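(* Each tight braided bimonoidal category is adjoint equivalent to a left permbraided category via strong braided bimonoidal functors. That is, for each tight braided bimonoidal category $C$ there exist a left permbraided category $A$ and an adjoint equivalence between the categories $C$ and $A$ in which both functors are strong braided bimonoidal functors.
   Context: Write $AB$ for $A\otimes B$; $\otimes$ binds tighter than $\oplus$. A bimonoidal category is a category $C$ with a symmetric monoidal structure $(\oplus,0,\alpha^\oplus,\lambda^\oplus,\rho^\oplus,\zeta^\oplus)$, a monoidal structure $(\otimes,1,\alpha^\otimes,\lambda^\otimes,\rho^\otimes)$ (with $\alpha_{A,B,C}:(AB)C\to A(BC)$, $\lambda_A$, $\rho_A$ the left/right unit isomorphisms), natural isomorphisms $\lambda^\bullet_A:0A\to0$, $\rho^\bullet_A:A0\to 0$, and natural monomorphisms $\delta^l_{A,B,C}:A(B\oplus C)\to AB\oplus AC$, $\delta^r_{A,B,C}:(A\oplus B)C\to AC\oplus BC$, such that for all objects: $\delta^l_{A,C,B}(1\otimes\zeta^\oplus_{B,C})=\zeta^\oplus_{AB,AC}\delta^l_{A,B,C}$; $\delta^r_{B,A,C}(\zeta^\oplus_{A,B}\otimes1)=\zeta^\oplus_{AC,BC}\delta^r_{A,B,C}$; $\alpha^\oplus(\delta^r_{A,B,D}\oplus1)\delta^r_{A\oplus B,C,D}=(1\oplus\delta^r_{B,C,D})\delta^r_{A,B\oplus C,D}(\alpha^\oplus_{A,B,C}\otimes1)$; $\alpha^\oplus(\delta^l_{A,B,C}\oplus1)\delta^l_{A,B\oplus C,D}=(1\oplus\delta^l_{A,C,D})\delta^l_{A,B,C\oplus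 D}(1\otimes\alpha^\oplus_{B,C,D})$; $\delta^l_{A,BC,BD}(1\otimes\delta^l_{B,C,D})\alpha^\otimes_{A,B,C\oplus D}=(\alpha^\otimes_{A,B,C}\oplus\alpha^\otimes_{A,B,D})\delta^l_{AB,C,D}$; $(\alpha^\otimes_{A,C,D}\oplus\alpha^\otimes_{B,C,D})\delta^r_{AC,BC,D}(\delta^r_{A,B,C}\otimes1)=\delta^r_{A,B,CD}\alpha^\otimes_{A\oplus B,C,D}$; $(\alpha^\otimes_{A,B,D}\oplus\alpha^\otimes_{A,C,D})\delta^r_{AB,AC,D}(\delta^l_{A,B,C}\otimes1)=\delta^l_{A,BD,CD}(1\otimes\delta^r_{B,C,D})\alpha^\otimes_{A,B\oplus C,D}$; $\mu(\delta^l_{A,C,D}\oplus\delta^l_{B,C,D})\delta^r_{A,B,C\oplus D}=(\delta^r_{A,B,C}\oplus\delta^r_{A,B,D})\delta^l_{A\oplus B,C,D}$, where $\mu:(AC\oplus AD)\oplus(BC\oplus BD)\to(AC\oplus BC)\oplus(AD\oplus BD)$ is the coherence isomorphism exchanging the two middle summands; $\lambda^\bullet_0=\rho^\bullet_0$; $\lambda^\oplus_0(\lambda^\bullet_A\oplus\lambda^\bullet_B)\delta^l_{0,A,B}=\lambda^\bullet_{A\oplus B}$; $\lambda^\oplus_0(\rho^\bullet_A\oplus\rho^\bullet_B)\delta^r_{A,B,0}=\rho^\bullet_{A\oplus B}$; $\rho^\otimes_0=\lambda^\bullet_1$; $\lambda^\otimes_0=\rho^\bullet_1$; $\lambda^\bullet_{AB}\alpha^\otimes_{0,A,B}=\lambda^\bullet_B(\lambda^\bullet_A\otimes1)$;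 $\rho^\bullet_A(1\otimes\lambda^\bullet_B)\alpha^\otimes_{A,0,B}=\lambda^\bullet_B(\rho^\bullet_A\otimes1)$; $\rho^\bullet_A(1\otimes\rho^\bullet_B)\alpha^\otimes_{A,B,0}=\rho^\bullet_{AB}$; $\lambda^\oplus_{AB}(\rho^\bullet_A\oplus1)\delta^l_{A,0,B}=1\otimes\lambda^\oplus_B$; $\lambda^\oplus_{BA}(\lambda^\bullet_A\oplus1)\delta^r_{0,B,A}=\lambda^\oplus_B\otimes1$; $\rho^\oplus_{AB}(1\oplus\rho^\bullet_A)\delta^l_{A,B,0}=1\otimes\rho^\oplus_B$; $\rho^\oplus_{AB}(1\oplus\lambda^\bullet_B)\delta^r_{A,0,B}=\rho^\oplus_A\otimes1$; $(\lambda^\otimes_A\oplus\lambda^\otimes_B)\delta^l_{1,A,B}=\lambda^\otimes_{A\oplus B}$; $(\rho^\otimes_A\oplus\rho^\otimes_B)\delta^r_{A,B,1}=\rho^\otimes_{A\oplus B}$. It is tight if $\delta^l,\delta^r$ are natural isomorphisms. A braided bimonoidal category is a bimonoidal category with a braiding $\zeta^\otimes$ making $\otimes$ braided monoidal, such that $\delta^l_{C,A,B}\zeta^\otimes_{A\oplus B,C}=(\zeta^\otimes_{A,C}\oplus\zeta^\otimes_{B,C})\delta^r_{A,B,C}$, $\delta^r_{B,C,A}\zeta^\otimes_{A,B\oplus C}=(\zeta^\otimes_{A,B}\oplus\zeta^\otimes_{A,C})\delta^l_{A,B,C}$, $\lambda^\bullet_A\zeta^\otimes_{A,0}=\rho^\bullet_A$,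 and $\rho^\bullet_A\zeta^\otimes_{0,A}=\lambda^\bullet_A$. A left permbraided category is a tight braided bimonoidal category whose additive and multiplicative structures are both strict monoidal, and for which $\lambda^\bullet$, $\rho^\bullet$, $\delta^l$, $\zeta^\otimes_{-,0}$ and $\zeta^\otimes_{0,-}$ are identities. A braided bimonoidal functor $F:C\to D$ is a functor with a symmetric monoidal structure $(F^2_\oplus,F^0_\oplus)$ with respect to $\oplus$ and a braided monoidal structure $(F^2_\otimes,F^0_\otimes)$ with respect to $\otimes$ (lax direction: $FA\otimes FB\to F(A\otimes B)$, $1\to F1$, etc.) such that $F(\lambda^\bullet_A)F^2_\otimes(F^0_\oplus\otimes1_{FA})=F^0_\oplus\lambda^\bullet_{FA}$ and $F(\delta^l_{A,B,C})F^2_\otimes(1\otimes F^2_\oplus)=F^2_\oplus(F^2_\otimes\oplus F^2_\otimes)\delta^l_{FA,FB,FC}$. It is strong if $F^2_\oplus,F^0_\oplus,F^2_\otimes,F^0_\otimes$ are all isomorphisms. *)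

theory Defs
  imports Main
begin

section \<open>Categories\<close>

record ('o, 'm) cat =
  Obj :: "'o set"
  Arr :: "'m set"
  Dom :: "'m \<Rightarrow> 'o"
  Cod :: "'m \<Rightarrow> 'o"
  Id :: "'o \<Rightarrow> 'm" ("\<iota>\<index>")
  Comp :: "'m \<Rightarrow> 'm \<Rightarrow> 'm" (infixr "\<cdot>\<index>" 55)

text \<open>\<open>g \<cdot> f\<close> is \<open>g\<close> after \<open>f\<close>. All operations are total functions; their values outside
  the carriers are irrelevant.\<close>

definition hom :: "('o, 'm, 'z) cat_scheme \<Rightarrow> 'o \<Rightarrow> 'o \<Rightarrow> 'm set" where
  "hom C a b = {f \<in> Arr C. Dom C f = a \<and> Cod C f = b}"

locale category =
  fixes C :: "('o, 'm, 'z) cat_scheme" (structure)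
  assumes dom_obj: "f \<in> Arr C \<Longrightarrow> Dom C f \<in> Obj C"
    and cod_obj: "f \<in> Arr C \<Longrightarrow> Cod C f \<in> Obj C"
    and id_hom: "a \<in> Obj C \<Longrightarrow> \<iota> a \<in> hom C a a"
    and comp_hom: "\<lbrakk>f \<in> hom C a b; g \<in> hom C b c\<rbrakk> \<Longrightarrow> g \<cdot> f \<in> hom C a c"
    and comp_id: "f \<in> hom C a b \<Longrightarrow> f \<cdot> \<iota> a = f"
    and id_comp: "f \<in> hom C a b \<Longrightarrow> \<iota> b \<cdot> f = f"
    and comp_assoc:
      "\<lbrakk>f \<in> hom C a b; g \<in> hom C b c; h \<in> hom C c d\<rbrakk> \<Longrightarrow> (h \<cdot> g) \<cdot> f = h \<cdot> (g \<cdot> f)"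

definition inverse_arrows :: "('o, 'm, 'z) cat_scheme \<Rightarrow> 'm \<Rightarrow> 'm \<Rightarrow> bool" where
  "inverse_arrows C f g \<longleftrightarrow>
     (\<exists>a b. f \<in> hom C a b \<and> g \<in> hom C b a \<and> Comp C g f = Id C a \<and> Comp C f g = Id C b)"

definition inv_arr :: "('o, 'm, 'z) cat_scheme \<Rightarrow> 'm \<Rightarrow> 'm" where
  "inv_arr C f = (THE g. inverse_arrows C f g)"

definition is_iso :: "('o, 'm, 'z) cat_scheme \<Rightarrow> 'm \<Rightarrow> bool" where
  "is_iso C f \<longleftrightarrow> (\<exists>g. inverse_arrows C f g)"

definition iso_hom :: "('o, 'm, 'z) cat_scheme \<Rightarrow> 'o \<Rightarrow> 'o \<Rightarrow> 'm set" where
  "iso_hom C a b = {f \<in> hom C a b. is_iso C f}"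

definition is_mono :: "('o, 'm, 'z) cat_scheme \<Rightarrow> 'm \<Rightarrow> bool" where
  "is_mono C f \<longleftrightarrow> f \<in> Arr C \<and>
     (\<forall>c. \<forall>g \<in> hom C c (Dom C f). \<forall>h \<in> hom C c (Dom C f).
        Comp C f g = Comp C f h \<longrightarrow> g = h)"

definition mono_hom :: "('o, 'm, 'z) cat_scheme \<Rightarrow> 'o \<Rightarrow> 'o \<Rightarrow> 'm set" where
  "mono_hom C a b = {f \<in> hom C a b. is_mono C f}"

text \<open>That a structural arrow, e.g. \<open>\<alpha> a b c\<close>, is an identity entails that its domain and
  codomain are equal objects.\<close>

definition is_identity :: "('o, 'm, 'z) cat_scheme \<Rightarrow> 'm \<Rightarrow> bool" where
  "is_identity C f \<longleftrightarrow> (\<exists>a \<in> Obj C. f = Id C a)"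


section \<open>Functors, natural isomorphisms, adjoint equivalences\<close>

record ('o, 'm, 'p, 'n) funct =
  fobj :: "'o \<Rightarrow> 'p"
  farr :: "'m \<Rightarrow> 'n"

locale cat_functor =
  source_cat: category C + target_cat: category D
  for C :: "('o, 'm, 'z) cat_scheme" and D :: "('p, 'n, 'y) cat_scheme" +
  fixes F :: "('o, 'm, 'p, 'n, 'x) funct_scheme"
  assumes fobj_obj: "a \<in> Obj C \<Longrightarrow> fobj F a \<in> Obj D"
    and farr_hom: "f \<in> hom C a b \<Longrightarrow> farr F f \<in> hom D (fobj F a) (fobj F b)"
    and farr_id: "a \<in> Obj C \<Longrightarrow> farr F (\<iota>\<^bsub>C\<^esub> a) = \<iota>\<^bsub>D\<^esub> (fobj F a)"
    and farr_comp:
      "\<lbrakk>f \<in> hom C a b; g \<in> hom C b c\<rbrakk> \<Longrightarrow> farr F (g \<cdot>\<^bsub>C\<^esub> f) = farr F g \<cdot>\<^bsub>D\<^esub> farr F f"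

definition id_funct :: "('o, 'm, 'o, 'm) funct" where
  "id_funct = \<lparr>fobj = (\<lambda>a. a), farr = (\<lambda>f. f)\<rparr>"

definition comp_funct ::
  "('p, 'n, 'q, 'k, 'x) funct_scheme \<Rightarrow> ('o, 'm, 'p, 'n, 'y) funct_scheme \<Rightarrow> ('o, 'm, 'q, 'k) funct" where
  "comp_funct G F = \<lparr>fobj = (\<lambda>a. fobj G (fobj F a)), farr = (\<lambda>f. farr G (farr F f))\<rparr>"

locale natural_isomorphism =
  dom_functor: cat_functor C D F + cod_functor: cat_functor C D G
  for C :: "('o, 'm, 'z) cat_scheme" and D :: "('p, 'n, 'y) cat_scheme"
    and F :: "('o, 'm, 'p, 'n, 'x) funct_scheme" and G :: "('o, 'm, 'p, 'n, 'w) funct_scheme" +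
  fixes \<tau> :: "'o \<Rightarrow> 'n"
  assumes component: "a \<in> Obj C \<Longrightarrow> \<tau> a \<in> iso_hom D (fobj F a) (fobj G a)"
    and natural: "f \<in> hom C a b \<Longrightarrow> \<tau> b \<cdot>\<^bsub>D\<^esub> farr F f = farr G f \<cdot>\<^bsub>D\<^esub> \<tau> a"

locale adjoint_equivalence =
  left: cat_functor C D F + right: cat_functor D C G +
  unit: natural_isomorphism C C id_funct "comp_funct G F" \<eta> +
  counit: natural_isomorphism D D "comp_funct F G" id_funct \<epsilon>
  for C :: "('o, 'm, 'z) cat_scheme" and D :: "('p, 'n, 'y) cat_scheme"
    and F :: "('o, 'm, 'p, 'n, 'x) funct_scheme" and G :: "('p, 'n, 'o, 'm, 'w) funct_scheme"
    and \<eta> :: "'o \<Rightarrow> 'm" and \<epsilon> :: "'p \<Rightarrow> 'n" +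
  assumes triangle_left: "a \<in> Obj C \<Longrightarrow> \<epsilon> (fobj F a) \<cdot>\<^bsub>D\<^esub> farr F (\<eta> a) = \<iota>\<^bsub>D\<^esub> (fobj F a)"
    and triangle_right: "b \<in> Obj D \<Longrightarrow> farr G (\<epsilon> b) \<cdot>\<^bsub>C\<^esub> \<eta> (fobj G b) = \<iota>\<^bsub>C\<^esub> (fobj G b)"


section \<open>Monoidal categories and functors\<close>

text \<open>\<open>\<otimes>\<close> is the tensor product on objects, \<open>\<boxtimes>\<close> the one on arrows.\<close>

locale monoidal_category = category C
  for C :: "('o, 'm, 'z) cat_scheme" (structure) +
  fixes tensor_obj :: "'o \<Rightarrow> 'o \<Rightarrow> 'o" (infixl "\<otimes>" 70)
    and tensor_arr :: "'m \<Rightarrow> 'm \<Rightarrow> 'm" (infixl "\<boxtimes>" 70)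
    and unit_obj :: "'o" ("\<I>")
    and \<alpha> :: "'o \<Rightarrow> 'o \<Rightarrow> 'o \<Rightarrow> 'm"
    and l :: "'o \<Rightarrow> 'm"
    and r :: "'o \<Rightarrow> 'm"
  assumes tensor_obj: "\<lbrakk>a \<in> Obj C; b \<in> Obj C\<rbrakk> \<Longrightarrow> a \<otimes> b \<in> Obj C"
    and tensor_hom:
      "\<lbrakk>f \<in> hom C a a'; g \<in> hom C b b'\<rbrakk> \<Longrightarrow> f \<boxtimes> g \<in> hom C (a \<otimes> b) (a' \<otimes> b')"
    and tensor_id: "\<lbrakk>a \<in> Obj C; b \<in> Obj C\<rbrakk> \<Longrightarrow> \<iota> a \<boxtimes> \<iota> b = \<iota> (a \<otimes> b)"
    and tensor_comp:
      "\<lbrakk>f \<in> hom C a a'; f' \<in> hom C a' a''; g \<in> hom C b b'; g' \<in> hom C b' b''\<rbrakk>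
        \<Longrightarrow> (f' \<cdot> f) \<boxtimes> (g' \<cdot> g) = (f' \<boxtimes> g') \<cdot> (f \<boxtimes> g)"
    and unit_obj: "\<I> \<in> Obj C"
    and assoc_iso: "\<lbrakk>a \<in> Obj C; b \<in> Obj C; c \<in> Obj C\<rbrakk>
        \<Longrightarrow> \<alpha> a b c \<in> iso_hom C ((a \<otimes> b) \<otimes> c) (a \<otimes> (b \<otimes> c))"
    and assoc_natural:
      "\<lbrakk>f \<in> hom C a a'; g \<in> hom C b b'; h \<in> hom C c c'\<rbrakk>
        \<Longrightarrow> \<alpha> a' b' c' \<cdot> ((f \<boxtimes> g) \<boxtimes> h) = (f \<boxtimes> (g \<boxtimes> h)) \<cdot> \<alpha> a b c"
    and lunit_iso: "a \<in> Obj C \<Longrightarrow> l a \<in> iso_hom C (\<I> \<otimes> a) a"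
    and lunit_natural: "f \<in> hom C a b \<Longrightarrow> l b \<cdot> (\<iota> \<I> \<boxtimes> f) = f \<cdot> l a"
    and runit_iso: "a \<in> Obj C \<Longrightarrow> r a \<in> iso_hom C (a \<otimes> \<I>) a"
    and runit_natural: "f \<in> hom C a b \<Longrightarrow> r b \<cdot> (f \<boxtimes> \<iota> \<I>) = f \<cdot> r a"
    and pentagon: "\<lbrakk>a \<in> Obj C; b \<in> Obj C; c \<in> Obj C; d \<in> Obj C\<rbrakk>
        \<Longrightarrow> (\<iota> a \<boxtimes> \<alpha> b c d) \<cdot> \<alpha> a (b \<otimes> c) d \<cdot> (\<alpha> a b c \<boxtimes> \<iota> d)
          = \<alpha> a b (c \<otimes> d) \<cdot> \<alpha> (a \<otimes> b) c d"
    and triangle: "\<lbrakk>a \<in> Obj C; b \<in> Obj C\<rbrakk>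
        \<Longrightarrow> (\<iota> a \<boxtimes> l b) \<cdot> \<alpha> a \<I> b = r a \<boxtimes> \<iota> b"

locale strict_monoidal_category = monoidal_category +
  assumes assoc_strict: "\<lbrakk>a \<in> Obj C; b \<in> Obj C; c \<in> Obj C\<rbrakk> \<Longrightarrow> is_identity C (\<alpha> a b c)"
    and lunit_strict: "a \<in> Obj C \<Longrightarrow> is_identity C (l a)"
    and runit_strict: "a \<in> Obj C \<Longrightarrow> is_identity C (r a)"

locale braided_monoidal_category = monoidal_category +
  fixes \<zeta> :: "'a \<Rightarrow> 'a \<Rightarrow> 'b"
  assumes braid_iso: "\<lbrakk>a \<in> Obj C; b \<in> Obj C\<rbrakk> \<Longrightarrow> \<zeta> a b \<in> iso_hom C (a \<otimes> b) (b \<otimes> a)"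
    and braid_natural:
      "\<lbrakk>f \<in> hom C a a'; g \<in> hom C b b'\<rbrakk> \<Longrightarrow> \<zeta> a' b' \<cdot> (f \<boxtimes> g) = (g \<boxtimes> f) \<cdot> \<zeta> a b"
    and hexagon1: "\<lbrakk>a \<in> Obj C; b \<in> Obj C; c \<in> Obj C\<rbrakk>
        \<Longrightarrow> \<alpha> b c a \<cdot> \<zeta> a (b \<otimes> c) \<cdot> \<alpha> a b c
          = (\<iota> b \<boxtimes> \<zeta> a c) \<cdot> \<alpha> b a c \<cdot> (\<zeta> a b \<boxtimes> \<iota> c)"
    and hexagon2: "\<lbrakk>a \<in> Obj C; b \<in> Obj C; c \<in> Obj C\<rbrakk>
        \<Longrightarrow> inv_arr C (\<alpha> c a b) \<cdot> \<zeta> (a \<otimes> b) c \<cdot> inv_arr C (\<alpha> a b c)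
          = (\<zeta> a c \<boxtimes> \<iota> b) \<cdot> inv_arr C (\<alpha> a c b) \<cdot> (\<iota> a \<boxtimes> \<zeta> b c)"

locale symmetric_monoidal_category = braided_monoidal_category +
  assumes symmetry: "\<lbrakk>a \<in> Obj C; b \<in> Obj C\<rbrakk> \<Longrightarrow> \<zeta> b a \<cdot> \<zeta> a b = \<iota> (a \<otimes> b)"

text \<open>Monoidal functors are lax: \<open>F2 a b : F a \<otimes> F b \<rightarrow> F (a \<otimes> b)\<close> and \<open>F0 : \<I> \<rightarrow> F \<I>\<close>.\<close>

locale monoidal_functor =
  cat_functor C D F +
  source: monoidal_category C tensor_obj tensor_arr unit_obj \<alpha> l r +
  target: monoidal_category D tensor_obj' tensor_arr' unit_obj' \<alpha>' l' r'
  for C :: "('o, 'm, 'z) cat_scheme"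
    and tensor_obj (infixl "\<otimes>" 70) and tensor_arr (infixl "\<boxtimes>" 70) and unit_obj ("\<I>")
    and \<alpha> and l and r
    and D :: "('p, 'n, 'y) cat_scheme"
    and tensor_obj' (infixl "\<otimes>''" 70) and tensor_arr' (infixl "\<boxtimes>''" 70) and unit_obj' ("\<I>''")
    and \<alpha>' and l' and r'
    and F :: "('o, 'm, 'p, 'n, 'x) funct_scheme" +
  fixes F2 :: "'o \<Rightarrow> 'o \<Rightarrow> 'n" and F0 :: "'n"
  assumes F2_hom: "\<lbrakk>a \<in> Obj C; b \<in> Obj C\<rbrakk>
        \<Longrightarrow> F2 a b \<in> hom D (fobj F a \<otimes>' fobj F b) (fobj F (a \<otimes> b))"
    and F2_natural: "\<lbrakk>f \<in> hom C a a'; g \<in> hom C b b'\<rbrakk>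
        \<Longrightarrow> F2 a' b' \<cdot>\<^bsub>D\<^esub> (farr F f \<boxtimes>' farr F g) = farr F (f \<boxtimes> g) \<cdot>\<^bsub>D\<^esub> F2 a b"
    and F0_hom: "F0 \<in> hom D \<I>' (fobj F \<I>)"
    and F2_assoc: "\<lbrakk>a \<in> Obj C; b \<in> Obj C; c \<in> Obj C\<rbrakk>
        \<Longrightarrow> farr F (\<alpha> a b c) \<cdot>\<^bsub>D\<^esub> F2 (a \<otimes> b) c \<cdot>\<^bsub>D\<^esub> (F2 a b \<boxtimes>' \<iota>\<^bsub>D\<^esub> (fobj F c))
          = F2 a (b \<otimes> c) \<cdot>\<^bsub>D\<^esub> (\<iota>\<^bsub>D\<^esub> (fobj F a) \<boxtimes>' F2 b c) \<cdot>\<^bsub>D\<^esub> \<alpha>' (fobj F a) (fobj F b) (fobj F c)"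
    and F2_lunit: "a \<in> Obj C
        \<Longrightarrow> farr F (l a) \<cdot>\<^bsub>D\<^esub> F2 \<I> a \<cdot>\<^bsub>D\<^esub> (F0 \<boxtimes>' \<iota>\<^bsub>D\<^esub> (fobj F a)) = l' (fobj F a)"
    and F2_runit: "a \<in> Obj C
        \<Longrightarrow> farr F (r a) \<cdot>\<^bsub>D\<^esub> F2 a \<I> \<cdot>\<^bsub>D\<^esub> (\<iota>\<^bsub>D\<^esub> (fobj F a) \<boxtimes>' F0) = r' (fobj F a)"

text \<open>A symmetric monoidal functor is a braided monoidal functor between symmetric monoidal
  categories, so this locale serves for both.\<close>

locale braided_monoidal_functor =
  monoidal_functor C tensor_obj tensor_arr unit_obj \<alpha> l r
    D tensor_obj' tensor_arr' unit_obj' \<alpha>' l' r' F F2 F0 +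
  source: braided_monoidal_category C tensor_obj tensor_arr unit_obj \<alpha> l r \<zeta> +
  target: braided_monoidal_category D tensor_obj' tensor_arr' unit_obj' \<alpha>' l' r' \<zeta>'
  for C :: "('o, 'm, 'z) cat_scheme"
    and tensor_obj (infixl "\<otimes>" 70) and tensor_arr (infixl "\<boxtimes>" 70) and unit_obj ("\<I>")
    and \<alpha> and l and r and \<zeta>
    and D :: "('p, 'n, 'y) cat_scheme"
    and tensor_obj' (infixl "\<otimes>''" 70) and tensor_arr' (infixl "\<boxtimes>''" 70) and unit_obj' ("\<I>''")
    and \<alpha>' and l' and r' and \<zeta>'
    and F :: "('o, 'm, 'p, 'n, 'x) funct_scheme" and F2 and F0 +
  assumes F2_braid: "\<lbrakk>a \<in> Obj C; b \<in> Obj C\<rbrakk>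
        \<Longrightarrow> farr F (\<zeta> a b) \<cdot>\<^bsub>D\<^esub> F2 a b = F2 b a \<cdot>\<^bsub>D\<^esub> \<zeta>' (fobj F a) (fobj F b)"


section \<open>Bimonoidal categories\<close>

text \<open>\<open>\<oplus>\<close> and \<open>\<otimes>\<close> act on objects, \<open>\<boxplus>\<close> and \<open>\<boxtimes>\<close> on arrows.\<close>

record ('o, 'm) bimon = "('o, 'm) cat" +
  add_obj :: "'o \<Rightarrow> 'o \<Rightarrow> 'o" (infixl "\<oplus>\<index>" 65)
  add_arr :: "'m \<Rightarrow> 'm \<Rightarrow> 'm" (infixl "\<boxplus>\<index>" 65)
  zero_obj :: "'o" ("\<zero>\<index>")
  add_assoc :: "'o \<Rightarrow> 'o \<Rightarrow> 'o \<Rightarrow> 'm" ("\<alpha>\<^sup>\<oplus>\<index>")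
  add_lunit :: "'o \<Rightarrow> 'm" ("\<lambda>\<^sup>\<oplus>\<index>")
  add_runit :: "'o \<Rightarrow> 'm" ("\<rho>\<^sup>\<oplus>\<index>")
  add_braid :: "'o \<Rightarrow> 'o \<Rightarrow> 'm" ("\<zeta>\<^sup>\<oplus>\<index>")
  mul_obj :: "'o \<Rightarrow> 'o \<Rightarrow> 'o" (infixl "\<otimes>\<index>" 70)
  mul_arr :: "'m \<Rightarrow> 'm \<Rightarrow> 'm" (infixl "\<boxtimes>\<index>" 70)
  one_obj :: "'o" ("\<one>\<index>")
  mul_assoc :: "'o \<Rightarrow> 'o \<Rightarrow> 'o \<Rightarrow> 'm" ("\<alpha>\<^sup>\<otimes>\<index>")
  mul_lunit :: "'o \<Rightarrow> 'm" ("\<lambda>\<^sup>\<otimes>\<index>")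
  mul_runit :: "'o \<Rightarrow> 'm" ("\<rho>\<^sup>\<otimes>\<index>")
  lnull :: "'o \<Rightarrow> 'm" ("\<lambda>\<^sup>\<bullet>\<index>")
  rnull :: "'o \<Rightarrow> 'm" ("\<rho>\<^sup>\<bullet>\<index>")
  ldist :: "'o \<Rightarrow> 'o \<Rightarrow> 'o \<Rightarrow> 'm" ("\<delta>\<^sup>l\<index>")
  rdist :: "'o \<Rightarrow> 'o \<Rightarrow> 'o \<Rightarrow> 'm" ("\<delta>\<^sup>r\<index>")

record ('o, 'm) braided_bimon = "('o, 'm) bimon" +
  mul_braid :: "'o \<Rightarrow> 'o \<Rightarrow> 'm" ("\<zeta>\<^sup>\<otimes>\<index>")

text \<open>The canonical isomorphism
  \<open>(a \<oplus> b) \<oplus> (c \<oplus> d) \<rightarrow> (a \<oplus> c) \<oplus> (b \<oplus> d)\<close>, written out with associators and symmetry.\<close>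

definition exchange :: "('o, 'm, 'z) bimon_scheme \<Rightarrow> 'o \<Rightarrow> 'o \<Rightarrow> 'o \<Rightarrow> 'o \<Rightarrow> 'm" ("\<mu>\<index>") where
  "exchange B a b c d =
     inv_arr B (\<alpha>\<^sup>\<oplus>\<^bsub>B\<^esub> a c (b \<oplus>\<^bsub>B\<^esub> d)) \<cdot>\<^bsub>B\<^esub>
     (\<iota>\<^bsub>B\<^esub> a \<boxplus>\<^bsub>B\<^esub>
        (\<alpha>\<^sup>\<oplus>\<^bsub>B\<^esub> c b d \<cdot>\<^bsub>B\<^esub> (\<zeta>\<^sup>\<oplus>\<^bsub>B\<^esub> b c \<boxplus>\<^bsub>B\<^esub> \<iota>\<^bsub>B\<^esub> d) \<cdot>\<^bsub>B\<^esub> inv_arr B (\<alpha>\<^sup>\<oplus>\<^bsub>B\<^esub> b c d))) \<cdot>\<^bsub>B\<^esub>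
     \<alpha>\<^sup>\<oplus>\<^bsub>B\<^esub> a b (c \<oplus>\<^bsub>B\<^esub> d)"

locale bimonoidal_category =
  add: symmetric_monoidal_category B "add_obj B" "add_arr B" "zero_obj B"
    "add_assoc B" "add_lunit B" "add_runit B" "add_braid B" +
  mul: monoidal_category B "mul_obj B" "mul_arr B" "one_obj B"
    "mul_assoc B" "mul_lunit B" "mul_runit B"
  for B :: "('o, 'm, 'z) bimon_scheme" (structure) +
  assumes lnull_iso: "a \<in> Obj B \<Longrightarrow> \<lambda>\<^sup>\<bullet> a \<in> iso_hom B (\<zero> \<otimes> a) \<zero>"
    and lnull_natural: "f \<in> hom B a b \<Longrightarrow> \<lambda>\<^sup>\<bullet> b \<cdot> (\<iota> \<zero> \<boxtimes> f) = \<lambda>\<^sup>\<bullet> a"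
    and rnull_iso: "a \<in> Obj B \<Longrightarrow> \<rho>\<^sup>\<bullet> a \<in> iso_hom B (a \<otimes> \<zero>) \<zero>"
    and rnull_natural: "f \<in> hom B a b \<Longrightarrow> \<rho>\<^sup>\<bullet> b \<cdot> (f \<boxtimes> \<iota> \<zero>) = \<rho>\<^sup>\<bullet> a"
    and ldist_mono: "\<lbrakk>a \<in> Obj B; b \<in> Obj B; c \<in> Obj B\<rbrakk>
        \<Longrightarrow> \<delta>\<^sup>l a b c \<in> mono_hom B (a \<otimes> (b \<oplus> c)) (a \<otimes> b \<oplus> a \<otimes> c)"
    and ldist_natural: "\<lbrakk>f \<in> hom B a a'; g \<in> hom B b b'; h \<in> hom B c c'\<rbrakk>
        \<Longrightarrow> \<delta>\<^sup>l a' b' c' \<cdot> (f \<boxtimes> (g \<boxplus> h)) = (f \<boxtimes> g \<boxplus> f \<boxtimes> h) \<cdot> \<delta>\<^sup>l a b c"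
    and rdist_mono: "\<lbrakk>a \<in> Obj B; b \<in> Obj B; c \<in> Obj B\<rbrakk>
        \<Longrightarrow> \<delta>\<^sup>r a b c \<in> mono_hom B ((a \<oplus> b) \<otimes> c) (a \<otimes> c \<oplus> b \<otimes> c)"
    and rdist_natural: "\<lbrakk>f \<in> hom B a a'; g \<in> hom B b b'; h \<in> hom B c c'\<rbrakk>
        \<Longrightarrow> \<delta>\<^sup>r a' b' c' \<cdot> ((f \<boxplus> g) \<boxtimes> h) = (f \<boxtimes> h \<boxplus> g \<boxtimes> h) \<cdot> \<delta>\<^sup>r a b c"
    and ldist_braid: "\<lbrakk>a \<in> Obj B; b \<in> Obj B; c \<in> Obj B\<rbrakk>
        \<Longrightarrow> \<delta>\<^sup>l a c b \<cdot> (\<iota> a \<boxtimes> \<zeta>\<^sup>\<oplus> b c) = \<zeta>\<^sup>\<oplus> (a \<otimes> b) (a \<otimes> c) \<cdot> \<delta>\<^sup>l a b c"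
    and rdist_braid: "\<lbrakk>a \<in> Obj B; b \<in> Obj B; c \<in> Obj B\<rbrakk>
        \<Longrightarrow> \<delta>\<^sup>r b a c \<cdot> (\<zeta>\<^sup>\<oplus> a b \<boxtimes> \<iota> c) = \<zeta>\<^sup>\<oplus> (a \<otimes> c) (b \<otimes> c) \<cdot> \<delta>\<^sup>r a b c"
    and rdist_add_assoc: "\<lbrakk>a \<in> Obj B; b \<in> Obj B; c \<in> Obj B; d \<in> Obj B\<rbrakk>
        \<Longrightarrow> \<alpha>\<^sup>\<oplus> (a \<otimes> d) (b \<otimes> d) (c \<otimes> d) \<cdot> (\<delta>\<^sup>r a b d \<boxplus> \<iota> (c \<otimes> d)) \<cdot> \<delta>\<^sup>r (a \<oplus> b) c d
          = (\<iota> (a \<otimes> d) \<boxplus> \<delta>\<^sup>r b c d) \<cdot> \<delta>\<^sup>r a (b \<oplus> c) d \<cdot> (\<alpha>\<^sup>\<oplus> a b c \<boxtimes> \<iota> d)"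
    and ldist_add_assoc: "\<lbrakk>a \<in> Obj B; b \<in> Obj B; c \<in> Obj B; d \<in> Obj B\<rbrakk>
        \<Longrightarrow> \<alpha>\<^sup>\<oplus> (a \<otimes> b) (a \<otimes> c) (a \<otimes> d) \<cdot> (\<delta>\<^sup>l a b c \<boxplus> \<iota> (a \<otimes> d)) \<cdot> \<delta>\<^sup>l a (b \<oplus> c) d
          = (\<iota> (a \<otimes> b) \<boxplus> \<delta>\<^sup>l a c d) \<cdot> \<delta>\<^sup>l a b (c \<oplus> d) \<cdot> (\<iota> a \<boxtimes> \<alpha>\<^sup>\<oplus> b c d)"
    and ldist_mul_assoc: "\<lbrakk>a \<in> Obj B; b \<in> Obj B; c \<in> Obj B; d \<in> Obj B\<rbrakk>
        \<Longrightarrow> \<delta>\<^sup>l a (b \<otimes> c) (b \<otimes> d) \<cdot> (\<iota> a \<boxtimes> \<delta>\<^sup>l b c d) \<cdot> \<alpha>\<^sup>\<otimes> a b (c \<oplus> d)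
          = (\<alpha>\<^sup>\<otimes> a b c \<boxplus> \<alpha>\<^sup>\<otimes> a b d) \<cdot> \<delta>\<^sup>l (a \<otimes> b) c d"
    and rdist_mul_assoc: "\<lbrakk>a \<in> Obj B; b \<in> Obj B; c \<in> Obj B; d \<in> Obj B\<rbrakk>
        \<Longrightarrow> (\<alpha>\<^sup>\<otimes> a c d \<boxplus> \<alpha>\<^sup>\<otimes> b c d) \<cdot> \<delta>\<^sup>r (a \<otimes> c) (b \<otimes> c) d \<cdot> (\<delta>\<^sup>r a b c \<boxtimes> \<iota> d)
          = \<delta>\<^sup>r a b (c \<otimes> d) \<cdot> \<alpha>\<^sup>\<otimes> (a \<oplus> b) c d"
    and lrdist_mul_assoc: "\<lbrakk>a \<in> Obj B; b \<in> Obj B; c \<in> Obj B; d \<in> Obj B\<rbrakk>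
        \<Longrightarrow> (\<alpha>\<^sup>\<otimes> a b d \<boxplus> \<alpha>\<^sup>\<otimes> a c d) \<cdot> \<delta>\<^sup>r (a \<otimes> b) (a \<otimes> c) d \<cdot> (\<delta>\<^sup>l a b c \<boxtimes> \<iota> d)
          = \<delta>\<^sup>l a (b \<otimes> d) (c \<otimes> d) \<cdot> (\<iota> a \<boxtimes> \<delta>\<^sup>r b c d) \<cdot> \<alpha>\<^sup>\<otimes> a (b \<oplus> c) d"
    and ldist_rdist: "\<lbrakk>a \<in> Obj B; b \<in> Obj B; c \<in> Obj B; d \<in> Obj B\<rbrakk>
        \<Longrightarrow> \<mu> (a \<otimes> c) (a \<otimes> d) (b \<otimes> c) (b \<otimes> d) \<cdot> (\<delta>\<^sup>l a c d \<boxplus> \<delta>\<^sup>l b c d) \<cdot> \<delta>\<^sup>r a b (c \<oplus> d)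
          = (\<delta>\<^sup>r a b c \<boxplus> \<delta>\<^sup>r a b d) \<cdot> \<delta>\<^sup>l (a \<oplus> b) c d"
    and lnull_zero: "\<lambda>\<^sup>\<bullet> \<zero> = \<rho>\<^sup>\<bullet> \<zero>"
    and lnull_add: "\<lbrakk>a \<in> Obj B; b \<in> Obj B\<rbrakk>
        \<Longrightarrow> \<lambda>\<^sup>\<oplus> \<zero> \<cdot> (\<lambda>\<^sup>\<bullet> a \<boxplus> \<lambda>\<^sup>\<bullet> b) \<cdot> \<delta>\<^sup>l \<zero> a b = \<lambda>\<^sup>\<bullet> (a \<oplus> b)"
    and rnull_add: "\<lbrakk>a \<in> Obj B; b \<in> Obj B\<rbrakk>
        \<Longrightarrow> \<lambda>\<^sup>\<oplus> \<zero> \<cdot> (\<rho>\<^sup>\<bullet> a \<boxplus> \<rho>\<^sup>\<bullet> b) \<cdot> \<delta>\<^sup>r a b \<zero> = \<rho>\<^sup>\<bullet> (a \<oplus> b)"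
    and mul_runit_zero: "\<rho>\<^sup>\<otimes> \<zero> = \<lambda>\<^sup>\<bullet> \<one>"
    and mul_lunit_zero: "\<lambda>\<^sup>\<otimes> \<zero> = \<rho>\<^sup>\<bullet> \<one>"
    and lnull_mul: "\<lbrakk>a \<in> Obj B; b \<in> Obj B\<rbrakk>
        \<Longrightarrow> \<lambda>\<^sup>\<bullet> (a \<otimes> b) \<cdot> \<alpha>\<^sup>\<otimes> \<zero> a b = \<lambda>\<^sup>\<bullet> b \<cdot> (\<lambda>\<^sup>\<bullet> a \<boxtimes> \<iota> b)"
    and lrnull_mul: "\<lbrakk>a \<in> Obj B; b \<in> Obj B\<rbrakk>
        \<Longrightarrow> \<rho>\<^sup>\<bullet> a \<cdot> (\<iota> a \<boxtimes> \<lambda>\<^sup>\<bullet> b) \<cdot> \<alpha>\<^sup>\<otimes> a \<zero> b = \<lambda>\<^sup>\<bullet> b \<cdot> (\<rho>\<^sup>\<bullet> a \<boxtimes> \<iota> b)"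
    and rnull_mul: "\<lbrakk>a \<in> Obj B; b \<in> Obj B\<rbrakk>
        \<Longrightarrow> \<rho>\<^sup>\<bullet> a \<cdot> (\<iota> a \<boxtimes> \<rho>\<^sup>\<bullet> b) \<cdot> \<alpha>\<^sup>\<otimes> a b \<zero> = \<rho>\<^sup>\<bullet> (a \<otimes> b)"
    and ldist_lzero: "\<lbrakk>a \<in> Obj B; b \<in> Obj B\<rbrakk>
        \<Longrightarrow> \<lambda>\<^sup>\<oplus> (a \<otimes> b) \<cdot> (\<rho>\<^sup>\<bullet> a \<boxplus> \<iota> (a \<otimes> b)) \<cdot> \<delta>\<^sup>l a \<zero> b = \<iota> a \<boxtimes> \<lambda>\<^sup>\<oplus> b"
    and rdist_lzero: "\<lbrakk>a \<in> Obj B; b \<in> Obj B\<rbrakk>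
        \<Longrightarrow> \<lambda>\<^sup>\<oplus> (b \<otimes> a) \<cdot> (\<lambda>\<^sup>\<bullet> a \<boxplus> \<iota> (b \<otimes> a)) \<cdot> \<delta>\<^sup>r \<zero> b a = \<lambda>\<^sup>\<oplus> b \<boxtimes> \<iota> a"
    and ldist_rzero: "\<lbrakk>a \<in> Obj B; b \<in> Obj B\<rbrakk>
        \<Longrightarrow> \<rho>\<^sup>\<oplus> (a \<otimes> b) \<cdot> (\<iota> (a \<otimes> b) \<boxplus> \<rho>\<^sup>\<bullet> a) \<cdot> \<delta>\<^sup>l a b \<zero> = \<iota> a \<boxtimes> \<rho>\<^sup>\<oplus> b"
    and rdist_rzero: "\<lbrakk>a \<in> Obj B; b \<in> Obj B\<rbrakk>
        \<Longrightarrow> \<rho>\<^sup>\<oplus> (a \<otimes> b) \<cdot> (\<iota> (a \<otimes> b) \<boxplus> \<lambda>\<^sup>\<bullet> b) \<cdot> \<delta>\<^sup>r a \<zero> b = \<rho>\<^sup>\<oplus> a \<boxtimes> \<iota> b"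
    and ldist_one: "\<lbrakk>a \<in> Obj B; b \<in> Obj B\<rbrakk>
        \<Longrightarrow> (\<lambda>\<^sup>\<otimes> a \<boxplus> \<lambda>\<^sup>\<otimes> b) \<cdot> \<delta>\<^sup>l \<one> a b = \<lambda>\<^sup>\<otimes> (a \<oplus> b)"
    and rdist_one: "\<lbrakk>a \<in> Obj B; b \<in> Obj B\<rbrakk>
        \<Longrightarrow> (\<rho>\<^sup>\<otimes> a \<boxplus> \<rho>\<^sup>\<otimes> b) \<cdot> \<delta>\<^sup>r a b \<one> = \<rho>\<^sup>\<otimes> (a \<oplus> b)"

locale braided_bimonoidal_category =
  bimonoidal_category B +
  mul: braided_monoidal_category B "mul_obj B" "mul_arr B" "one_obj B"
    "mul_assoc B" "mul_lunit B" "mul_runit B" "mul_braid B"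
  for B :: "('o, 'm, 'z) braided_bimon_scheme" (structure) +
  assumes ldist_mul_braid: "\<lbrakk>a \<in> Obj B; b \<in> Obj B; c \<in> Obj B\<rbrakk>
        \<Longrightarrow> \<delta>\<^sup>l c a b \<cdot> \<zeta>\<^sup>\<otimes> (a \<oplus> b) c = (\<zeta>\<^sup>\<otimes> a c \<boxplus> \<zeta>\<^sup>\<otimes> b c) \<cdot> \<delta>\<^sup>r a b c"
    and rdist_mul_braid: "\<lbrakk>a \<in> Obj B; b \<in> Obj B; c \<in> Obj B\<rbrakk>
        \<Longrightarrow> \<delta>\<^sup>r b c a \<cdot> \<zeta>\<^sup>\<otimes> a (b \<oplus> c) = (\<zeta>\<^sup>\<otimes> a b \<boxplus> \<zeta>\<^sup>\<otimes> a c) \<cdot> \<delta>\<^sup>l a b c"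
    and lnull_mul_braid: "a \<in> Obj B \<Longrightarrow> \<lambda>\<^sup>\<bullet> a \<cdot> \<zeta>\<^sup>\<otimes> a \<zero> = \<rho>\<^sup>\<bullet> a"
    and rnull_mul_braid: "a \<in> Obj B \<Longrightarrow> \<rho>\<^sup>\<bullet> a \<cdot> \<zeta>\<^sup>\<otimes> \<zero> a = \<lambda>\<^sup>\<bullet> a"

locale tight_braided_bimonoidal_category = braided_bimonoidal_category +
  assumes ldist_iso: "\<lbrakk>a \<in> Obj B; b \<in> Obj B; c \<in> Obj B\<rbrakk> \<Longrightarrow> is_iso B (\<delta>\<^sup>l a b c)"
    and rdist_iso: "\<lbrakk>a \<in> Obj B; b \<in> Obj B; c \<in> Obj B\<rbrakk> \<Longrightarrow> is_iso B (\<delta>\<^sup>r a b c)"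

locale left_permbraided_category =
  tight_braided_bimonoidal_category B +
  add: strict_monoidal_category B "add_obj B" "add_arr B" "zero_obj B"
    "add_assoc B" "add_lunit B" "add_runit B" +
  mul: strict_monoidal_category B "mul_obj B" "mul_arr B" "one_obj B"
    "mul_assoc B" "mul_lunit B" "mul_runit B"
  for B :: "('o, 'm, 'z) braided_bimon_scheme" (structure) +
  assumes lnull_strict: "a \<in> Obj B \<Longrightarrow> is_identity B (\<lambda>\<^sup>\<bullet> a)"
    and rnull_strict: "a \<in> Obj B \<Longrightarrow> is_identity B (\<rho>\<^sup>\<bullet> a)"
    and ldist_strict: "\<lbrakk>a \<in> Obj B; b \<in> Obj B; c \<in> Obj B\<rbrakk> \<Longrightarrow> is_identity B (\<delta>\<^sup>l a b c)"
    and mul_braid_rzero_strict: "a \<in> Obj B \<Longrightarrow> is_identity B (\<zeta>\<^sup>\<otimes> a \<zero>)"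
    and mul_braid_lzero_strict: "a \<in> Obj B \<Longrightarrow> is_identity B (\<zeta>\<^sup>\<otimes> \<zero> a)"


section \<open>Braided bimonoidal functors\<close>

record ('o, 'm, 'p, 'n) bimon_funct = "('o, 'm, 'p, 'n) funct" +
  add2 :: "'o \<Rightarrow> 'o \<Rightarrow> 'n"
  add0 :: "'n"
  mul2 :: "'o \<Rightarrow> 'o \<Rightarrow> 'n"
  mul0 :: "'n"

locale braided_bimonoidal_functor =
  source: braided_bimonoidal_category C + target: braided_bimonoidal_category D +
  add: braided_monoidal_functor
    C "add_obj C" "add_arr C" "zero_obj C" "add_assoc C" "add_lunit C" "add_runit C" "add_braid C"
    D "add_obj D" "add_arr D" "zero_obj D" "add_assoc D" "add_lunit D" "add_runit D" "add_braid D"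
    F "add2 F" "add0 F" +
  mul: braided_monoidal_functor
    C "mul_obj C" "mul_arr C" "one_obj C" "mul_assoc C" "mul_lunit C" "mul_runit C" "mul_braid C"
    D "mul_obj D" "mul_arr D" "one_obj D" "mul_assoc D" "mul_lunit D" "mul_runit D" "mul_braid D"
    F "mul2 F" "mul0 F"
  for C :: "('o, 'm, 'z) braided_bimon_scheme" and D :: "('p, 'n, 'y) braided_bimon_scheme"
    and F :: "('o, 'm, 'p, 'n, 'x) bimon_funct_scheme" +
  assumes functor_lnull: "a \<in> Obj C
        \<Longrightarrow> farr F (\<lambda>\<^sup>\<bullet>\<^bsub>C\<^esub> a) \<cdot>\<^bsub>D\<^esub> mul2 F \<zero>\<^bsub>C\<^esub> a \<cdot>\<^bsub>D\<^esub> (add0 F \<boxtimes>\<^bsub>D\<^esub> \<iota>\<^bsub>D\<^esub> (fobj F a))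
          = add0 F \<cdot>\<^bsub>D\<^esub> \<lambda>\<^sup>\<bullet>\<^bsub>D\<^esub> (fobj F a)"
    and functor_ldist: "\<lbrakk>a \<in> Obj C; b \<in> Obj C; c \<in> Obj C\<rbrakk>
        \<Longrightarrow> farr F (\<delta>\<^sup>l\<^bsub>C\<^esub> a b c) \<cdot>\<^bsub>D\<^esub> mul2 F a (b \<oplus>\<^bsub>C\<^esub> c) \<cdot>\<^bsub>D\<^esub> (\<iota>\<^bsub>D\<^esub> (fobj F a) \<boxtimes>\<^bsub>D\<^esub> add2 F b c)
          = add2 F (a \<otimes>\<^bsub>C\<^esub> b) (a \<otimes>\<^bsub>C\<^esub> c) \<cdot>\<^bsub>D\<^esub> (mul2 F a b \<boxplus>\<^bsub>D\<^esub> mul2 F a c)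
              \<cdot>\<^bsub>D\<^esub> \<delta>\<^sup>l\<^bsub>D\<^esub> (fobj F a) (fobj F b) (fobj F c)"

locale strong_braided_bimonoidal_functor = braided_bimonoidal_functor +
  assumes add2_iso: "\<lbrakk>a \<in> Obj C; b \<in> Obj C\<rbrakk> \<Longrightarrow> is_iso D (add2 F a b)"
    and add0_iso: "is_iso D (add0 F)"
    and mul2_iso: "\<lbrakk>a \<in> Obj C; b \<in> Obj C\<rbrakk> \<Longrightarrow> is_iso D (mul2 F a b)"
    and mul0_iso: "is_iso D (mul0 F)"

end

theory Submission
  imports Defs
begin

text \<open>
  Let \<open>C\<close> be a tight braided bimonoidal category. The strict category \<open>A\<close> has as objects the formal
  polynomials in the objects of \<open>C\<close>: lists of words, read as sums of products. Each polynomial has a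
  value \<open>sums S\<close> in \<open>C\<close>, and the arrows of \<open>A\<close> from \<open>S\<close> to \<open>T\<close> are the arrows of \<open>C\<close> between their
  values. Taking values is fully faithful by definition, and the polynomial \<open>[[x]]\<close> has a value isomorphic
  to \<open>x\<close>, so \<open>A\<close> and \<open>C\<close> are equivalent. The sum of polynomials is concatenation, and their product
  lists all concatenations of a word of the first with a word of the second factor. Ordered with the
  second factor varying slowest, these operations are strictly associative and unital, zero is
  strictly absorbing, and the product distributes strictly over sums in its second argument.

  The proof separates transport of structure from coherence. Given any isomorphisms
  \<open>sums S \<oplus> sums T \<rightarrow> sums (S @ T)\<close> and \<open>sums S \<otimes> sums T \<rightarrow> sums (prods S T)\<close>, the structure of \<open>C\<close>
  can be transported to \<open>A\<close>, and every axiom of \<open>C\<close> then holds in \<open>A\<close>: an arrow of \<open>A\<close> is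
  represented by an arrow of \<open>C\<close> when a square of the chosen isomorphisms commutes (\<open>rep\<close>), and this
  relation is preserved by all operations. This yields the transported structure
  (\<open>transported_bimonoidal\<close>), the fact that taking values and choosing \<open>[[x]]\<close> are strong functors
  (\<open>val_functor_strong\<close>, \<open>sec_functor_strong\<close>), and the adjoint equivalence (\<open>transported_equivalence\<close>).

  The choice of the isomorphisms matters only for strictness. A structure arrow of \<open>A\<close> whose source
  and target are the same polynomial is an identity exactly when the chosen isomorphisms satisfy one coherence equation with the structure arrow of \<open>C\<close>
  from which it comes. For sums they are iterated associators, and the equations are the classical ones
  for monoidal categories (\<open>fold_merge_assoc\<close>). For products, the left distributor expands the second
  factor and the right distributor then expands the first (\<open>prods_iso\<close>). Compatibility with the left
  distributor, the null isomorphisms and the units, and associativity (\<open>prods_iso_append\<close>, \<open>prods_iso_nil\<close>,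
  \<open>prods_iso_one_left\<close>, \<open>prods_iso_one_right\<close>, \<open>prods_iso_assoc\<close>), follow by induction on the
  polynomials; each case of an induction is settled by one of the axioms that relate the distributors and the
  null isomorphisms to the rest of the structure.
\<close>

section \<open>Arrows, isomorphisms and functors\<close>

context category
begin

lemma hom_arr: "f \<in> hom C a b \<longleftrightarrow> f \<in> Arr C \<and> Dom C f = a \<and> Cod C f = b"
  by (simp add: hom_def)

lemma id_arr [simp]:
  assumes "a \<in> Obj C"
  shows "\<iota> a \<in> Arr C" "Dom C (\<iota> a) = a" "Cod C (\<iota> a) = a"
  using id_hom[OF assms] by (simp_all add: hom_arr)

lemma comp_arr [simp]:
  assumes "f \<in> Arr C" "g \<in> Arr C" "Dom C g = Cod C f"
  shows "g \<cdot> f \<in> Arr C" "Dom C (g \<cdot> f) = Dom C f" "Cod C (g \<cdot> f) = Cod C g"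
  using comp_hom[of f "Dom C f" "Cod C f" g "Cod C g"] assms by (simp_all add: hom_arr)

declare dom_obj [simp] cod_obj [simp]

lemma comp_id_arr [simp]: "\<lbrakk>f \<in> Arr C; Dom C f = a\<rbrakk> \<Longrightarrow> f \<cdot> \<iota> a = f"
  using comp_id[of f a "Cod C f"] by (simp add: hom_arr)

lemma id_comp_arr [simp]: "\<lbrakk>f \<in> Arr C; Cod C f = a\<rbrakk> \<Longrightarrow> \<iota> a \<cdot> f = f"
  using id_comp[of f "Dom C f" a] by (simp add: hom_arr)

lemma comp_assoc_arr [simp]:
  "\<lbrakk>f \<in> Arr C; g \<in> Arr C; h \<in> Arr C; Dom C g = Cod C f; Dom C h = Cod C g\<rbrakk>
    \<Longrightarrow> (h \<cdot> g) \<cdot> f = h \<cdot> (g \<cdot> f)"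
  using comp_assoc[of f "Dom C f" "Cod C f" g "Cod C g" h "Cod C h"] by (simp add: hom_arr)

text \<open>Composites are normalised to the right, so an equation about a composite of two arrows does
  not occur literally inside a longer one; in this form it can be used there.\<close>

lemma segment2:
  "\<lbrakk>g \<cdot> f = t; k \<in> Arr C; f \<in> Arr C; g \<in> Arr C; Dom C f = Cod C k; Dom C g = Cod C f\<rbrakk>
    \<Longrightarrow> g \<cdot> (f \<cdot> k) = t \<cdot> k"
  by auto

lemma inverse_arrows_arr:
  "inverse_arrows C f g \<longleftrightarrow> f \<in> Arr C \<and> g \<in> Arr C \<and> Dom C g = Cod C f \<and> Cod C g = Dom C f
     \<and> g \<cdot> f = \<iota> (Dom C f) \<and> f \<cdot> g = \<iota> (Cod C f)"
  by (auto simp: inverse_arrows_def hom_arr)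

lemma inverse_arrows_unique:
  assumes "inverse_arrows C f g" "inverse_arrows C f g'"
  shows "g' = g"
proof -
  have "g' = (g \<cdot> f) \<cdot> g'" using assms by (simp add: inverse_arrows_arr del: comp_assoc_arr)
  also have "\<dots> = g \<cdot> (f \<cdot> g')" using assms unfolding inverse_arrows_arr by (intro comp_assoc_arr) auto
  also have "\<dots> = g" using assms by (simp add: inverse_arrows_arr)
  finally show ?thesis .
qed

lemma inv_arr_eq: "inverse_arrows C f g \<Longrightarrow> inv_arr C f = g"
  unfolding inv_arr_def using inverse_arrows_unique by blast

lemma inverse_arrows_inv: "is_iso C f \<Longrightarrow> inverse_arrows C f (inv_arr C f)"
  using inv_arr_eq by (auto simp: is_iso_def)

lemma inv_arr_arr [simp]:
  assumes "is_iso C f"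
  shows "inv_arr C f \<in> Arr C" "Dom C (inv_arr C f) = Cod C f" "Cod C (inv_arr C f) = Dom C f"
    "inv_arr C f \<cdot> f = \<iota> (Dom C f)" "f \<cdot> inv_arr C f = \<iota> (Cod C f)"
  using inverse_arrows_inv[OF assms] by (simp_all add: inverse_arrows_arr)

lemma iso_arr: "is_iso C f \<Longrightarrow> f \<in> Arr C"
  by (auto simp: is_iso_def inverse_arrows_arr)

lemma inv_comp_cancel [simp]:
  assumes "is_iso C f" "k \<in> Arr C" "Cod C k = Dom C f"
  shows "inv_arr C f \<cdot> (f \<cdot> k) = k"
  using segment2[OF inv_arr_arr(4)[OF assms(1)] assms(2) iso_arr[OF assms(1)]] assms by simp

lemma comp_inv_cancel [simp]:
  assumes "is_iso C f" "k \<in> Arr C" "Cod C k = Cod C f"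
  shows "f \<cdot> (inv_arr C f \<cdot> k) = k"
  using segment2[OF inv_arr_arr(5)[OF assms(1)] assms(2)] assms iso_arr[OF assms(1)] by simp

lemma inverse_arrows_iso: "inverse_arrows C f g \<Longrightarrow> is_iso C f"
  by (auto simp: is_iso_def)

lemma inverse_arrows_sym: "inverse_arrows C f g \<Longrightarrow> inverse_arrows C g f"
  by (auto simp: inverse_arrows_arr)

lemma iso_inv [simp]: "is_iso C f \<Longrightarrow> is_iso C (inv_arr C f)"
  using inverse_arrows_inv inverse_arrows_sym inverse_arrows_iso by blast

lemma iso_id [simp]: "a \<in> Obj C \<Longrightarrow> is_iso C (\<iota> a)"
  by (rule inverse_arrows_iso[of _ "\<iota> a"]) (simp add: inverse_arrows_arr)

lemma inv_id [simp]: "a \<in> Obj C \<Longrightarrow> inv_arr C (\<iota> a) = \<iota> a"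
  by (rule inv_arr_eq) (simp add: inverse_arrows_arr)

lemma inverse_arrows_comp:
  assumes "is_iso C f" "is_iso C g" "Dom C g = Cod C f"
  shows "inverse_arrows C (g \<cdot> f) (inv_arr C f \<cdot> inv_arr C g)"
  using assms iso_arr[OF assms(1)] iso_arr[OF assms(2)]
  by (simp add: inverse_arrows_arr)

lemma iso_comp [simp]:
  "\<lbrakk>is_iso C f; is_iso C g; Dom C g = Cod C f\<rbrakk> \<Longrightarrow> is_iso C (g \<cdot> f)"
  using inverse_arrows_comp inverse_arrows_iso by blast

lemma inv_comp:
  "\<lbrakk>is_iso C f; is_iso C g; Dom C g = Cod C f\<rbrakk>
    \<Longrightarrow> inv_arr C (g \<cdot> f) = inv_arr C f \<cdot> inv_arr C g"
  using inverse_arrows_comp inv_arr_eq by blast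

lemma iso_cancel_left:
  assumes "m \<cdot> f = m \<cdot> g" "is_iso C m" "f \<in> Arr C" "g \<in> Arr C"
    "Cod C f = Dom C m" "Cod C g = Dom C m"
  shows "f = g"
proof -
  have "f = inv_arr C m \<cdot> (m \<cdot> f)" by (rule inv_comp_cancel[OF assms(2,3,5), symmetric])
  also have "\<dots> = inv_arr C m \<cdot> (m \<cdot> g)" by (simp only: assms(1))
  also have "\<dots> = g" by (rule inv_comp_cancel[OF assms(2,4,6)])
  finally show ?thesis .
qed

lemma iso_cancel_right:
  assumes "f \<cdot> m = g \<cdot> m" "is_iso C m" "f \<in> Arr C" "g \<in> Arr C"
    "Dom C f = Cod C m" "Dom C g = Cod C m"
  shows "f = g"
proof -
  have "(f \<cdot> m) \<cdot> inv_arr C m = (g \<cdot> m) \<cdot> inv_arr C m" by (simp only: assms(1))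
  then show ?thesis using assms(2-) iso_arr[OF assms(2)] by simp
qed

lemma iso_mono:
  assumes "is_iso C f" shows "is_mono C f"
  unfolding is_mono_def
proof (intro conjI allI ballI impI)
  show "f \<in> Arr C" by (rule iso_arr[OF assms])
  fix c g h
  assume "g \<in> hom C c (Dom C f)" "h \<in> hom C c (Dom C f)" "f \<cdot> g = f \<cdot> h"
  then show "g = h" using iso_cancel_left[of f g h] assms by (simp add: hom_arr)
qed

lemma iso_hom_arr: "f \<in> iso_hom C a b \<longleftrightarrow> f \<in> Arr C \<and> Dom C f = a \<and> Cod C f = b \<and> is_iso C f"
  by (auto simp: iso_hom_def hom_arr)

lemma identity_eq: "is_identity C f \<Longrightarrow> f = \<iota> (Cod C f)"
  by (auto simp: is_identity_def)

lemma iso_homD: "f \<in> iso_hom C a b \<Longrightarrow> f \<in> hom C a b"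
  by (simp add: iso_hom_def)

lemma mono_homD: "f \<in> mono_hom C a b \<Longrightarrow> f \<in> hom C a b"
  by (simp add: mono_hom_def)

lemma hom_obj: "f \<in> hom C a b \<Longrightarrow> a \<in> Obj C" "f \<in> hom C a b \<Longrightarrow> b \<in> Obj C"
  by (auto simp: hom_arr)

end

lemma id_cat_functor: "category C \<Longrightarrow> cat_functor C C id_funct"
  by (simp add: cat_functor_def cat_functor_axioms_def id_funct_def category.id_hom category.comp_hom)

lemma comp_cat_functor:
  assumes "cat_functor C D F" "cat_functor D E G"
  shows "cat_functor C E (comp_funct G F)"
proof -
  interpret F: cat_functor C D F by (rule assms)
  interpret G: cat_functor D E G by (rule assms)
  show ?thesis
    by unfold_locales
      (auto simp: comp_funct_def F.fobj_obj G.fobj_obj F.farr_id G.farr_id F.farr_comp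
        intro!: F.farr_hom G.farr_hom G.farr_comp)
qed

section \<open>Products of lists in a monoidal category\<close>

no_notation mul_obj (infixl "\<otimes>\<index>" 70)
no_notation mul_arr (infixl "\<boxtimes>\<index>" 70)

context monoidal_category
begin

declare tensor_obj [simp] unit_obj [simp] tensor_id [simp]

lemma tensor_arr [simp]:
  assumes "f \<in> Arr C" "g \<in> Arr C"
  shows "f \<boxtimes> g \<in> Arr C" "Dom C (f \<boxtimes> g) = Dom C f \<otimes> Dom C g" "Cod C (f \<boxtimes> g) = Cod C f \<otimes> Cod C g"
  using tensor_hom[of f "Dom C f" "Cod C f" g "Dom C g" "Cod C g"] assms
  by (simp_all add: hom_arr)

lemma tensor_comp_arr [simp]:
  "\<lbrakk>f \<in> Arr C; f' \<in> Arr C; g \<in> Arr C; g' \<in> Arr C; Dom C f' = Cod C f; Dom C g' = Cod C g\<rbrakk>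
    \<Longrightarrow> (f' \<boxtimes> g') \<cdot> (f \<boxtimes> g) = (f' \<cdot> f) \<boxtimes> (g' \<cdot> g)"
  using tensor_comp[of f "Dom C f" "Cod C f" f' "Cod C f'" g "Dom C g" "Cod C g" g' "Cod C g'"]
  by (simp add: hom_arr)

lemma tensor_comp_arr2 [simp]:
  "\<lbrakk>f \<in> Arr C; f' \<in> Arr C; g \<in> Arr C; g' \<in> Arr C; Dom C f' = Cod C f; Dom C g' = Cod C g;
    k \<in> Arr C; Cod C k = Dom C f \<otimes> Dom C g\<rbrakk>
    \<Longrightarrow> (f' \<boxtimes> g') \<cdot> ((f \<boxtimes> g) \<cdot> k) = ((f' \<cdot> f) \<boxtimes> (g' \<cdot> g)) \<cdot> k"
  using segment2[OF tensor_comp_arr] by simp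

lemma inverse_arrows_tensor:
  assumes "is_iso C f" "is_iso C g"
  shows "inverse_arrows C (f \<boxtimes> g) (inv_arr C f \<boxtimes> inv_arr C g)"
  using assms iso_arr[OF assms(1)] iso_arr[OF assms(2)] by (simp add: inverse_arrows_arr)

lemma iso_tensor [simp]: "\<lbrakk>is_iso C f; is_iso C g\<rbrakk> \<Longrightarrow> is_iso C (f \<boxtimes> g)"
  using inverse_arrows_tensor inverse_arrows_iso by blast

lemma inv_tensor: "\<lbrakk>is_iso C f; is_iso C g\<rbrakk> \<Longrightarrow> inv_arr C (f \<boxtimes> g) = inv_arr C f \<boxtimes> inv_arr C g"
  using inverse_arrows_tensor inv_arr_eq by blast

lemma assoc_arr [simp]:
  assumes "a \<in> Obj C" "b \<in> Obj C" "c \<in> Obj C"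
  shows "\<alpha> a b c \<in> Arr C" "Dom C (\<alpha> a b c) = (a \<otimes> b) \<otimes> c" "Cod C (\<alpha> a b c) = a \<otimes> (b \<otimes> c)"
    "is_iso C (\<alpha> a b c)"
  using assoc_iso[OF assms] by (simp_all add: iso_hom_arr)

lemma lunit_arr [simp]:
  assumes "a \<in> Obj C"
  shows "l a \<in> Arr C" "Dom C (l a) = \<I> \<otimes> a" "Cod C (l a) = a" "is_iso C (l a)"
  using lunit_iso[OF assms] by (simp_all add: iso_hom_arr)

lemma runit_arr [simp]:
  assumes "a \<in> Obj C"
  shows "r a \<in> Arr C" "Dom C (r a) = a \<otimes> \<I>" "Cod C (r a) = a" "is_iso C (r a)"
  using runit_iso[OF assms] by (simp_all add: iso_hom_arr)

lemma assoc_natural_arr: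
  "\<lbrakk>f \<in> Arr C; g \<in> Arr C; h \<in> Arr C\<rbrakk> \<Longrightarrow>
   \<alpha> (Cod C f) (Cod C g) (Cod C h) \<cdot> ((f \<boxtimes> g) \<boxtimes> h)
    = (f \<boxtimes> (g \<boxtimes> h)) \<cdot> \<alpha> (Dom C f) (Dom C g) (Dom C h)"
  by (rule assoc_natural) (auto simp: hom_arr)

lemma lunit_natural_arr: "f \<in> Arr C \<Longrightarrow> l (Cod C f) \<cdot> (\<iota> \<I> \<boxtimes> f) = f \<cdot> l (Dom C f)"
  by (rule lunit_natural) (auto simp: hom_arr)

lemma runit_natural_arr: "f \<in> Arr C \<Longrightarrow> r (Cod C f) \<cdot> (f \<boxtimes> \<iota> \<I>) = f \<cdot> r (Dom C f)"
  by (rule runit_natural) (auto simp: hom_arr)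

text \<open>Naturality of \<open>l\<close> and of \<open>r\<close> recovers an arrow from its tensor product with the unit.\<close>

lemma unit_tensor_cancel:
  assumes "\<iota> \<I> \<boxtimes> f = \<iota> \<I> \<boxtimes> g" "f \<in> Arr C" "g \<in> Arr C" "Dom C f = Dom C g" "Cod C f = Cod C g"
  shows "f = g"
proof -
  have "f \<cdot> l (Dom C f) = g \<cdot> l (Dom C f)"
    using lunit_natural_arr[of f] lunit_natural_arr[of g] assms by simp
  then show ?thesis by (rule iso_cancel_right) (use assms in auto)
qed

lemma tensor_unit_cancel:
  assumes "f \<boxtimes> \<iota> \<I> = g \<boxtimes> \<iota> \<I>" "f \<in> Arr C" "g \<in> Arr C" "Dom C f = Dom C g" "Cod C f = Cod C g"
  shows "f = g"
proof -
  have "f \<cdot> r (Dom C f) = g \<cdot> r (Dom C f)"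
    using runit_natural_arr[of f] runit_natural_arr[of g] assms by simp
  then show ?thesis by (rule iso_cancel_right) (use assms in auto)
qed

text \<open>Kelly's consequences of the pentagon and the triangle. After tensoring with the unit, which is
  faithful, the pentagon with two entries equal to the unit turns one side into the other: the
  triangle and the naturality of the associator remove all unit isomorphisms but one.\<close>

lemma lunit_tensor:
  assumes [simp]: "a \<in> Obj C" "b \<in> Obj C"
  shows "l (a \<otimes> b) \<cdot> \<alpha> \<I> a b = l a \<boxtimes> \<iota> b"
proof (rule unit_tensor_cancel)
  let ?m = "\<alpha> \<I> (\<I> \<otimes> a) b \<cdot> (\<alpha> \<I> \<I> a \<boxtimes> \<iota> b)"
  have "(\<iota> \<I> \<boxtimes> (l (a \<otimes> b) \<cdot> \<alpha> \<I> a b)) \<cdot> ?m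
      = (\<iota> \<I> \<boxtimes> l (a \<otimes> b)) \<cdot> ((\<iota> \<I> \<boxtimes> \<alpha> \<I> a b) \<cdot> \<alpha> \<I> (\<I> \<otimes> a) b \<cdot> (\<alpha> \<I> \<I> a \<boxtimes> \<iota> b))"
    by simp
  also have "\<dots> = ((\<iota> \<I> \<boxtimes> l (a \<otimes> b)) \<cdot> \<alpha> \<I> \<I> (a \<otimes> b)) \<cdot> \<alpha> (\<I> \<otimes> \<I>) a b"
    by (subst pentagon) simp_all
  also have "\<dots> = (r \<I> \<boxtimes> (\<iota> a \<boxtimes> \<iota> b)) \<cdot> \<alpha> (\<I> \<otimes> \<I>) a b"
    by (subst triangle) simp_all
  also have "\<dots> = \<alpha> \<I> a b \<cdot> ((r \<I> \<boxtimes> \<iota> a) \<boxtimes> \<iota> b)"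
    using assoc_natural_arr[of "r \<I>" "\<iota> a" "\<iota> b"] by simp
  also have "\<dots> = \<alpha> \<I> a b \<cdot> ((\<iota> \<I> \<boxtimes> l a) \<boxtimes> \<iota> b) \<cdot> (\<alpha> \<I> \<I> a \<boxtimes> \<iota> b)"
    by (subst triangle[symmetric]) simp_all
  also have "\<dots> = (\<iota> \<I> \<boxtimes> (l a \<boxtimes> \<iota> b)) \<cdot> ?m"
    using segment2[OF assoc_natural_arr[of "\<iota> \<I>" "l a" "\<iota> b"]] by (simp del: tensor_comp_arr tensor_comp_arr2)
  finally show "\<iota> \<I> \<boxtimes> (l (a \<otimes> b) \<cdot> \<alpha> \<I> a b) = \<iota> \<I> \<boxtimes> (l a \<boxtimes> \<iota> b)"
    by (rule iso_cancel_right) simp_all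
qed simp_all

lemma runit_tensor:
  assumes [simp]: "a \<in> Obj C" "b \<in> Obj C"
  shows "(\<iota> a \<boxtimes> r b) \<cdot> \<alpha> a b \<I> = r (a \<otimes> b)"
proof (rule tensor_unit_cancel)
  let ?\<alpha> = "\<alpha> a b \<I>"
  have "?\<alpha> \<cdot> (((\<iota> a \<boxtimes> r b) \<cdot> ?\<alpha>) \<boxtimes> \<iota> \<I>) = ?\<alpha> \<cdot> ((\<iota> a \<boxtimes> r b) \<boxtimes> \<iota> \<I>) \<cdot> (?\<alpha> \<boxtimes> \<iota> \<I>)"
    by simp
  also have "\<dots> = (\<iota> a \<boxtimes> (r b \<boxtimes> \<iota> \<I>)) \<cdot> \<alpha> a (b \<otimes> \<I>) \<I> \<cdot> (?\<alpha> \<boxtimes> \<iota> \<I>)"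
    using segment2[OF assoc_natural_arr[of "\<iota> a" "r b" "\<iota> \<I>"]] by (simp del: tensor_comp_arr tensor_comp_arr2)
  also have "\<dots> = (\<iota> a \<boxtimes> (\<iota> b \<boxtimes> l \<I>)) \<cdot> (\<iota> a \<boxtimes> \<alpha> b \<I> \<I>) \<cdot> \<alpha> a (b \<otimes> \<I>) \<I> \<cdot> (?\<alpha> \<boxtimes> \<iota> \<I>)"
    by (subst triangle[symmetric]) simp_all
  also have "\<dots> = (\<iota> a \<boxtimes> (\<iota> b \<boxtimes> l \<I>)) \<cdot> \<alpha> a b (\<I> \<otimes> \<I>) \<cdot> \<alpha> (a \<otimes> b) \<I> \<I>"
    by (subst pentagon) simp_all
  also have "\<dots> = ?\<alpha> \<cdot> (\<iota> (a \<otimes> b) \<boxtimes> l \<I>) \<cdot> \<alpha> (a \<otimes> b) \<I> \<I>"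
    using segment2[OF assoc_natural_arr[of "\<iota> a" "\<iota> b" "l \<I>", symmetric]] by simp
  also have "\<dots> = ?\<alpha> \<cdot> (r (a \<otimes> b) \<boxtimes> \<iota> \<I>)"
    by (subst triangle) simp_all
  finally show "((\<iota> a \<boxtimes> r b) \<cdot> ?\<alpha>) \<boxtimes> \<iota> \<I> = r (a \<otimes> b) \<boxtimes> \<iota> \<I>"
    by (rule iso_cancel_left) simp_all
qed simp_all

text \<open>By naturality \<open>l (\<I> \<otimes> \<I>) = \<iota> \<I> \<boxtimes> l \<I>\<close>, so Kelly's law for \<open>l\<close> and the triangle have the same
  right-hand factor.\<close>

lemma lunit_unit: "l \<I> = r \<I>"
proof (rule tensor_unit_cancel)
  have "l \<I> \<cdot> (\<iota> \<I> \<boxtimes> l \<I>) = l \<I> \<cdot> l (\<I> \<otimes> \<I>)"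
    using lunit_natural_arr[of "l \<I>"] by simp
  then have "\<iota> \<I> \<boxtimes> l \<I> = l (\<I> \<otimes> \<I>)"
    by (rule iso_cancel_left) simp_all
  then show "l \<I> \<boxtimes> \<iota> \<I> = r \<I> \<boxtimes> \<iota> \<I>"
    using lunit_tensor[of \<I> \<I>] triangle[of \<I> \<I>] by simp
qed simp_all

text \<open>Ending every product in the unit makes the recursions uniform in the length of the list; in
  exchange, a list with one entry \<open>a\<close> has the value \<open>a \<otimes> \<I>\<close>, which is only isomorphic to \<open>a\<close>.\<close>

primrec fold_obj :: "('x \<Rightarrow> 'o) \<Rightarrow> 'x list \<Rightarrow> 'o" where
  "fold_obj p [] = \<I>"
| "fold_obj p (x # xs) = p x \<otimes> fold_obj p xs"

primrec fold_merge :: "('x \<Rightarrow> 'o) \<Rightarrow> 'x list \<Rightarrow> 'x list \<Rightarrow> 'm" where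
  "fold_merge p [] ys = l (fold_obj p ys)"
| "fold_merge p (x # xs) ys
    = (\<iota> (p x) \<boxtimes> fold_merge p xs ys) \<cdot> \<alpha> (p x) (fold_obj p xs) (fold_obj p ys)"

lemma fold_obj_obj [simp]: "p ` set xs \<subseteq> Obj C \<Longrightarrow> fold_obj p xs \<in> Obj C"
  by (induction xs) simp_all

lemma fold_merge_arr [simp]:
  assumes "p ` set xs \<subseteq> Obj C" "p ` set ys \<subseteq> Obj C"
  shows "fold_merge p xs ys \<in> Arr C"
    "Dom C (fold_merge p xs ys) = fold_obj p xs \<otimes> fold_obj p ys"
    "Cod C (fold_merge p xs ys) = fold_obj p (xs @ ys)"
    "is_iso C (fold_merge p xs ys)"
  using assms by (induction xs) simp_all

lemma fold_merge_nil: "p ` set xs \<subseteq> Obj C \<Longrightarrow> fold_merge p xs [] = r (fold_obj p xs)"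
  by (induction xs) (simp_all add: lunit_unit runit_tensor)

text \<open>The empty list is the case of Kelly's law for \<open>l\<close>, and the induction step is the pentagon.\<close>

lemma fold_merge_assoc:
  assumes "p ` set xs \<subseteq> Obj C" and ys: "p ` set ys \<subseteq> Obj C" and zs: "p ` set zs \<subseteq> Obj C"
  shows "fold_merge p (xs @ ys) zs \<cdot> (fold_merge p xs ys \<boxtimes> \<iota> (fold_obj p zs))
    = fold_merge p xs (ys @ zs) \<cdot> (\<iota> (fold_obj p xs) \<boxtimes> fold_merge p ys zs)
        \<cdot> \<alpha> (fold_obj p xs) (fold_obj p ys) (fold_obj p zs)"
  using assms(1)
proof (induction xs)
  case Nil
  note [simp] = ys zs
  show ?case
    using segment2[OF lunit_natural_arr[of "fold_merge p ys zs"]]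
    by (simp add: lunit_tensor image_Un)
next
  case (Cons x xs)
  let ?R = "fold_obj p" and ?m = "fold_merge p"
  have [simp]: "p x \<in> Obj C" "p ` set xs \<subseteq> Obj C" using Cons.prems by auto
  note [simp] = ys zs image_Un
  have "?m ((x # xs) @ ys) zs \<cdot> (?m (x # xs) ys \<boxtimes> \<iota> (?R zs))
      = (\<iota> (p x) \<boxtimes> ?m (xs @ ys) zs) \<cdot> \<alpha> (p x) (?R (xs @ ys)) (?R zs)
          \<cdot> ((\<iota> (p x) \<boxtimes> ?m xs ys) \<boxtimes> \<iota> (?R zs)) \<cdot> (\<alpha> (p x) (?R xs) (?R ys) \<boxtimes> \<iota> (?R zs))"
    by simp
  also have "\<dots> = (\<iota> (p x) \<boxtimes> ?m (xs @ ys) zs) \<cdot> (\<iota> (p x) \<boxtimes> (?m xs ys \<boxtimes> \<iota> (?R zs)))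
          \<cdot> \<alpha> (p x) (?R xs \<otimes> ?R ys) (?R zs) \<cdot> (\<alpha> (p x) (?R xs) (?R ys) \<boxtimes> \<iota> (?R zs))"
    using segment2[OF assoc_natural_arr[of "\<iota> (p x)" "?m xs ys" "\<iota> (?R zs)"]]
    by (simp del: tensor_comp_arr tensor_comp_arr2)
  also have "\<dots> = (\<iota> (p x) \<boxtimes> (?m (xs @ ys) zs \<cdot> (?m xs ys \<boxtimes> \<iota> (?R zs))))
          \<cdot> \<alpha> (p x) (?R xs \<otimes> ?R ys) (?R zs) \<cdot> (\<alpha> (p x) (?R xs) (?R ys) \<boxtimes> \<iota> (?R zs))"
    by simp
  also have "\<dots> = (\<iota> (p x) \<boxtimes> (?m xs (ys @ zs) \<cdot> (\<iota> (?R xs) \<boxtimes> ?m ys zs)))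
          \<cdot> (\<iota> (p x) \<boxtimes> \<alpha> (?R xs) (?R ys) (?R zs))
          \<cdot> \<alpha> (p x) (?R xs \<otimes> ?R ys) (?R zs) \<cdot> (\<alpha> (p x) (?R xs) (?R ys) \<boxtimes> \<iota> (?R zs))"
    by (subst Cons.IH) simp_all
  also have "\<dots> = (\<iota> (p x) \<boxtimes> (?m xs (ys @ zs) \<cdot> (\<iota> (?R xs) \<boxtimes> ?m ys zs)))
          \<cdot> \<alpha> (p x) (?R xs) (?R ys \<otimes> ?R zs) \<cdot> \<alpha> (p x \<otimes> ?R xs) (?R ys) (?R zs)"
    by (subst pentagon) simp_all
  also have "\<dots> = ?m (x # xs) (ys @ zs) \<cdot> (\<iota> (?R (x # xs)) \<boxtimes> ?m ys zs)
        \<cdot> \<alpha> (?R (x # xs)) (?R ys) (?R zs)"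
    using segment2[OF assoc_natural_arr[of "\<iota> (p x)" "\<iota> (?R xs)" "?m ys zs"]] by simp
  finally show ?case .
qed

end

context braided_monoidal_category
begin

lemma braid_arr [simp]:
  assumes "a \<in> Obj C" "b \<in> Obj C"
  shows "\<zeta> a b \<in> Arr C" "Dom C (\<zeta> a b) = a \<otimes> b" "Cod C (\<zeta> a b) = b \<otimes> a" "is_iso C (\<zeta> a b)"
  using braid_iso[OF assms] by (simp_all add: iso_hom_arr)

lemma braid_natural_arr:
  "\<lbrakk>f \<in> Arr C; g \<in> Arr C\<rbrakk> \<Longrightarrow>
    \<zeta> (Cod C f) (Cod C g) \<cdot> (f \<boxtimes> g) = (g \<boxtimes> f) \<cdot> \<zeta> (Dom C f) (Dom C g)"
  by (rule braid_natural) (auto simp: hom_arr)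

end

notation mul_obj (infixl "\<otimes>\<index>" 70)
notation mul_arr (infixl "\<boxtimes>\<index>" 70)

section \<open>Polynomials in the objects of a bimonoidal category\<close>

context bimonoidal_category
begin

lemma lnull_arr [simp]:
  assumes "a \<in> Obj B"
  shows "\<lambda>\<^sup>\<bullet> a \<in> Arr B" "Dom B (\<lambda>\<^sup>\<bullet> a) = \<zero> \<otimes> a" "Cod B (\<lambda>\<^sup>\<bullet> a) = \<zero>" "is_iso B (\<lambda>\<^sup>\<bullet> a)"
  using lnull_iso[OF assms] by (simp_all add: add.iso_hom_arr)

lemma rnull_arr [simp]:
  assumes "a \<in> Obj B"
  shows "\<rho>\<^sup>\<bullet> a \<in> Arr B" "Dom B (\<rho>\<^sup>\<bullet> a) = a \<otimes> \<zero>" "Cod B (\<rho>\<^sup>\<bullet> a) = \<zero>" "is_iso B (\<rho>\<^sup>\<bullet> a)"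
  using rnull_iso[OF assms] by (simp_all add: add.iso_hom_arr)

lemma ldist_arr [simp]:
  assumes "a \<in> Obj B" "b \<in> Obj B" "c \<in> Obj B"
  shows "\<delta>\<^sup>l a b c \<in> Arr B" "Dom B (\<delta>\<^sup>l a b c) = a \<otimes> (b \<oplus> c)"
    "Cod B (\<delta>\<^sup>l a b c) = a \<otimes> b \<oplus> a \<otimes> c"
  using ldist_mono[OF assms] by (simp_all add: mono_hom_def add.hom_arr)

lemma rdist_arr [simp]:
  assumes "a \<in> Obj B" "b \<in> Obj B" "c \<in> Obj B"
  shows "\<delta>\<^sup>r a b c \<in> Arr B" "Dom B (\<delta>\<^sup>r a b c) = (a \<oplus> b) \<otimes> c"
    "Cod B (\<delta>\<^sup>r a b c) = a \<otimes> c \<oplus> b \<otimes> c"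
  using rdist_mono[OF assms] by (simp_all add: mono_hom_def add.hom_arr)

lemma lnull_natural_arr: "f \<in> Arr B \<Longrightarrow> \<lambda>\<^sup>\<bullet> (Cod B f) \<cdot> (\<iota> \<zero> \<boxtimes> f) = \<lambda>\<^sup>\<bullet> (Dom B f)"
  by (rule lnull_natural) (auto simp: add.hom_arr)

lemma rnull_natural_arr: "f \<in> Arr B \<Longrightarrow> \<rho>\<^sup>\<bullet> (Cod B f) \<cdot> (f \<boxtimes> \<iota> \<zero>) = \<rho>\<^sup>\<bullet> (Dom B f)"
  by (rule rnull_natural) (auto simp: add.hom_arr)

lemma ldist_natural_arr:
  "\<lbrakk>f \<in> Arr B; g \<in> Arr B; h \<in> Arr B\<rbrakk> \<Longrightarrow>
    \<delta>\<^sup>l (Cod B f) (Cod B g) (Cod B h) \<cdot> (f \<boxtimes> (g \<boxplus> h))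
      = (f \<boxtimes> g \<boxplus> f \<boxtimes> h) \<cdot> \<delta>\<^sup>l (Dom B f) (Dom B g) (Dom B h)"
  by (rule ldist_natural) (auto simp: add.hom_arr)

lemma rdist_natural_arr:
  "\<lbrakk>f \<in> Arr B; g \<in> Arr B; h \<in> Arr B\<rbrakk> \<Longrightarrow>
    \<delta>\<^sup>r (Cod B f) (Cod B g) (Cod B h) \<cdot> ((f \<boxplus> g) \<boxtimes> h)
      = (f \<boxtimes> h \<boxplus> g \<boxtimes> h) \<cdot> \<delta>\<^sup>r (Dom B f) (Dom B g) (Dom B h)"
  by (rule rdist_natural) (auto simp: add.hom_arr)

lemmas merge_tensor = add.tensor_comp_arr add.tensor_comp_arr2 mul.tensor_comp_arr mul.tensor_comp_arr2

text \<open>A list of words stands for a formal sum of formal products of objects. Its value \<open>sums\<close> is a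
  right-nested sum of right-nested products, and \<open>append_iso\<close> compares the sum of two values with
  the value of the concatenation.\<close>

definition word :: "'o list \<Rightarrow> 'o" where
  "word = mul.fold_obj (\<lambda>x. x)"

definition join :: "'o list \<Rightarrow> 'o list \<Rightarrow> 'm" where
  "join = mul.fold_merge (\<lambda>x. x)"

definition sums :: "'o list list \<Rightarrow> 'o" where
  "sums = add.fold_obj word"

definition append_iso :: "'o list list \<Rightarrow> 'o list list \<Rightarrow> 'm" where
  "append_iso = add.fold_merge word"

definition polys :: "'o list list set" where
  "polys = {S. \<forall>w \<in> set S. set w \<subseteq> Obj B}"

definition scale :: "'o list list \<Rightarrow> 'o list \<Rightarrow> 'o list list" where
  "scale S w = map (\<lambda>s. s @ w) S"

text \<open>The words of the second factor vary slowest. Hence the product distributes over concatenation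
  literally in its second argument, whereas in its first argument it does so only up to a
  permutation of the summands. Accordingly the left distributor becomes an identity and the right one a
  permutation.\<close>

primrec prods :: "'o list list \<Rightarrow> 'o list list \<Rightarrow> 'o list list" where
  "prods S [] = []"
| "prods S (t # T) = scale S t @ prods S T"

primrec scale_iso :: "'o list list \<Rightarrow> 'o list \<Rightarrow> 'm" where
  "scale_iso [] w = \<lambda>\<^sup>\<bullet> (word w)"
| "scale_iso (s # S) w = (join s w \<boxplus> scale_iso S w) \<cdot> \<delta>\<^sup>r (word s) (sums S) (word w)"

primrec prods_iso :: "'o list list \<Rightarrow> 'o list list \<Rightarrow> 'm" where
  "prods_iso S [] = \<rho>\<^sup>\<bullet> (sums S)"
| "prods_iso S (t # T) = append_iso (scale S t) (prods S T)
     \<cdot> (scale_iso S t \<boxplus> prods_iso S T) \<cdot> \<delta>\<^sup>l (sums S) (word t) (sums T)"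

lemma scale_simps [simp]:
  "scale [] w = []" "scale (s # S) w = (s @ w) # scale S w" "scale S [] = S"
  "scale (S @ S') w = scale S w @ scale S' w" "scale (scale S v) w = scale S (v @ w)"
  by (simp_all add: scale_def)

lemma prods_append [simp]: "prods S (T @ U) = prods S T @ prods S U"
  by (induction T) simp_all

lemma scale_prods [simp]: "scale (prods S T) w = prods S (scale T w)"
  by (induction T) simp_all

lemma prods_assoc [simp]: "prods (prods S T) U = prods S (prods T U)"
  by (induction U) simp_all

lemma prods_nil [simp]: "prods [] T = []"
  by (induction T) simp_all

lemma prods_one [simp]: "prods [[]] T = T"
  by (induction T) simp_all

lemma polys_simps [simp]:
  "[] \<in> polys" "s # S \<in> polys \<longleftrightarrow> set s \<subseteq> Obj B \<and> S \<in> polys"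
  "S @ T \<in> polys \<longleftrightarrow> S \<in> polys \<and> T \<in> polys"
  by (auto simp: polys_def)

lemma scale_polys [simp]: "\<lbrakk>S \<in> polys; set w \<subseteq> Obj B\<rbrakk> \<Longrightarrow> scale S w \<in> polys"
  by (induction S) simp_all

lemma prods_polys [simp]: "\<lbrakk>S \<in> polys; T \<in> polys\<rbrakk> \<Longrightarrow> prods S T \<in> polys"
  by (induction T) simp_all

lemma word_simps [simp]: "word [] = \<one>" "word (x # w) = x \<otimes> word w"
  by (simp_all add: word_def)

lemma sums_simps [simp]: "sums [] = \<zero>" "sums (w # S) = word w \<oplus> sums S"
  by (simp_all add: sums_def)

lemma word_obj [simp]: "set w \<subseteq> Obj B \<Longrightarrow> word w \<in> Obj B"
  by (simp add: word_def)

lemma word_polys: "S \<in> polys \<Longrightarrow> word ` set S \<subseteq> Obj B"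
  by (auto simp: polys_def)

lemma sums_obj [simp]: "S \<in> polys \<Longrightarrow> sums S \<in> Obj B"
  by (simp add: sums_def word_polys)

lemma join_arr [simp]:
  assumes "set v \<subseteq> Obj B" "set w \<subseteq> Obj B"
  shows "join v w \<in> Arr B" "Dom B (join v w) = word v \<otimes> word w" "Cod B (join v w) = word (v @ w)"
    "is_iso B (join v w)"
  using assms by (simp_all add: join_def word_def)

lemma append_iso_simps [simp]:
  "append_iso [] T = \<lambda>\<^sup>\<oplus> (sums T)"
  "append_iso (s # S) T = (\<iota> (word s) \<boxplus> append_iso S T) \<cdot> \<alpha>\<^sup>\<oplus> (word s) (sums S) (sums T)"
  by (simp_all add: append_iso_def sums_def)

lemma append_iso_arr [simp]:
  assumes "S \<in> polys" "T \<in> polys"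
  shows "append_iso S T \<in> Arr B" "Dom B (append_iso S T) = sums S \<oplus> sums T"
    "Cod B (append_iso S T) = sums (S @ T)" "is_iso B (append_iso S T)"
  using word_polys[OF assms(1)] word_polys[OF assms(2)] by (simp_all add: append_iso_def sums_def)

lemma join_assoc:
  assumes "set u \<subseteq> Obj B" "set v \<subseteq> Obj B" "set w \<subseteq> Obj B"
  shows "join (u @ v) w \<cdot> (join u v \<boxtimes> \<iota> (word w))
    = join u (v @ w) \<cdot> (\<iota> (word u) \<boxtimes> join v w) \<cdot> \<alpha>\<^sup>\<otimes> (word u) (word v) (word w)"
  using mul.fold_merge_assoc[of "\<lambda>x. x" u v w] assms by (simp add: join_def word_def)

lemma append_iso_assoc:
  assumes "S \<in> polys" "T \<in> polys" "U \<in> polys"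
  shows "append_iso (S @ T) U \<cdot> (append_iso S T \<boxplus> \<iota> (sums U))
    = append_iso S (T @ U) \<cdot> (\<iota> (sums S) \<boxplus> append_iso T U) \<cdot> \<alpha>\<^sup>\<oplus> (sums S) (sums T) (sums U)"
  using add.fold_merge_assoc[of word S T U] assms[THEN word_polys]
  by (simp add: append_iso_def sums_def)

lemma join_nil: "set w \<subseteq> Obj B \<Longrightarrow> join w [] = \<rho>\<^sup>\<otimes> (word w)"
  by (simp add: join_def word_def mul.fold_merge_nil)

lemma append_iso_nil: "S \<in> polys \<Longrightarrow> append_iso S [] = \<rho>\<^sup>\<oplus> (sums S)"
  using word_polys by (simp add: append_iso_def sums_def add.fold_merge_nil)

lemma scale_iso_arr [simp]:
  assumes "S \<in> polys" "set w \<subseteq> Obj B"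
  shows "scale_iso S w \<in> Arr B" "Dom B (scale_iso S w) = sums S \<otimes> word w"
    "Cod B (scale_iso S w) = sums (scale S w)"
  using assms by (induction S) simp_all

lemma prods_iso_arr [simp]:
  assumes "S \<in> polys" "T \<in> polys"
  shows "prods_iso S T \<in> Arr B" "Dom B (prods_iso S T) = sums S \<otimes> sums T"
    "Cod B (prods_iso S T) = sums (prods S T)"
  using assms by (induction T) simp_all

section \<open>Coherence of the product of polynomials\<close>

text \<open>The empty polynomial needs the axiom \<open>rdist_lzero\<close>, and the step the axiom \<open>rdist_add_assoc\<close>. This
  describes the right distributor of two polynomials and is used when \<open>S\<close> is itself a product.\<close>

lemma scale_iso_append:
  assumes "S \<in> polys" and [simp]: "S' \<in> polys" "set w \<subseteq> Obj B"
  shows "scale_iso (S @ S') w \<cdot> (append_iso S S' \<boxtimes> \<iota> (word w))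
    = append_iso (scale S w) (scale S' w) \<cdot> (scale_iso S w \<boxplus> scale_iso S' w)
        \<cdot> \<delta>\<^sup>r (sums S) (sums S') (word w)"
  using assms(1)
proof (induction S)
  case Nil
  have "scale_iso S' w \<cdot> (\<lambda>\<^sup>\<oplus> (sums S') \<boxtimes> \<iota> (word w))
      = scale_iso S' w \<cdot> \<lambda>\<^sup>\<oplus> (sums S' \<otimes> word w) \<cdot> (\<lambda>\<^sup>\<bullet> (word w) \<boxplus> \<iota> (sums S' \<otimes> word w))
          \<cdot> \<delta>\<^sup>r \<zero> (sums S') (word w)"
    by (subst rdist_lzero[symmetric]) simp_all
  also have "\<dots> = \<lambda>\<^sup>\<oplus> (sums (scale S' w)) \<cdot> (\<iota> \<zero> \<boxplus> scale_iso S' w)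
          \<cdot> (\<lambda>\<^sup>\<bullet> (word w) \<boxplus> \<iota> (sums S' \<otimes> word w)) \<cdot> \<delta>\<^sup>r \<zero> (sums S') (word w)"
    using add.segment2[OF add.lunit_natural_arr[of "scale_iso S' w"]] by (simp del: merge_tensor)
  finally show ?case by simp
next
  case (Cons s S)
  then have [simp]: "set s \<subseteq> Obj B" "S \<in> polys" by simp_all
  let ?R = sums and ?P = word
  let ?X = "scale_iso (S @ S') w" and ?\<phi> = "append_iso (scale S w) (scale S' w)"
  have "scale_iso ((s # S) @ S') w \<cdot> (append_iso (s # S) S' \<boxtimes> \<iota> (?P w))
      = (join s w \<boxplus> ?X) \<cdot> \<delta>\<^sup>r (?P s) (?R (S @ S')) (?P w)
          \<cdot> ((\<iota> (?P s) \<boxplus> append_iso S S') \<boxtimes> \<iota> (?P w)) \<cdot> (\<alpha>\<^sup>\<oplus> (?P s) (?R S) (?R S') \<boxtimes> \<iota> (?P w))"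
    by simp
  also have "\<dots> = (join s w \<boxplus> ?X) \<cdot> (\<iota> (?P s \<otimes> ?P w) \<boxplus> (append_iso S S' \<boxtimes> \<iota> (?P w)))
          \<cdot> \<delta>\<^sup>r (?P s) (?R S \<oplus> ?R S') (?P w) \<cdot> (\<alpha>\<^sup>\<oplus> (?P s) (?R S) (?R S') \<boxtimes> \<iota> (?P w))"
    using add.segment2[OF rdist_natural_arr[of "\<iota> (?P s)" "append_iso S S'" "\<iota> (?P w)"]]
    by (simp del: merge_tensor)
  also have "\<dots> = (join s w \<boxplus> (?X \<cdot> (append_iso S S' \<boxtimes> \<iota> (?P w))))
          \<cdot> \<delta>\<^sup>r (?P s) (?R S \<oplus> ?R S') (?P w) \<cdot> (\<alpha>\<^sup>\<oplus> (?P s) (?R S) (?R S') \<boxtimes> \<iota> (?P w))"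
    by simp
  also have "\<dots> = (join s w \<boxplus> (?\<phi> \<cdot> (scale_iso S w \<boxplus> scale_iso S' w)))
          \<cdot> (\<iota> (?P s \<otimes> ?P w) \<boxplus> \<delta>\<^sup>r (?R S) (?R S') (?P w))
          \<cdot> \<delta>\<^sup>r (?P s) (?R S \<oplus> ?R S') (?P w) \<cdot> (\<alpha>\<^sup>\<oplus> (?P s) (?R S) (?R S') \<boxtimes> \<iota> (?P w))"
    by (subst Cons.IH) simp_all
  also have "\<dots> = (join s w \<boxplus> (?\<phi> \<cdot> (scale_iso S w \<boxplus> scale_iso S' w)))
          \<cdot> \<alpha>\<^sup>\<oplus> (?P s \<otimes> ?P w) (?R S \<otimes> ?P w) (?R S' \<otimes> ?P w)
          \<cdot> (\<delta>\<^sup>r (?P s) (?R S) (?P w) \<boxplus> \<iota> (?R S' \<otimes> ?P w)) \<cdot> \<delta>\<^sup>r (?P s \<oplus> ?R S) (?R S') (?P w)"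
    by (subst rdist_add_assoc) simp_all
  also have "\<dots> = (\<iota> (?P (s @ w)) \<boxplus> ?\<phi>) \<cdot> (join s w \<boxplus> (scale_iso S w \<boxplus> scale_iso S' w))
          \<cdot> \<alpha>\<^sup>\<oplus> (?P s \<otimes> ?P w) (?R S \<otimes> ?P w) (?R S' \<otimes> ?P w)
          \<cdot> (\<delta>\<^sup>r (?P s) (?R S) (?P w) \<boxplus> \<iota> (?R S' \<otimes> ?P w)) \<cdot> \<delta>\<^sup>r (?P s \<oplus> ?R S) (?R S') (?P w)"
    by simp
  also have "\<dots> = (\<iota> (?P (s @ w)) \<boxplus> ?\<phi>)
          \<cdot> \<alpha>\<^sup>\<oplus> (?P (s @ w)) (?R (scale S w)) (?R (scale S' w))
          \<cdot> ((join s w \<boxplus> scale_iso S w) \<boxplus> scale_iso S' w)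
          \<cdot> (\<delta>\<^sup>r (?P s) (?R S) (?P w) \<boxplus> \<iota> (?R S' \<otimes> ?P w)) \<cdot> \<delta>\<^sup>r (?P s \<oplus> ?R S) (?R S') (?P w)"
    using add.segment2[OF add.assoc_natural_arr[of "join s w" "scale_iso S w" "scale_iso S' w", symmetric]]
    by (simp del: merge_tensor)
  finally show ?case by simp
qed

text \<open>This is what makes the left distributor strict. It mirrors \<open>scale_iso_append\<close>, with the axioms
  \<open>ldist_lzero\<close> and \<open>ldist_add_assoc\<close>, except that here the concatenations have to be reassociated
  at the end.\<close>

lemma prods_iso_append:
  assumes "T \<in> polys" and [simp]: "S \<in> polys" "U \<in> polys"
  shows "prods_iso S (T @ U) \<cdot> (\<iota> (sums S) \<boxtimes> append_iso T U)
    = append_iso (prods S T) (prods S U) \<cdot> (prods_iso S T \<boxplus> prods_iso S U)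
        \<cdot> \<delta>\<^sup>l (sums S) (sums T) (sums U)"
  using assms(1)
proof (induction T)
  case Nil
  have "prods_iso S U \<cdot> (\<iota> (sums S) \<boxtimes> \<lambda>\<^sup>\<oplus> (sums U))
      = prods_iso S U \<cdot> \<lambda>\<^sup>\<oplus> (sums S \<otimes> sums U) \<cdot> (\<rho>\<^sup>\<bullet> (sums S) \<boxplus> \<iota> (sums S \<otimes> sums U))
          \<cdot> \<delta>\<^sup>l (sums S) \<zero> (sums U)"
    by (subst ldist_lzero[symmetric]) simp_all
  also have "\<dots> = \<lambda>\<^sup>\<oplus> (sums (prods S U)) \<cdot> (\<iota> \<zero> \<boxplus> prods_iso S U)
          \<cdot> (\<rho>\<^sup>\<bullet> (sums S) \<boxplus> \<iota> (sums S \<otimes> sums U)) \<cdot> \<delta>\<^sup>l (sums S) \<zero> (sums U)"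
    using add.segment2[OF add.lunit_natural_arr[of "prods_iso S U"]] by (simp del: merge_tensor)
  finally show ?case by simp
next
  case (Cons t T)
  then have [simp]: "set t \<subseteq> Obj B" "T \<in> polys" by simp_all
  let ?R = sums and ?P = word
  let ?\<sigma> = "scale_iso S t" and ?X = "prods_iso S T" and ?Y = "prods_iso S U"
    and ?\<phi> = "append_iso (prods S T) (prods S U)"
  have "prods_iso S ((t # T) @ U) \<cdot> (\<iota> (?R S) \<boxtimes> append_iso (t # T) U)
      = append_iso (scale S t) (prods S T @ prods S U) \<cdot> (?\<sigma> \<boxplus> prods_iso S (T @ U))
          \<cdot> \<delta>\<^sup>l (?R S) (?P t) (?R (T @ U)) \<cdot> (\<iota> (?R S) \<boxtimes> (\<iota> (?P t) \<boxplus> append_iso T U))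
          \<cdot> (\<iota> (?R S) \<boxtimes> \<alpha>\<^sup>\<oplus> (?P t) (?R T) (?R U))"
    by simp
  also have "\<dots> = append_iso (scale S t) (prods S T @ prods S U) \<cdot> (?\<sigma> \<boxplus> prods_iso S (T @ U))
          \<cdot> (\<iota> (?R S \<otimes> ?P t) \<boxplus> \<iota> (?R S) \<boxtimes> append_iso T U)
          \<cdot> \<delta>\<^sup>l (?R S) (?P t) (?R T \<oplus> ?R U) \<cdot> (\<iota> (?R S) \<boxtimes> \<alpha>\<^sup>\<oplus> (?P t) (?R T) (?R U))"
    using add.segment2[OF ldist_natural_arr[of "\<iota> (?R S)" "\<iota> (?P t)" "append_iso T U"]]
    by (simp del: merge_tensor)
  also have "\<dots> = append_iso (scale S t) (prods S T @ prods S U)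
          \<cdot> (?\<sigma> \<boxplus> (prods_iso S (T @ U) \<cdot> (\<iota> (?R S) \<boxtimes> append_iso T U)))
          \<cdot> \<delta>\<^sup>l (?R S) (?P t) (?R T \<oplus> ?R U) \<cdot> (\<iota> (?R S) \<boxtimes> \<alpha>\<^sup>\<oplus> (?P t) (?R T) (?R U))"
    by simp
  also have "\<dots> = append_iso (scale S t) (prods S T @ prods S U)
          \<cdot> (?\<sigma> \<boxplus> (?\<phi> \<cdot> (?X \<boxplus> ?Y)))
          \<cdot> (\<iota> (?R S \<otimes> ?P t) \<boxplus> \<delta>\<^sup>l (?R S) (?R T) (?R U))
          \<cdot> \<delta>\<^sup>l (?R S) (?P t) (?R T \<oplus> ?R U) \<cdot> (\<iota> (?R S) \<boxtimes> \<alpha>\<^sup>\<oplus> (?P t) (?R T) (?R U))"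
    by (subst Cons.IH) simp_all
  also have "\<dots> = append_iso (scale S t) (prods S T @ prods S U)
          \<cdot> (?\<sigma> \<boxplus> (?\<phi> \<cdot> (?X \<boxplus> ?Y)))
          \<cdot> \<alpha>\<^sup>\<oplus> (?R S \<otimes> ?P t) (?R S \<otimes> ?R T) (?R S \<otimes> ?R U)
          \<cdot> (\<delta>\<^sup>l (?R S) (?P t) (?R T) \<boxplus> \<iota> (?R S \<otimes> ?R U)) \<cdot> \<delta>\<^sup>l (?R S) (?P t \<oplus> ?R T) (?R U)"
    by (subst ldist_add_assoc) simp_all
  also have "\<dots> = append_iso (scale S t) (prods S T @ prods S U)
          \<cdot> (\<iota> (?R (scale S t)) \<boxplus> ?\<phi>) \<cdot> (?\<sigma> \<boxplus> (?X \<boxplus> ?Y))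
          \<cdot> \<alpha>\<^sup>\<oplus> (?R S \<otimes> ?P t) (?R S \<otimes> ?R T) (?R S \<otimes> ?R U)
          \<cdot> (\<delta>\<^sup>l (?R S) (?P t) (?R T) \<boxplus> \<iota> (?R S \<otimes> ?R U)) \<cdot> \<delta>\<^sup>l (?R S) (?P t \<oplus> ?R T) (?R U)"
    by simp
  also have "\<dots> = append_iso (scale S t) (prods S T @ prods S U)
          \<cdot> (\<iota> (?R (scale S t)) \<boxplus> ?\<phi>)
          \<cdot> \<alpha>\<^sup>\<oplus> (?R (scale S t)) (?R (prods S T)) (?R (prods S U))
          \<cdot> ((?\<sigma> \<boxplus> ?X) \<boxplus> ?Y)
          \<cdot> (\<delta>\<^sup>l (?R S) (?P t) (?R T) \<boxplus> \<iota> (?R S \<otimes> ?R U)) \<cdot> \<delta>\<^sup>l (?R S) (?P t \<oplus> ?R T) (?R U)"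
    using add.segment2[OF add.assoc_natural_arr[of ?\<sigma> ?X ?Y, symmetric]]
    by (simp del: merge_tensor)
  also have "\<dots> = append_iso (prods S (t # T)) (prods S U)
          \<cdot> (append_iso (scale S t) (prods S T) \<boxplus> \<iota> (?R (prods S U)))
          \<cdot> ((?\<sigma> \<boxplus> ?X) \<boxplus> ?Y)
          \<cdot> (\<delta>\<^sup>l (?R S) (?P t) (?R T) \<boxplus> \<iota> (?R S \<otimes> ?R U)) \<cdot> \<delta>\<^sup>l (?R S) (?P t \<oplus> ?R T) (?R U)"
    using add.segment2[OF append_iso_assoc[of "scale S t" "prods S T" "prods S U"]]
    by (simp del: merge_tensor)
  finally show ?case by simp
qed

lemma prods_iso_nil: "T \<in> polys \<Longrightarrow> prods_iso [] T = \<lambda>\<^sup>\<bullet> (sums T)"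
  by (induction T) (simp_all add: lnull_zero lnull_add)

lemma scale_iso_one: "S \<in> polys \<Longrightarrow> scale_iso S [] = \<rho>\<^sup>\<otimes> (sums S)"
  by (induction S) (simp_all add: mul_runit_zero join_nil rdist_one)

text \<open>The polynomial \<open>[[]]\<close> with the empty word as its only summand is the multiplicative unit. Its value
  is \<open>\<one> \<oplus> \<zero>\<close>, so \<open>\<rho>\<^sup>\<oplus> \<one>\<close> has to mediate between it and \<open>\<one>\<close>.\<close>

lemma prods_iso_one_right:
  assumes [simp]: "S \<in> polys"
  shows "prods_iso S [[]] = \<rho>\<^sup>\<otimes> (sums S) \<cdot> (\<iota> (sums S) \<boxtimes> \<rho>\<^sup>\<oplus> \<one>)"
proof -
  have "prods_iso S [[]] = \<rho>\<^sup>\<oplus> (sums S) \<cdot> (\<rho>\<^sup>\<otimes> (sums S) \<boxplus> \<iota> \<zero>)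
      \<cdot> (\<iota> (sums S \<otimes> \<one>) \<boxplus> \<rho>\<^sup>\<bullet> (sums S)) \<cdot> \<delta>\<^sup>l (sums S) \<one> \<zero>"
    by (simp add: scale_iso_one append_iso_nil)
  also have "\<dots> = \<rho>\<^sup>\<otimes> (sums S) \<cdot> \<rho>\<^sup>\<oplus> (sums S \<otimes> \<one>)
      \<cdot> (\<iota> (sums S \<otimes> \<one>) \<boxplus> \<rho>\<^sup>\<bullet> (sums S)) \<cdot> \<delta>\<^sup>l (sums S) \<one> \<zero>"
    using add.segment2[OF add.runit_natural_arr[of "\<rho>\<^sup>\<otimes> (sums S)"]] by (simp del: merge_tensor)
  also have "\<dots> = \<rho>\<^sup>\<otimes> (sums S) \<cdot> (\<iota> (sums S) \<boxtimes> \<rho>\<^sup>\<oplus> \<one>)"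
    by (subst ldist_rzero) simp_all
  finally show ?thesis .
qed

lemma prods_iso_one_left:
  assumes "T \<in> polys"
  shows "prods_iso [[]] T = \<lambda>\<^sup>\<otimes> (sums T) \<cdot> (\<rho>\<^sup>\<oplus> \<one> \<boxtimes> \<iota> (sums T))"
  using assms
proof (induction T)
  case Nil
  show ?case using rnull_natural_arr[of "\<rho>\<^sup>\<oplus> \<one>"] by (simp add: mul_lunit_zero)
next
  case (Cons t T)
  then have [simp]: "set t \<subseteq> Obj B" "T \<in> polys" by simp_all
  let ?R = sums and ?P = word and ?u = "\<rho>\<^sup>\<oplus> \<one>"
  \<comment> \<open>One word is the case of \<open>rdist_rzero\<close>: the summand \<open>\<zero> \<otimes> word t\<close> is absorbed.\<close>
  have step: "\<rho>\<^sup>\<oplus> (?P t) \<cdot> scale_iso [[]] t = \<lambda>\<^sup>\<otimes> (?P t) \<cdot> (?u \<boxtimes> \<iota> (?P t))"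
  proof -
    have "\<rho>\<^sup>\<oplus> (?P t) \<cdot> scale_iso [[]] t = \<rho>\<^sup>\<oplus> (?P t) \<cdot> (\<lambda>\<^sup>\<otimes> (?P t) \<boxplus> \<iota> \<zero>)
        \<cdot> (\<iota> (\<one> \<otimes> ?P t) \<boxplus> \<lambda>\<^sup>\<bullet> (?P t)) \<cdot> \<delta>\<^sup>r \<one> \<zero> (?P t)"
      by (simp add: join_def word_def)
    also have "\<dots> = \<lambda>\<^sup>\<otimes> (?P t) \<cdot> \<rho>\<^sup>\<oplus> (\<one> \<otimes> ?P t)
        \<cdot> (\<iota> (\<one> \<otimes> ?P t) \<boxplus> \<lambda>\<^sup>\<bullet> (?P t)) \<cdot> \<delta>\<^sup>r \<one> \<zero> (?P t)"
      using add.segment2[OF add.runit_natural_arr[of "\<lambda>\<^sup>\<otimes> (?P t)"]] by (simp del: merge_tensor)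
    also have "\<dots> = \<lambda>\<^sup>\<otimes> (?P t) \<cdot> (?u \<boxtimes> \<iota> (?P t))"
      by (subst rdist_rzero) simp_all
    finally show ?thesis .
  qed
  have "prods_iso [[]] (t # T) = (\<iota> (?P t) \<boxplus> \<lambda>\<^sup>\<oplus> (?R T)) \<cdot> \<alpha>\<^sup>\<oplus> (?P t) \<zero> (?R T)
      \<cdot> (scale_iso [[]] t \<boxplus> prods_iso [[]] T) \<cdot> \<delta>\<^sup>l (?R [[]]) (?P t) (?R T)"
    by (simp del: scale_iso.simps merge_tensor)
  also have "\<dots> = (\<rho>\<^sup>\<oplus> (?P t) \<boxplus> \<iota> (?R T))
      \<cdot> (scale_iso [[]] t \<boxplus> prods_iso [[]] T) \<cdot> \<delta>\<^sup>l (?R [[]]) (?P t) (?R T)"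
    using add.segment2[OF add.triangle[of "?P t" "?R T"]] by (simp del: scale_iso.simps merge_tensor)
  also have "\<dots> = ((\<rho>\<^sup>\<oplus> (?P t) \<cdot> scale_iso [[]] t) \<boxplus> prods_iso [[]] T)
      \<cdot> \<delta>\<^sup>l (?R [[]]) (?P t) (?R T)"
    by (simp del: scale_iso.simps)
  also have "\<dots> = ((\<lambda>\<^sup>\<otimes> (?P t) \<cdot> (?u \<boxtimes> \<iota> (?P t))) \<boxplus> (\<lambda>\<^sup>\<otimes> (?R T) \<cdot> (?u \<boxtimes> \<iota> (?R T))))
      \<cdot> \<delta>\<^sup>l (?R [[]]) (?P t) (?R T)"
    by (simp only: step Cons.IH[OF \<open>T \<in> polys\<close>])
  also have "\<dots> = (\<lambda>\<^sup>\<otimes> (?P t) \<boxplus> \<lambda>\<^sup>\<otimes> (?R T)) \<cdot> (?u \<boxtimes> \<iota> (?P t) \<boxplus> ?u \<boxtimes> \<iota> (?R T))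
      \<cdot> \<delta>\<^sup>l (?R [[]]) (?P t) (?R T)"
    by simp
  also have "\<dots> = ((\<lambda>\<^sup>\<otimes> (?P t) \<boxplus> \<lambda>\<^sup>\<otimes> (?R T)) \<cdot> \<delta>\<^sup>l \<one> (?P t) (?R T))
      \<cdot> (?u \<boxtimes> \<iota> (?P t \<oplus> ?R T))"
    using add.segment2[OF ldist_natural_arr[of ?u "\<iota> (?P t)" "\<iota> (?R T)", symmetric]]
      ldist_natural_arr[of ?u "\<iota> (?P t)" "\<iota> (?R T)", symmetric]
    by (simp del: merge_tensor)
  also have "\<dots> = \<lambda>\<^sup>\<otimes> (?P t \<oplus> ?R T) \<cdot> (?u \<boxtimes> \<iota> (?P t \<oplus> ?R T))"
    by (subst ldist_one) simp_all
  finally show ?case by simp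
qed

text \<open>Associativity of \<open>prods_iso\<close> is proved in three steps, for one word in the last two factors, for
  one word in the last factor, and in general. Each is an induction whose base case is an axiom on
  the null isomorphisms and whose step is an axiom on the distributors and the multiplicative
  associator: here \<open>lnull_mul\<close> and \<open>rdist_mul_assoc\<close>, then \<open>lrnull_mul\<close> and \<open>lrdist_mul_assoc\<close>, and
  finally \<open>rnull_mul\<close> and \<open>ldist_mul_assoc\<close>.\<close>

lemma scale_iso_scale:
  assumes "S \<in> polys" and [simp]: "set v \<subseteq> Obj B" "set w \<subseteq> Obj B"
  shows "scale_iso (scale S v) w \<cdot> (scale_iso S v \<boxtimes> \<iota> (word w))
    = scale_iso S (v @ w) \<cdot> (\<iota> (sums S) \<boxtimes> join v w) \<cdot> \<alpha>\<^sup>\<otimes> (sums S) (word v) (word w)"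
  using assms(1)
proof (induction S)
  case Nil
  show ?case
    using add.segment2[OF lnull_natural_arr[of "join v w"]] by (simp add: lnull_mul)
next
  case (Cons s S)
  then have [simp]: "set s \<subseteq> Obj B" "S \<in> polys" by simp_all
  let ?R = sums and ?P = word
  have "scale_iso (scale (s # S) v) w \<cdot> (scale_iso (s # S) v \<boxtimes> \<iota> (?P w))
      = (join (s @ v) w \<boxplus> scale_iso (scale S v) w) \<cdot> \<delta>\<^sup>r (?P (s @ v)) (?R (scale S v)) (?P w)
        \<cdot> ((join s v \<boxplus> scale_iso S v) \<boxtimes> \<iota> (?P w)) \<cdot> (\<delta>\<^sup>r (?P s) (?R S) (?P v) \<boxtimes> \<iota> (?P w))"
    by simp
  also have "\<dots> = (join (s @ v) w \<boxplus> scale_iso (scale S v) w)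
        \<cdot> (join s v \<boxtimes> \<iota> (?P w) \<boxplus> scale_iso S v \<boxtimes> \<iota> (?P w))
        \<cdot> \<delta>\<^sup>r (?P s \<otimes> ?P v) (?R S \<otimes> ?P v) (?P w) \<cdot> (\<delta>\<^sup>r (?P s) (?R S) (?P v) \<boxtimes> \<iota> (?P w))"
    using add.segment2[OF rdist_natural_arr[of "join s v" "scale_iso S v" "\<iota> (?P w)"]]
    by (simp del: merge_tensor)
  also have "\<dots> = ((join (s @ v) w \<cdot> (join s v \<boxtimes> \<iota> (?P w)))
          \<boxplus> (scale_iso (scale S v) w \<cdot> (scale_iso S v \<boxtimes> \<iota> (?P w))))
        \<cdot> \<delta>\<^sup>r (?P s \<otimes> ?P v) (?R S \<otimes> ?P v) (?P w) \<cdot> (\<delta>\<^sup>r (?P s) (?R S) (?P v) \<boxtimes> \<iota> (?P w))"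
    by simp
  also have "\<dots> = ((join s (v @ w) \<cdot> (\<iota> (?P s) \<boxtimes> join v w))
          \<boxplus> (scale_iso S (v @ w) \<cdot> (\<iota> (?R S) \<boxtimes> join v w)))
        \<cdot> (\<alpha>\<^sup>\<otimes> (?P s) (?P v) (?P w) \<boxplus> \<alpha>\<^sup>\<otimes> (?R S) (?P v) (?P w))
        \<cdot> \<delta>\<^sup>r (?P s \<otimes> ?P v) (?R S \<otimes> ?P v) (?P w) \<cdot> (\<delta>\<^sup>r (?P s) (?R S) (?P v) \<boxtimes> \<iota> (?P w))"
    by (subst join_assoc, simp, simp, simp, subst Cons.IH) simp_all
  also have "\<dots> = ((join s (v @ w) \<cdot> (\<iota> (?P s) \<boxtimes> join v w))
          \<boxplus> (scale_iso S (v @ w) \<cdot> (\<iota> (?R S) \<boxtimes> join v w)))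
        \<cdot> \<delta>\<^sup>r (?P s) (?R S) (?P v \<otimes> ?P w) \<cdot> \<alpha>\<^sup>\<otimes> (?P s \<oplus> ?R S) (?P v) (?P w)"
    by (subst rdist_mul_assoc) simp_all
  also have "\<dots> = (join s (v @ w) \<boxplus> scale_iso S (v @ w))
        \<cdot> (\<iota> (?P s) \<boxtimes> join v w \<boxplus> \<iota> (?R S) \<boxtimes> join v w)
        \<cdot> \<delta>\<^sup>r (?P s) (?R S) (?P v \<otimes> ?P w) \<cdot> \<alpha>\<^sup>\<otimes> (?P s \<oplus> ?R S) (?P v) (?P w)"
    by simp
  also have "\<dots> = (join s (v @ w) \<boxplus> scale_iso S (v @ w)) \<cdot> \<delta>\<^sup>r (?P s) (?R S) (?P (v @ w))
        \<cdot> (\<iota> (?P s \<oplus> ?R S) \<boxtimes> join v w) \<cdot> \<alpha>\<^sup>\<otimes> (?P s \<oplus> ?R S) (?P v) (?P w)"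
    using add.segment2[OF rdist_natural_arr[of "\<iota> (?P s)" "\<iota> (?R S)" "join v w", symmetric]]
    by (simp del: merge_tensor)
  finally show ?case by simp
qed

text \<open>The product \<open>prods S (t # T)\<close> is a concatenation, so \<open>scale_iso_append\<close> produces a right distributor
  which \<open>lrdist_mul_assoc\<close> exchanges with the left distributor of \<open>prods_iso\<close>.\<close>

lemma scale_iso_prods:
  assumes "T \<in> polys" and [simp]: "S \<in> polys" "set w \<subseteq> Obj B"
  shows "scale_iso (prods S T) w \<cdot> (prods_iso S T \<boxtimes> \<iota> (word w))
    = prods_iso S (scale T w) \<cdot> (\<iota> (sums S) \<boxtimes> scale_iso T w)
        \<cdot> \<alpha>\<^sup>\<otimes> (sums S) (sums T) (word w)"
  using assms(1)
proof (induction T)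
  case Nil
  show ?case by (simp add: lrnull_mul)
next
  case (Cons t T)
  then have [simp]: "set t \<subseteq> Obj B" "T \<in> polys" by simp_all
  let ?R = sums and ?P = word
  let ?\<sigma> = "scale_iso S t" and ?X = "prods_iso S T" and ?w = "\<iota> (word w)"
    and ?\<phi> = "append_iso (scale S (t @ w)) (prods S (scale T w))"
    and ?d = "\<delta>\<^sup>r (sums S \<otimes> word t) (sums S \<otimes> sums T) (word w) \<cdot> (\<delta>\<^sup>l (sums S) (word t) (sums T) \<boxtimes> \<iota> (word w))"
    and ?d' = "\<delta>\<^sup>l (sums S) (word t \<otimes> word w) (sums T \<otimes> word w) \<cdot> (\<iota> (sums S) \<boxtimes> \<delta>\<^sup>r (word t) (sums T) (word w)) \<cdot> \<alpha>\<^sup>\<otimes> (sums S) (word t \<oplus> sums T) (word w)"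
  have "scale_iso (prods S (t # T)) w \<cdot> (prods_iso S (t # T) \<boxtimes> ?w)
      = scale_iso (scale S t @ prods S T) w \<cdot> (append_iso (scale S t) (prods S T) \<boxtimes> ?w)
        \<cdot> ((?\<sigma> \<boxplus> ?X) \<boxtimes> ?w) \<cdot> (\<delta>\<^sup>l (?R S) (?P t) (?R T) \<boxtimes> ?w)"
    by simp
  also have "\<dots> = ?\<phi> \<cdot> (scale_iso (scale S t) w \<boxplus> scale_iso (prods S T) w)
        \<cdot> \<delta>\<^sup>r (?R (scale S t)) (?R (prods S T)) (?P w)
        \<cdot> ((?\<sigma> \<boxplus> ?X) \<boxtimes> ?w) \<cdot> (\<delta>\<^sup>l (?R S) (?P t) (?R T) \<boxtimes> ?w)"
    using add.segment2[OF scale_iso_append[of "scale S t" "prods S T" w]]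
    by (simp del: merge_tensor)
  also have "\<dots> = ?\<phi> \<cdot> (scale_iso (scale S t) w \<boxplus> scale_iso (prods S T) w)
        \<cdot> (?\<sigma> \<boxtimes> ?w \<boxplus> ?X \<boxtimes> ?w) \<cdot> ?d"
    using add.segment2[OF rdist_natural_arr[of ?\<sigma> ?X ?w]] by (simp del: merge_tensor)
  also have "\<dots> = ?\<phi> \<cdot> ((scale_iso (scale S t) w \<cdot> (?\<sigma> \<boxtimes> ?w))
          \<boxplus> (scale_iso (prods S T) w \<cdot> (?X \<boxtimes> ?w))) \<cdot> ?d"
    by simp
  also have "\<dots> = ?\<phi> \<cdot> ((scale_iso S (t @ w) \<cdot> (\<iota> (?R S) \<boxtimes> join t w))
          \<boxplus> (prods_iso S (scale T w) \<cdot> (\<iota> (?R S) \<boxtimes> scale_iso T w)))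
        \<cdot> ((\<alpha>\<^sup>\<otimes> (?R S) (?P t) (?P w) \<boxplus> \<alpha>\<^sup>\<otimes> (?R S) (?R T) (?P w)) \<cdot> ?d)"
    by (subst scale_iso_scale, simp, simp, simp, subst Cons.IH) simp_all
  also have "\<dots> = ?\<phi> \<cdot> ((scale_iso S (t @ w) \<cdot> (\<iota> (?R S) \<boxtimes> join t w))
          \<boxplus> (prods_iso S (scale T w) \<cdot> (\<iota> (?R S) \<boxtimes> scale_iso T w))) \<cdot> ?d'"
    by (subst lrdist_mul_assoc) simp_all
  also have "\<dots> = ?\<phi> \<cdot> (scale_iso S (t @ w) \<boxplus> prods_iso S (scale T w))
        \<cdot> (\<iota> (?R S) \<boxtimes> join t w \<boxplus> \<iota> (?R S) \<boxtimes> scale_iso T w) \<cdot> ?d'"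
    by simp
  also have "\<dots> = ?\<phi> \<cdot> (scale_iso S (t @ w) \<boxplus> prods_iso S (scale T w))
        \<cdot> \<delta>\<^sup>l (?R S) (?P (t @ w)) (?R (scale T w)) \<cdot> (\<iota> (?R S) \<boxtimes> (join t w \<boxplus> scale_iso T w))
        \<cdot> (\<iota> (?R S) \<boxtimes> \<delta>\<^sup>r (?P t) (?R T) (?P w)) \<cdot> \<alpha>\<^sup>\<otimes> (?R S) (?P t \<oplus> ?R T) (?P w)"
    using add.segment2[OF ldist_natural_arr[of "\<iota> (?R S)" "join t w" "scale_iso T w", symmetric]]
    by (simp del: merge_tensor)
  finally show ?case by simp
qed

text \<open>In the step \<open>prods_iso_append\<close> reassembles the right-hand side, because \<open>prods T (u # U)\<close> is a
  concatenation.\<close>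

lemma prods_iso_assoc:
  assumes "U \<in> polys" and [simp]: "S \<in> polys" "T \<in> polys"
  shows "prods_iso (prods S T) U \<cdot> (prods_iso S T \<boxtimes> \<iota> (sums U))
    = prods_iso S (prods T U) \<cdot> (\<iota> (sums S) \<boxtimes> prods_iso T U)
        \<cdot> \<alpha>\<^sup>\<otimes> (sums S) (sums T) (sums U)"
  using assms(1)
proof (induction U)
  case Nil
  show ?case using rnull_natural_arr[of "prods_iso S T"] by (simp add: rnull_mul)
next
  case (Cons u U)
  then have [simp]: "set u \<subseteq> Obj B" "U \<in> polys" by simp_all
  let ?R = sums and ?P = word
  let ?\<psi> = "prods_iso S T" and ?S = "\<iota> (sums S)"
    and ?\<phi> = "append_iso (prods S (scale T u)) (prods S (prods T U))"
    and ?d = "\<delta>\<^sup>l (sums S \<otimes> sums T) (word u) (sums U)"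
    and ?d' = "\<delta>\<^sup>l (sums S) (sums T \<otimes> word u) (sums T \<otimes> sums U) \<cdot> (\<iota> (sums S) \<boxtimes> \<delta>\<^sup>l (sums T) (word u) (sums U)) \<cdot> \<alpha>\<^sup>\<otimes> (sums S) (sums T) (word u \<oplus> sums U)"
  have "prods_iso (prods S T) (u # U) \<cdot> (?\<psi> \<boxtimes> \<iota> (?R (u # U)))
      = ?\<phi> \<cdot> (scale_iso (prods S T) u \<boxplus> prods_iso (prods S T) U)
        \<cdot> \<delta>\<^sup>l (?R (prods S T)) (?P u) (?R U) \<cdot> (?\<psi> \<boxtimes> \<iota> (?P u \<oplus> ?R U))"
    by simp
  also have "\<dots> = ?\<phi> \<cdot> (scale_iso (prods S T) u \<boxplus> prods_iso (prods S T) U)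
        \<cdot> (?\<psi> \<boxtimes> \<iota> (?P u) \<boxplus> ?\<psi> \<boxtimes> \<iota> (?R U)) \<cdot> ?d"
    using ldist_natural_arr[of ?\<psi> "\<iota> (?P u)" "\<iota> (?R U)"] by (simp del: merge_tensor)
  also have "\<dots> = ?\<phi> \<cdot> ((scale_iso (prods S T) u \<cdot> (?\<psi> \<boxtimes> \<iota> (?P u)))
          \<boxplus> (prods_iso (prods S T) U \<cdot> (?\<psi> \<boxtimes> \<iota> (?R U)))) \<cdot> ?d"
    by simp
  also have "\<dots> = ?\<phi> \<cdot> ((prods_iso S (scale T u) \<cdot> (?S \<boxtimes> scale_iso T u))
          \<boxplus> (prods_iso S (prods T U) \<cdot> (?S \<boxtimes> prods_iso T U)))
        \<cdot> ((\<alpha>\<^sup>\<otimes> (?R S) (?R T) (?P u) \<boxplus> \<alpha>\<^sup>\<otimes> (?R S) (?R T) (?R U)) \<cdot> ?d)"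
    by (subst scale_iso_prods, simp, simp, simp, subst Cons.IH) simp_all
  also have "\<dots> = ?\<phi> \<cdot> ((prods_iso S (scale T u) \<cdot> (?S \<boxtimes> scale_iso T u))
          \<boxplus> (prods_iso S (prods T U) \<cdot> (?S \<boxtimes> prods_iso T U))) \<cdot> ?d'"
    by (subst ldist_mul_assoc[symmetric]) simp_all
  also have "\<dots> = ?\<phi> \<cdot> (prods_iso S (scale T u) \<boxplus> prods_iso S (prods T U))
        \<cdot> (?S \<boxtimes> scale_iso T u \<boxplus> ?S \<boxtimes> prods_iso T U) \<cdot> ?d'"
    by simp
  also have "\<dots> = ?\<phi> \<cdot> (prods_iso S (scale T u) \<boxplus> prods_iso S (prods T U))
        \<cdot> \<delta>\<^sup>l (?R S) (?R (scale T u)) (?R (prods T U))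
        \<cdot> (?S \<boxtimes> (scale_iso T u \<boxplus> prods_iso T U))
        \<cdot> (?S \<boxtimes> \<delta>\<^sup>l (?R T) (?P u) (?R U)) \<cdot> \<alpha>\<^sup>\<otimes> (?R S) (?R T) (?P u \<oplus> ?R U)"
    using add.segment2[OF ldist_natural_arr[of ?S "scale_iso T u" "prods_iso T U", symmetric]]
    by (simp del: merge_tensor)
  also have "\<dots> = prods_iso S (scale T u @ prods T U)
        \<cdot> (?S \<boxtimes> append_iso (scale T u) (prods T U)) \<cdot> (?S \<boxtimes> (scale_iso T u \<boxplus> prods_iso T U))
        \<cdot> (?S \<boxtimes> \<delta>\<^sup>l (?R T) (?P u) (?R U)) \<cdot> \<alpha>\<^sup>\<otimes> (?R S) (?R T) (?P u \<oplus> ?R U)"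
    using add.segment2[OF prods_iso_append[of "scale T u" S "prods T U"]] by (simp del: merge_tensor)
  finally show ?case by simp
qed

end
context tight_braided_bimonoidal_category
begin

declare ldist_iso [simp] rdist_iso [simp]

lemma scale_iso_iso [simp]: "\<lbrakk>S \<in> polys; set w \<subseteq> Obj B\<rbrakk> \<Longrightarrow> is_iso B (scale_iso S w)"
  by (induction S) simp_all

lemma prods_iso_iso [simp]: "\<lbrakk>S \<in> polys; T \<in> polys\<rbrakk> \<Longrightarrow> is_iso B (prods_iso S T)"
  by (induction T) simp_all

end

section \<open>Transport of structure along a realization\<close>

text \<open>Names \<open>S \<in> K\<close> for objects of a bimonoidal category, with operations on names that \<open>val\<close> respects up
  to arbitrarily chosen isomorphisms. The whole structure can be transported along any such choice;
  compatibilities between the isomorphisms are a matter of strictness only.\<close>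

locale realization = tight_braided_bimonoidal_category B
  for B :: "('o, 'm, 'z) braided_bimon_scheme" (structure) +
  fixes K :: "'k set" and val :: "'k \<Rightarrow> 'o"
    and plus_ob :: "'k \<Rightarrow> 'k \<Rightarrow> 'k" and zero_ob :: 'k
    and times_ob :: "'k \<Rightarrow> 'k \<Rightarrow> 'k" and unit_ob :: 'k
    and plus_iso :: "'k \<Rightarrow> 'k \<Rightarrow> 'm" and zero_iso :: 'm
    and times_iso :: "'k \<Rightarrow> 'k \<Rightarrow> 'm" and unit_iso :: 'm
  assumes val_obj [simp]: "S \<in> K \<Longrightarrow> val S \<in> Obj B"
    and plus_ob [simp]: "\<lbrakk>S \<in> K; T \<in> K\<rbrakk> \<Longrightarrow> plus_ob S T \<in> K"
    and zero_ob [simp]: "zero_ob \<in> K"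
    and times_ob [simp]: "\<lbrakk>S \<in> K; T \<in> K\<rbrakk> \<Longrightarrow> times_ob S T \<in> K"
    and unit_ob [simp]: "unit_ob \<in> K"
    and plus_iso: "\<lbrakk>S \<in> K; T \<in> K\<rbrakk> \<Longrightarrow> plus_iso S T \<in> iso_hom B (val S \<oplus> val T) (val (plus_ob S T))"
    and zero_iso: "zero_iso \<in> iso_hom B \<zero> (val zero_ob)"
    and times_iso: "\<lbrakk>S \<in> K; T \<in> K\<rbrakk> \<Longrightarrow> times_iso S T \<in> iso_hom B (val S \<otimes> val T) (val (times_ob S T))"
    and unit_iso: "unit_iso \<in> iso_hom B \<one> (val unit_ob)"
begin

lemma realization_arr [simp]:
  "\<lbrakk>S \<in> K; T \<in> K\<rbrakk> \<Longrightarrow> plus_iso S T \<in> Arr B"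
  "\<lbrakk>S \<in> K; T \<in> K\<rbrakk> \<Longrightarrow> Dom B (plus_iso S T) = val S \<oplus> val T"
  "\<lbrakk>S \<in> K; T \<in> K\<rbrakk> \<Longrightarrow> Cod B (plus_iso S T) = val (plus_ob S T)"
  "\<lbrakk>S \<in> K; T \<in> K\<rbrakk> \<Longrightarrow> is_iso B (plus_iso S T)"
  "zero_iso \<in> Arr B" "Dom B zero_iso = \<zero>" "Cod B zero_iso = val zero_ob" "is_iso B zero_iso"
  "\<lbrakk>S \<in> K; T \<in> K\<rbrakk> \<Longrightarrow> times_iso S T \<in> Arr B"
  "\<lbrakk>S \<in> K; T \<in> K\<rbrakk> \<Longrightarrow> Dom B (times_iso S T) = val S \<otimes> val T"
  "\<lbrakk>S \<in> K; T \<in> K\<rbrakk> \<Longrightarrow> Cod B (times_iso S T) = val (times_ob S T)"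
  "\<lbrakk>S \<in> K; T \<in> K\<rbrakk> \<Longrightarrow> is_iso B (times_iso S T)"
  "unit_iso \<in> Arr B" "Dom B unit_iso = \<one>" "Cod B unit_iso = val unit_ob" "is_iso B unit_iso"
  using plus_iso zero_iso times_iso unit_iso by (auto simp: add.iso_hom_arr)

text \<open>The value of a compound name such as \<open>plus_ob (plus_ob S T) U\<close> is only isomorphic to the
  corresponding sum of values. Names are therefore compared with objects through an isomorphism
  \<open>u : X \<rightarrow> val S\<close>, which exhibits \<open>X\<close> as a presentation of \<open>S\<close>. Presentations can be added and
  multiplied.\<close>

definition pres :: "'k \<Rightarrow> 'o \<Rightarrow> 'm \<Rightarrow> bool" where
  "pres S X u \<longleftrightarrow> S \<in> K \<and> X \<in> Obj B \<and> u \<in> Arr B \<and> Dom B u = X \<and> Cod B u = val S \<and> is_iso B u"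

definition plus_pres :: "'k \<Rightarrow> 'm \<Rightarrow> 'k \<Rightarrow> 'm \<Rightarrow> 'm" where
  "plus_pres S u T v = plus_iso S T \<cdot> (u \<boxplus> v)"

definition times_pres :: "'k \<Rightarrow> 'm \<Rightarrow> 'k \<Rightarrow> 'm \<Rightarrow> 'm" where
  "times_pres S u T v = times_iso S T \<cdot> (u \<boxtimes> v)"

text \<open>Conjugation of \<open>y : X \<rightarrow> Y\<close> by presentations of \<open>S\<close> and \<open>T\<close>.\<close>

definition lift :: "'k \<Rightarrow> 'm \<Rightarrow> 'k \<Rightarrow> 'm \<Rightarrow> 'm \<Rightarrow> 'k \<times> 'm \<times> 'k" where
  "lift S u T v y = (S, v \<cdot> y \<cdot> inv_arr B u, T)"

definition val_arr :: "'k \<times> 'm \<times> 'k \<Rightarrow> 'm" where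
  "val_arr x = fst (snd x)"

text \<open>The category of names, with the arrows of \<open>B\<close> between their values; source and target are recorded
  because different names may have equal values. Each structure arrow is the one of \<open>B\<close>, lifted
  along the presentations of its source and target by sums and products of values.\<close>

definition transported :: "('k, 'k \<times> 'm \<times> 'k) braided_bimon" where
  "transported = \<lparr>
    Obj = K,
    Arr = {x. fst x \<in> K \<and> snd (snd x) \<in> K \<and> val_arr x \<in> hom B (val (fst x)) (val (snd (snd x)))},
    Dom = fst,
    Cod = (\<lambda>x. snd (snd x)),
    Id = (\<lambda>S. (S, \<iota> (val S), S)),
    Comp = (\<lambda>y x. (fst x, val_arr y \<cdot> val_arr x, snd (snd y))),
    add_obj = plus_ob,
    add_arr = (\<lambda>x y. lift (plus_ob (fst x) (fst y)) (plus_iso (fst x) (fst y))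
      (plus_ob (snd (snd x)) (snd (snd y))) (plus_iso (snd (snd x)) (snd (snd y))) (val_arr x \<boxplus> val_arr y)),
    zero_obj = zero_ob,
    add_assoc = (\<lambda>S T U. lift (plus_ob (plus_ob S T) U) (plus_pres (plus_ob S T) (plus_iso S T) U (\<iota> (val U)))
      (plus_ob S (plus_ob T U)) (plus_pres S (\<iota> (val S)) (plus_ob T U) (plus_iso T U))
      (\<alpha>\<^sup>\<oplus> (val S) (val T) (val U))),
    add_lunit = (\<lambda>S. lift (plus_ob zero_ob S) (plus_pres zero_ob zero_iso S (\<iota> (val S))) S (\<iota> (val S)) (\<lambda>\<^sup>\<oplus> (val S))),
    add_runit = (\<lambda>S. lift (plus_ob S zero_ob) (plus_pres S (\<iota> (val S)) zero_ob zero_iso) S (\<iota> (val S)) (\<rho>\<^sup>\<oplus> (val S))),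
    add_braid = (\<lambda>S T. lift (plus_ob S T) (plus_iso S T) (plus_ob T S) (plus_iso T S) (\<zeta>\<^sup>\<oplus> (val S) (val T))),
    mul_obj = times_ob,
    mul_arr = (\<lambda>x y. lift (times_ob (fst x) (fst y)) (times_iso (fst x) (fst y))
      (times_ob (snd (snd x)) (snd (snd y))) (times_iso (snd (snd x)) (snd (snd y))) (val_arr x \<boxtimes> val_arr y)),
    one_obj = unit_ob,
    mul_assoc = (\<lambda>S T U. lift (times_ob (times_ob S T) U) (times_pres (times_ob S T) (times_iso S T) U (\<iota> (val U)))
      (times_ob S (times_ob T U)) (times_pres S (\<iota> (val S)) (times_ob T U) (times_iso T U))
      (\<alpha>\<^sup>\<otimes> (val S) (val T) (val U))),
    mul_lunit = (\<lambda>S. lift (times_ob unit_ob S) (times_pres unit_ob unit_iso S (\<iota> (val S))) S (\<iota> (val S)) (\<lambda>\<^sup>\<otimes> (val S))),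
    mul_runit = (\<lambda>S. lift (times_ob S unit_ob) (times_pres S (\<iota> (val S)) unit_ob unit_iso) S (\<iota> (val S)) (\<rho>\<^sup>\<otimes> (val S))),
    lnull = (\<lambda>S. lift (times_ob zero_ob S) (times_pres zero_ob zero_iso S (\<iota> (val S))) zero_ob zero_iso (\<lambda>\<^sup>\<bullet> (val S))),
    rnull = (\<lambda>S. lift (times_ob S zero_ob) (times_pres S (\<iota> (val S)) zero_ob zero_iso) zero_ob zero_iso (\<rho>\<^sup>\<bullet> (val S))),
    ldist = (\<lambda>S T U. lift (times_ob S (plus_ob T U)) (times_pres S (\<iota> (val S)) (plus_ob T U) (plus_iso T U))
      (plus_ob (times_ob S T) (times_ob S U)) (plus_pres (times_ob S T) (times_iso S T) (times_ob S U) (times_iso S U))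
      (\<delta>\<^sup>l (val S) (val T) (val U))),
    rdist = (\<lambda>S T U. lift (times_ob (plus_ob S T) U) (times_pres (plus_ob S T) (plus_iso S T) U (\<iota> (val U)))
      (plus_ob (times_ob S U) (times_ob T U)) (plus_pres (times_ob S U) (times_iso S U) (times_ob T U) (times_iso T U))
      (\<delta>\<^sup>r (val S) (val T) (val U))),
    mul_braid = (\<lambda>S T. lift (times_ob S T) (times_iso S T) (times_ob T S) (times_iso T S) (\<zeta>\<^sup>\<otimes> (val S) (val T)))
  \<rparr>"

lemma transported_simps [simp]:
  "Obj transported = K" "add_obj transported = plus_ob" "zero_obj transported = zero_ob"
  "mul_obj transported = times_ob" "one_obj transported = unit_ob"
  by (simp_all add: transported_def)

lemma transported_hom:
  "x \<in> hom transported S T \<longleftrightarrow> (\<exists>f. S \<in> K \<and> T \<in> K \<and> x = (S, f, T) \<and> f \<in> hom B (val S) (val T))"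
  by (cases x) (auto simp: transported_def hom_def val_arr_def)

sublocale trans: category transported
proof
  show "Dom transported x \<in> Obj transported" if "x \<in> Arr transported" for x
    using that by (simp add: transported_def)
  show "Cod transported x \<in> Obj transported" if "x \<in> Arr transported" for x
    using that by (simp add: transported_def)
qed (auto simp: transported_hom add.hom_arr, auto simp: transported_def val_arr_def)

text \<open>The square with sides \<open>x\<close>, \<open>y\<close> and the two presentations commutes. This relation is compatible with
  all operations, so every expression in the structure of \<open>transported\<close> is represented by the same
  expression in the structure of \<open>B\<close>, and equations can be read off from \<open>B\<close> by \<open>rep_eqI\<close>.\<close>

definition rep :: "'k \<Rightarrow> 'o \<Rightarrow> 'm \<Rightarrow> 'k \<Rightarrow> 'o \<Rightarrow> 'm \<Rightarrow> 'k \<times> 'm \<times> 'k \<Rightarrow> 'm \<Rightarrow> bool" where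
  "rep S X u T Y v x y \<longleftrightarrow>
    pres S X u \<and> pres T Y v \<and> y \<in> hom B X Y \<and> x = lift S u T v y"

lemma rep_eqI:
  "\<lbrakk>rep S X u T Y v x y; rep S X u T Y v x' y'; y = y'\<rbrakk> \<Longrightarrow> x = x'"
  by (simp add: rep_def)

lemma rep_lift:
  "\<lbrakk>pres S X u; pres T Y v; y \<in> hom B X Y\<rbrakk> \<Longrightarrow> rep S X u T Y v (lift S u T v y) y"
  by (simp add: rep_def)

lemma rep_hom: "rep S X u T Y v x y \<Longrightarrow> x \<in> hom transported S T"
  by (auto simp: rep_def transported_hom lift_def pres_def add.hom_arr)

lemma rep_square: "rep S X u T Y v x y \<Longrightarrow> val_arr x \<cdot> u = v \<cdot> y"
  by (auto simp: rep_def val_arr_def lift_def pres_def add.hom_arr)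

lemma rep_id: "pres S X u \<Longrightarrow> rep S X u S X u (\<iota>\<^bsub>transported\<^esub> S) (\<iota> X)"
  by (auto simp: rep_def lift_def transported_def pres_def add.hom_arr)

lemma rep_comp:
  "\<lbrakk>rep T Y v U Z w x' y'; rep S X u T Y v x y\<rbrakk>
    \<Longrightarrow> rep S X u U Z w (x' \<cdot>\<^bsub>transported\<^esub> x) (y' \<cdot> y)"
  by (auto simp: rep_def lift_def transported_def pres_def add.hom_arr val_arr_def)

lemma rep_add_arr:
  assumes "rep S X u T Y v x y" "rep S' X' u' T' Y' v' x' y'"
  shows "rep (plus_ob S S') (X \<oplus> X') (plus_pres S u S' u') (plus_ob T T') (Y \<oplus> Y') (plus_pres T v T' v')
    (x \<boxplus>\<^bsub>transported\<^esub> x') (y \<boxplus> y')"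
  using assms
  by (auto simp: rep_def lift_def transported_def pres_def add.hom_arr val_arr_def plus_pres_def
      add.inv_comp add.inv_tensor)

lemma rep_mul_arr:
  assumes "rep S X u T Y v x y" "rep S' X' u' T' Y' v' x' y'"
  shows "rep (times_ob S S') (X \<otimes> X') (times_pres S u S' u') (times_ob T T') (Y \<otimes> Y') (times_pres T v T' v')
    (x \<boxtimes>\<^bsub>transported\<^esub> x') (y \<boxtimes> y')"
  using assms
  by (auto simp: rep_def lift_def transported_def pres_def add.hom_arr val_arr_def times_pres_def
      add.inv_comp mul.inv_tensor)

lemma rep_inv:
  assumes r: "rep S X u T Y v x y" and y: "is_iso B y"
  shows "rep T Y v S X u (inv_arr transported x) (inv_arr B y)"
    and "is_iso transported x"
proof -
  have p: "pres S X u" "pres T Y v" "y \<in> Arr B" "Dom B y = X" "Cod B y = Y"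
    using r by (simp_all add: rep_def add.hom_arr)
  let ?z = "lift T v S u (inv_arr B y)"
  have z: "rep T Y v S X u ?z (inv_arr B y)"
    by (rule rep_lift) (use p y in \<open>simp_all add: add.hom_arr\<close>)
  have "?z \<cdot>\<^bsub>transported\<^esub> x = \<iota>\<^bsub>transported\<^esub> S"
    by (rule rep_eqI[OF rep_comp[OF z r] rep_id[OF p(1)]]) (use p y in simp)
  moreover have "x \<cdot>\<^bsub>transported\<^esub> ?z = \<iota>\<^bsub>transported\<^esub> T"
    by (rule rep_eqI[OF rep_comp[OF r z] rep_id[OF p(2)]]) (use p y in simp)
  ultimately have i: "inverse_arrows transported x ?z"
    unfolding inverse_arrows_def using rep_hom[OF r] rep_hom[OF z] by blast
  show "rep T Y v S X u (inv_arr transported x) (inv_arr B y)"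
    using z by (simp add: trans.inv_arr_eq[OF i])
  show "is_iso transported x" by (rule trans.inverse_arrows_iso[OF i])
qed

lemma pres_val: "S \<in> K \<Longrightarrow> pres S (val S) (\<iota> (val S))"
  by (simp add: pres_def)

lemma pres_plus: "\<lbrakk>pres S X u; pres T Y v\<rbrakk> \<Longrightarrow> pres (plus_ob S T) (X \<oplus> Y) (plus_pres S u T v)"
  by (auto simp: pres_def plus_pres_def)

lemma pres_times: "\<lbrakk>pres S X u; pres T Y v\<rbrakk> \<Longrightarrow> pres (times_ob S T) (X \<otimes> Y) (times_pres S u T v)"
  by (auto simp: pres_def times_pres_def)

lemma pres_zero: "pres zero_ob \<zero> zero_iso" by (simp add: pres_def)

lemma pres_unit: "pres unit_ob \<one> unit_iso" by (simp add: pres_def)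

text \<open>A representative remains valid when the presentations are changed by isomorphisms \<open>m\<close> and \<open>n\<close> that
  form a commutative square with it. For a structure arrow that square is naturality, so it is
  enough to know a representative at one presentation of each argument, and that one is built into
  \<open>transported\<close>.\<close>

lemma rep_reindex:
  assumes "u' = u \<cdot> m" "v' = v \<cdot> n" "pres S X u" "pres T Y v" "y \<in> hom B X Y"
    "m \<in> iso_hom B X' X" "n \<in> iso_hom B Y' Y" "y' \<in> hom B X' Y'" "y \<cdot> m = n \<cdot> y'"
  shows "rep S X' u' T Y' v' (lift S u T v y) y'"
proof -
  have [simp]: "S \<in> K" "T \<in> K" "u \<in> Arr B" "v \<in> Arr B" "is_iso B u" "is_iso B v" "Dom B u = X" "Dom B v = Y"
    "Cod B u = val S" "Cod B v = val T" "m \<in> Arr B" "n \<in> Arr B" "is_iso B m" "is_iso B n"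
    "Dom B m = X'" "Cod B m = X" "Dom B n = Y'" "Cod B n = Y" "y \<in> Arr B" "Dom B y = X" "Cod B y = Y"
    "y' \<in> Arr B" "Dom B y' = X'" "Cod B y' = Y'"
    using assms by (simp_all add: pres_def add.hom_arr add.iso_hom_arr)
  have "X' \<in> Obj B" "Y' \<in> Obj B"
    using add.dom_obj[of m] add.dom_obj[of n] by simp_all
  moreover have "v \<cdot> y \<cdot> inv_arr B u = (v \<cdot> n) \<cdot> y' \<cdot> inv_arr B (u \<cdot> m)"
    using add.segment2[OF assms(9)[symmetric], of "inv_arr B m \<cdot> inv_arr B u"]
    by (simp add: add.inv_comp)
  ultimately show ?thesis
    using assms(1,2) by (simp add: rep_def pres_def lift_def add.hom_arr)
qed

lemma pres_arr:
  assumes "pres S X u"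
  shows "S \<in> K" "X \<in> Obj B" "u \<in> Arr B" "Dom B u = X" "Cod B u = val S" "is_iso B u"
  using assms by (simp_all add: pres_def)

lemmas reindex_simps = plus_pres_def times_pres_def pres_def add.hom_arr add.iso_hom_arr

lemma rep_add_assoc:
  assumes "pres S X u" "pres T Y v" "pres U Z w"
  shows "rep (plus_ob (plus_ob S T) U) (X \<oplus> Y \<oplus> Z) (plus_pres (plus_ob S T) (plus_pres S u T v) U w)
    (plus_ob S (plus_ob T U)) (X \<oplus> (Y \<oplus> Z)) (plus_pres S u (plus_ob T U) (plus_pres T v U w))
    (add_assoc transported S T U) (\<alpha>\<^sup>\<oplus> X Y Z)"
proof -
  note [simp] = pres_arr[OF assms(1)] pres_arr[OF assms(2)] pres_arr[OF assms(3)]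
  show ?thesis
    unfolding transported_def cat.simps bimon.simps braided_bimon.simps
    by (rule rep_reindex[where m = "(u \<boxplus> v) \<boxplus> w" and n = "u \<boxplus> (v \<boxplus> w)" and X = "val S \<oplus> val T \<oplus> val U" and Y = "val S \<oplus> (val T \<oplus> val U)"])
      (use add.assoc_natural_arr[of u v w] in \<open>simp_all add: reindex_simps\<close>)
qed

lemma rep_add_lunit:
  assumes "pres S X u"
  shows "rep (plus_ob zero_ob S) (\<zero> \<oplus> X) (plus_pres zero_ob zero_iso S u)
    S X u
    (add_lunit transported S) (\<lambda>\<^sup>\<oplus> X)"
proof -
  note [simp] = pres_arr[OF assms]
  show ?thesis
    unfolding transported_def cat.simps bimon.simps braided_bimon.simps
    by (rule rep_reindex[where m = "\<iota> \<zero> \<boxplus> u" and n = "u" and X = "\<zero> \<oplus> val S" and Y = "val S"])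
      (use add.lunit_natural_arr[of u] in \<open>simp_all add: reindex_simps\<close>)
qed

lemma rep_add_runit:
  assumes "pres S X u"
  shows "rep (plus_ob S zero_ob) (X \<oplus> \<zero>) (plus_pres S u zero_ob zero_iso)
    S X u
    (add_runit transported S) (\<rho>\<^sup>\<oplus> X)"
proof -
  note [simp] = pres_arr[OF assms]
  show ?thesis
    unfolding transported_def cat.simps bimon.simps braided_bimon.simps
    by (rule rep_reindex[where m = "u \<boxplus> \<iota> \<zero>" and n = "u" and X = "val S \<oplus> \<zero>" and Y = "val S"])
      (use add.runit_natural_arr[of u] in \<open>simp_all add: reindex_simps\<close>)
qed

lemma rep_add_braid:
  assumes "pres S X u" "pres T Y v"
  shows "rep (plus_ob S T) (X \<oplus> Y) (plus_pres S u T v)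
    (plus_ob T S) (Y \<oplus> X) (plus_pres T v S u)
    (add_braid transported S T) (\<zeta>\<^sup>\<oplus> X Y)"
proof -
  note [simp] = pres_arr[OF assms(1)] pres_arr[OF assms(2)]
  show ?thesis
    unfolding transported_def cat.simps bimon.simps braided_bimon.simps
    by (rule rep_reindex[where m = "u \<boxplus> v" and n = "v \<boxplus> u" and X = "val S \<oplus> val T" and Y = "val T \<oplus> val S"])
      (use add.braid_natural_arr[of u v] in \<open>simp_all add: reindex_simps\<close>)
qed

lemma rep_mul_assoc:
  assumes "pres S X u" "pres T Y v" "pres U Z w"
  shows "rep (times_ob (times_ob S T) U) (X \<otimes> Y \<otimes> Z) (times_pres (times_ob S T) (times_pres S u T v) U w)
    (times_ob S (times_ob T U)) (X \<otimes> (Y \<otimes> Z)) (times_pres S u (times_ob T U) (times_pres T v U w))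
    (mul_assoc transported S T U) (\<alpha>\<^sup>\<otimes> X Y Z)"
proof -
  note [simp] = pres_arr[OF assms(1)] pres_arr[OF assms(2)] pres_arr[OF assms(3)]
  show ?thesis
    unfolding transported_def cat.simps bimon.simps braided_bimon.simps
    by (rule rep_reindex[where m = "(u \<boxtimes> v) \<boxtimes> w" and n = "u \<boxtimes> (v \<boxtimes> w)" and X = "val S \<otimes> val T \<otimes> val U" and Y = "val S \<otimes> (val T \<otimes> val U)"])
      (use mul.assoc_natural_arr[of u v w] in \<open>simp_all add: reindex_simps\<close>)
qed

lemma rep_mul_lunit:
  assumes "pres S X u"
  shows "rep (times_ob unit_ob S) (\<one> \<otimes> X) (times_pres unit_ob unit_iso S u)
    S X u
    (mul_lunit transported S) (\<lambda>\<^sup>\<otimes> X)"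
proof -
  note [simp] = pres_arr[OF assms]
  show ?thesis
    unfolding transported_def cat.simps bimon.simps braided_bimon.simps
    by (rule rep_reindex[where m = "\<iota> \<one> \<boxtimes> u" and n = "u" and X = "\<one> \<otimes> val S" and Y = "val S"])
      (use mul.lunit_natural_arr[of u] in \<open>simp_all add: reindex_simps\<close>)
qed

lemma rep_mul_runit:
  assumes "pres S X u"
  shows "rep (times_ob S unit_ob) (X \<otimes> \<one>) (times_pres S u unit_ob unit_iso)
    S X u
    (mul_runit transported S) (\<rho>\<^sup>\<otimes> X)"
proof -
  note [simp] = pres_arr[OF assms]
  show ?thesis
    unfolding transported_def cat.simps bimon.simps braided_bimon.simps
    by (rule rep_reindex[where m = "u \<boxtimes> \<iota> \<one>" and n = "u" and X = "val S \<otimes> \<one>" and Y = "val S"])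
      (use mul.runit_natural_arr[of u] in \<open>simp_all add: reindex_simps\<close>)
qed

lemma rep_mul_braid:
  assumes "pres S X u" "pres T Y v"
  shows "rep (times_ob S T) (X \<otimes> Y) (times_pres S u T v)
    (times_ob T S) (Y \<otimes> X) (times_pres T v S u)
    (mul_braid transported S T) (\<zeta>\<^sup>\<otimes> X Y)"
proof -
  note [simp] = pres_arr[OF assms(1)] pres_arr[OF assms(2)]
  show ?thesis
    unfolding transported_def cat.simps bimon.simps braided_bimon.simps
    by (rule rep_reindex[where m = "u \<boxtimes> v" and n = "v \<boxtimes> u" and X = "val S \<otimes> val T" and Y = "val T \<otimes> val S"])
      (use mul.braid_natural_arr[of u v] in \<open>simp_all add: reindex_simps\<close>)
qed

lemma rep_lnull:
  assumes "pres S X u"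
  shows "rep (times_ob zero_ob S) (\<zero> \<otimes> X) (times_pres zero_ob zero_iso S u)
    zero_ob \<zero> zero_iso
    (lnull transported S) (\<lambda>\<^sup>\<bullet> X)"
proof -
  note [simp] = pres_arr[OF assms]
  show ?thesis
    unfolding transported_def cat.simps bimon.simps braided_bimon.simps
    by (rule rep_reindex[where m = "\<iota> \<zero> \<boxtimes> u" and n = "\<iota> \<zero>" and X = "\<zero> \<otimes> val S" and Y = "\<zero>"])
      (use lnull_natural_arr[of u] in \<open>simp_all add: reindex_simps\<close>)
qed

lemma rep_rnull:
  assumes "pres S X u"
  shows "rep (times_ob S zero_ob) (X \<otimes> \<zero>) (times_pres S u zero_ob zero_iso)
    zero_ob \<zero> zero_iso
    (rnull transported S) (\<rho>\<^sup>\<bullet> X)"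
proof -
  note [simp] = pres_arr[OF assms]
  show ?thesis
    unfolding transported_def cat.simps bimon.simps braided_bimon.simps
    by (rule rep_reindex[where m = "u \<boxtimes> \<iota> \<zero>" and n = "\<iota> \<zero>" and X = "val S \<otimes> \<zero>" and Y = "\<zero>"])
      (use rnull_natural_arr[of u] in \<open>simp_all add: reindex_simps\<close>)
qed

lemma rep_ldist:
  assumes "pres S X u" "pres T Y v" "pres U Z w"
  shows "rep (times_ob S (plus_ob T U)) (X \<otimes> (Y \<oplus> Z)) (times_pres S u (plus_ob T U) (plus_pres T v U w))
    (plus_ob (times_ob S T) (times_ob S U)) (X \<otimes> Y \<oplus> X \<otimes> Z) (plus_pres (times_ob S T) (times_pres S u T v) (times_ob S U) (times_pres S u U w))
    (ldist transported S T U) (\<delta>\<^sup>l X Y Z)"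
proof -
  note [simp] = pres_arr[OF assms(1)] pres_arr[OF assms(2)] pres_arr[OF assms(3)]
  show ?thesis
    unfolding transported_def cat.simps bimon.simps braided_bimon.simps
    by (rule rep_reindex[where m = "u \<boxtimes> (v \<boxplus> w)" and n = "u \<boxtimes> v \<boxplus> u \<boxtimes> w" and X = "val S \<otimes> (val T \<oplus> val U)" and Y = "val S \<otimes> val T \<oplus> val S \<otimes> val U"])
      (use ldist_natural_arr[of u v w] in \<open>simp_all add: reindex_simps\<close>)
qed

lemma rep_rdist:
  assumes "pres S X u" "pres T Y v" "pres U Z w"
  shows "rep (times_ob (plus_ob S T) U) ((X \<oplus> Y) \<otimes> Z) (times_pres (plus_ob S T) (plus_pres S u T v) U w)
    (plus_ob (times_ob S U) (times_ob T U)) (X \<otimes> Z \<oplus> Y \<otimes> Z) (plus_pres (times_ob S U) (times_pres S u U w) (times_ob T U) (times_pres T v U w))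
    (rdist transported S T U) (\<delta>\<^sup>r X Y Z)"
proof -
  note [simp] = pres_arr[OF assms(1)] pres_arr[OF assms(2)] pres_arr[OF assms(3)]
  show ?thesis
    unfolding transported_def cat.simps bimon.simps braided_bimon.simps
    by (rule rep_reindex[where m = "(u \<boxplus> v) \<boxtimes> w" and n = "u \<boxtimes> w \<boxplus> v \<boxtimes> w" and X = "(val S \<oplus> val T) \<otimes> val U" and Y = "val S \<otimes> val U \<oplus> val T \<otimes> val U"])
      (use rdist_natural_arr[of u v w] in \<open>simp_all add: reindex_simps\<close>)
qed

end

section \<open>The axioms of the transported structure\<close>

context realization
begin

lemma val_arr_hom: "x \<in> hom transported S T \<Longrightarrow> val_arr x \<in> hom B (val S) (val T)"
  by (auto simp: transported_hom val_arr_def)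

lemma hom_ends: "x \<in> hom transported S T \<Longrightarrow> S \<in> K" "x \<in> hom transported S T \<Longrightarrow> T \<in> K"
  by (auto simp: transported_hom)

lemma rep_arr:
  "x \<in> hom transported S T \<Longrightarrow> rep S (val S) (\<iota> (val S)) T (val T) (\<iota> (val T)) x (val_arr x)"
  by (auto simp: transported_hom rep_def pres_val val_arr_def lift_def add.hom_arr)

lemma rep_is_iso: "\<lbrakk>rep S X u T Y v x y; is_iso B y\<rbrakk> \<Longrightarrow> is_iso transported x"
  by (rule rep_inv(2))

lemma rep_iso_hom: "\<lbrakk>rep S X u T Y v x y; is_iso B y\<rbrakk> \<Longrightarrow> x \<in> iso_hom transported S T"
  by (simp add: iso_hom_def rep_hom rep_is_iso)

lemma rep_mono_hom: "\<lbrakk>rep S X u T Y v x y; is_iso B y\<rbrakk> \<Longrightarrow> x \<in> mono_hom transported S T"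
  by (simp add: mono_hom_def rep_hom rep_is_iso trans.iso_mono)

lemma rep_inv_add_assoc:
  assumes "pres S X u" "pres T Y v" "pres U Z w"
  shows "rep (plus_ob S (plus_ob T U)) (X \<oplus> (Y \<oplus> Z)) (plus_pres S u (plus_ob T U) (plus_pres T v U w))
    (plus_ob (plus_ob S T) U) (X \<oplus> Y \<oplus> Z) (plus_pres (plus_ob S T) (plus_pres S u T v) U w)
    (inv_arr transported (add_assoc transported S T U)) (inv_arr B (\<alpha>\<^sup>\<oplus> X Y Z))"
  by (rule rep_inv(1)[OF rep_add_assoc[OF assms]]) (use assms in \<open>simp add: pres_def\<close>)

lemma rep_inv_mul_assoc:
  assumes "pres S X u" "pres T Y v" "pres U Z w"
  shows "rep (times_ob S (times_ob T U)) (X \<otimes> (Y \<otimes> Z)) (times_pres S u (times_ob T U) (times_pres T v U w))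
    (times_ob (times_ob S T) U) (X \<otimes> Y \<otimes> Z) (times_pres (times_ob S T) (times_pres S u T v) U w)
    (inv_arr transported (mul_assoc transported S T U)) (inv_arr B (\<alpha>\<^sup>\<otimes> X Y Z))"
  by (rule rep_inv(1)[OF rep_mul_assoc[OF assms]]) (use assms in \<open>simp add: pres_def\<close>)

text \<open>Resolution with these rules computes a representative by recursion on an expression, together with
  the presentations of its source and target.\<close>

lemmas rep_structure =
  rep_comp rep_add_arr rep_mul_arr rep_inv_add_assoc rep_inv_mul_assoc
  rep_add_assoc rep_add_lunit rep_add_runit rep_add_braid
  rep_mul_assoc rep_mul_lunit rep_mul_runit rep_mul_braid
  rep_lnull rep_rnull rep_ldist rep_rdist rep_id
  pres_zero pres_unit pres_plus pres_times

lemma rep_exchange: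
  assumes "pres S X u" "pres T Y v" "pres U Z w" "pres V W t"
  shows "rep (plus_ob (plus_ob S T) (plus_ob U V)) (X \<oplus> Y \<oplus> (Z \<oplus> W))
      (plus_pres (plus_ob S T) (plus_pres S u T v) (plus_ob U V) (plus_pres U w V t))
    (plus_ob (plus_ob S U) (plus_ob T V)) (X \<oplus> Z \<oplus> (Y \<oplus> W))
      (plus_pres (plus_ob S U) (plus_pres S u U w) (plus_ob T V) (plus_pres T v V t))
    (exchange transported S T U V) (exchange B X Y Z W)"
  unfolding exchange_def transported_simps by (rule rep_structure assms)+

lemmas rep_rules = rep_structure rep_exchange rep_arr pres_val

text \<open>Every equation is proved in the same way: both sides are represented by the two sides of the
  corresponding axiom of \<open>B\<close>, at the values of the variables, with respect to the same presentations.\<close>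

lemma transported_add:
  "symmetric_monoidal_category transported (add_obj transported) (add_arr transported) (zero_obj transported)
    (add_assoc transported) (add_lunit transported) (add_runit transported) (add_braid transported)"
  apply unfold_locales
  apply (simp_all only: transported_simps)
  subgoal by simp
  subgoal by (rule rep_hom, (rule rep_rules | assumption | erule hom_ends)+)
  subgoal by (rule rep_eqI, (rule rep_rules | assumption | erule hom_ends)+, rule add.tensor_id;
    (erule val_arr_hom | simp))
  subgoal by (rule rep_eqI, (rule rep_rules | assumption | erule hom_ends)+, rule add.tensor_comp;
    (erule val_arr_hom | simp))
  subgoal by simp
  subgoal by (rule rep_iso_hom, (rule rep_rules | assumption | erule hom_ends)+, simp)
  subgoal by (rule rep_eqI, (rule rep_rules | assumption | erule hom_ends)+, rule add.assoc_natural;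
    (erule val_arr_hom | simp))
  subgoal by (rule rep_iso_hom, (rule rep_rules | assumption | erule hom_ends)+, simp)
  subgoal by (rule rep_eqI, (rule rep_rules | assumption | erule hom_ends)+, rule add.lunit_natural;
    (erule val_arr_hom | simp))
  subgoal by (rule rep_iso_hom, (rule rep_rules | assumption | erule hom_ends)+, simp)
  subgoal by (rule rep_eqI, (rule rep_rules | assumption | erule hom_ends)+, rule add.runit_natural;
    (erule val_arr_hom | simp))
  subgoal by (rule rep_eqI, (rule rep_rules | assumption | erule hom_ends)+, rule add.pentagon;
    (erule val_arr_hom | simp))
  subgoal by (rule rep_eqI, (rule rep_rules | assumption | erule hom_ends)+, rule add.triangle;
    (erule val_arr_hom | simp))
  subgoal by (rule rep_iso_hom, (rule rep_rules | assumption | erule hom_ends)+, simp)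
  subgoal by (rule rep_eqI, (rule rep_rules | assumption | erule hom_ends)+, rule add.braid_natural;
    (erule val_arr_hom | simp))
  subgoal by (rule rep_eqI, (rule rep_rules | assumption | erule hom_ends)+, rule add.hexagon1;
    (erule val_arr_hom | simp))
  subgoal by (rule rep_eqI, (rule rep_rules | assumption | erule hom_ends)+, rule add.hexagon2;
    (erule val_arr_hom | simp))
  subgoal by (rule rep_eqI, (rule rep_rules | assumption | erule hom_ends)+, rule add.symmetry;
    (erule val_arr_hom | simp))
  done

lemma transported_mul:
  "braided_monoidal_category transported (mul_obj transported) (mul_arr transported) (one_obj transported)
    (mul_assoc transported) (mul_lunit transported) (mul_runit transported) (mul_braid transported)"
  apply unfold_locales
  apply (simp_all only: transported_simps)
  subgoal by simp
  subgoal by (rule rep_hom, (rule rep_rules | assumption | erule hom_ends)+)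
  subgoal by (rule rep_eqI, (rule rep_rules | assumption | erule hom_ends)+, rule mul.tensor_id;
    (erule val_arr_hom | simp))
  subgoal by (rule rep_eqI, (rule rep_rules | assumption | erule hom_ends)+, rule mul.tensor_comp;
    (erule val_arr_hom | simp))
  subgoal by simp
  subgoal by (rule rep_iso_hom, (rule rep_rules | assumption | erule hom_ends)+, simp)
  subgoal by (rule rep_eqI, (rule rep_rules | assumption | erule hom_ends)+, rule mul.assoc_natural;
    (erule val_arr_hom | simp))
  subgoal by (rule rep_iso_hom, (rule rep_rules | assumption | erule hom_ends)+, simp)
  subgoal by (rule rep_eqI, (rule rep_rules | assumption | erule hom_ends)+, rule mul.lunit_natural;
    (erule val_arr_hom | simp))
  subgoal by (rule rep_iso_hom, (rule rep_rules | assumption | erule hom_ends)+, simp)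
  subgoal by (rule rep_eqI, (rule rep_rules | assumption | erule hom_ends)+, rule mul.runit_natural;
    (erule val_arr_hom | simp))
  subgoal by (rule rep_eqI, (rule rep_rules | assumption | erule hom_ends)+, rule mul.pentagon;
    (erule val_arr_hom | simp))
  subgoal by (rule rep_eqI, (rule rep_rules | assumption | erule hom_ends)+, rule mul.triangle;
    (erule val_arr_hom | simp))
  subgoal by (rule rep_iso_hom, (rule rep_rules | assumption | erule hom_ends)+, simp)
  subgoal by (rule rep_eqI, (rule rep_rules | assumption | erule hom_ends)+, rule mul.braid_natural;
    (erule val_arr_hom | simp))
  subgoal by (rule rep_eqI, (rule rep_rules | assumption | erule hom_ends)+, rule mul.hexagon1;
    (erule val_arr_hom | simp))
  subgoal by (rule rep_eqI, (rule rep_rules | assumption | erule hom_ends)+, rule mul.hexagon2;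
    (erule val_arr_hom | simp))
  done

lemma transported_bimonoidal: "tight_braided_bimonoidal_category transported"
proof -
  interpret add': symmetric_monoidal_category transported "add_obj transported" "add_arr transported" "zero_obj transported" "add_assoc transported" "add_lunit transported" "add_runit transported" "add_braid transported"
    by (rule transported_add)
  interpret mul': braided_monoidal_category transported "mul_obj transported" "mul_arr transported" "one_obj transported" "mul_assoc transported" "mul_lunit transported" "mul_runit transported" "mul_braid transported"
    by (rule transported_mul)
  show ?thesis
  apply unfold_locales
  apply (simp_all only: transported_simps)
  subgoal by (rule rep_iso_hom, (rule rep_rules | assumption | erule hom_ends)+, simp)
  subgoal by (rule rep_eqI, (rule rep_rules | assumption | erule hom_ends)+, rule lnull_natural;
    (erule val_arr_hom | simp))
  subgoal by (rule rep_iso_hom, (rule rep_rules | assumption | erule hom_ends)+, simp)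
  subgoal by (rule rep_eqI, (rule rep_rules | assumption | erule hom_ends)+, rule rnull_natural;
    (erule val_arr_hom | simp))
  subgoal by (rule rep_mono_hom, (rule rep_rules | assumption | erule hom_ends)+, simp)
  subgoal by (rule rep_eqI, (rule rep_rules | assumption | erule hom_ends)+, rule ldist_natural;
    (erule val_arr_hom | simp))
  subgoal by (rule rep_mono_hom, (rule rep_rules | assumption | erule hom_ends)+, simp)
  subgoal by (rule rep_eqI, (rule rep_rules | assumption | erule hom_ends)+, rule rdist_natural;
    (erule val_arr_hom | simp))
  subgoal by (rule rep_eqI, (rule rep_rules | assumption | erule hom_ends)+, rule ldist_braid;
    (erule val_arr_hom | simp))
  subgoal by (rule rep_eqI, (rule rep_rules | assumption | erule hom_ends)+, rule rdist_braid;
    (erule val_arr_hom | simp))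
  subgoal by (rule rep_eqI, (rule rep_rules | assumption | erule hom_ends)+, rule rdist_add_assoc;
    (erule val_arr_hom | simp))
  subgoal by (rule rep_eqI, (rule rep_rules | assumption | erule hom_ends)+, rule ldist_add_assoc;
    (erule val_arr_hom | simp))
  subgoal by (rule rep_eqI, (rule rep_rules | assumption | erule hom_ends)+, rule ldist_mul_assoc;
    (erule val_arr_hom | simp))
  subgoal by (rule rep_eqI, (rule rep_rules | assumption | erule hom_ends)+, rule rdist_mul_assoc;
    (erule val_arr_hom | simp))
  subgoal by (rule rep_eqI, (rule rep_rules | assumption | erule hom_ends)+, rule lrdist_mul_assoc;
    (erule val_arr_hom | simp))
  subgoal by (rule rep_eqI, (rule rep_rules | assumption | erule hom_ends)+, rule ldist_rdist;
    (erule val_arr_hom | simp))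
  subgoal by (rule rep_eqI, (rule rep_rules | assumption | erule hom_ends)+, rule lnull_zero;
    (erule val_arr_hom | simp))
  subgoal by (rule rep_eqI, (rule rep_rules | assumption | erule hom_ends)+, rule lnull_add;
    (erule val_arr_hom | simp))
  subgoal by (rule rep_eqI, (rule rep_rules | assumption | erule hom_ends)+, rule rnull_add;
    (erule val_arr_hom | simp))
  subgoal by (rule rep_eqI, (rule rep_rules | assumption | erule hom_ends)+, rule mul_runit_zero;
    (erule val_arr_hom | simp))
  subgoal by (rule rep_eqI, (rule rep_rules | assumption | erule hom_ends)+, rule mul_lunit_zero;
    (erule val_arr_hom | simp))
  subgoal by (rule rep_eqI, (rule rep_rules | assumption | erule hom_ends)+, rule lnull_mul;
    (erule val_arr_hom | simp))
  subgoal by (rule rep_eqI, (rule rep_rules | assumption | erule hom_ends)+, rule lrnull_mul;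
    (erule val_arr_hom | simp))
  subgoal by (rule rep_eqI, (rule rep_rules | assumption | erule hom_ends)+, rule rnull_mul;
    (erule val_arr_hom | simp))
  subgoal by (rule rep_eqI, (rule rep_rules | assumption | erule hom_ends)+, rule ldist_lzero;
    (erule val_arr_hom | simp))
  subgoal by (rule rep_eqI, (rule rep_rules | assumption | erule hom_ends)+, rule rdist_lzero;
    (erule val_arr_hom | simp))
  subgoal by (rule rep_eqI, (rule rep_rules | assumption | erule hom_ends)+, rule ldist_rzero;
    (erule val_arr_hom | simp))
  subgoal by (rule rep_eqI, (rule rep_rules | assumption | erule hom_ends)+, rule rdist_rzero;
    (erule val_arr_hom | simp))
  subgoal by (rule rep_eqI, (rule rep_rules | assumption | erule hom_ends)+, rule ldist_one;
    (erule val_arr_hom | simp))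
  subgoal by (rule rep_eqI, (rule rep_rules | assumption | erule hom_ends)+, rule rdist_one;
    (erule val_arr_hom | simp))
  subgoal by (rule rep_eqI, (rule rep_rules | assumption | erule hom_ends)+, rule ldist_mul_braid;
    (erule val_arr_hom | simp))
  subgoal by (rule rep_eqI, (rule rep_rules | assumption | erule hom_ends)+, rule rdist_mul_braid;
    (erule val_arr_hom | simp))
  subgoal by (rule rep_eqI, (rule rep_rules | assumption | erule hom_ends)+, rule lnull_mul_braid;
    (erule val_arr_hom | simp))
  subgoal by (rule rep_eqI, (rule rep_rules | assumption | erule hom_ends)+, rule rnull_mul_braid;
    (erule val_arr_hom | simp))
  subgoal by (rule rep_is_iso, (rule rep_rules | assumption | erule hom_ends)+, simp)
  subgoal by (rule rep_is_iso, (rule rep_rules | assumption | erule hom_ends)+, simp)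
  done
qed

end

section \<open>Realization as a strong functor\<close>

context realization
begin

lemma val_arr_arr [simp]:
  assumes "x \<in> hom transported S T"
  shows "val_arr x \<in> Arr B" "Dom B (val_arr x) = val S" "Cod B (val_arr x) = val T"
  using val_arr_hom[OF assms] by (simp_all add: add.hom_arr)

definition val_functor :: "('k, 'k \<times> 'm \<times> 'k, 'o, 'm) bimon_funct" where
  "val_functor = \<lparr>fobj = val, farr = val_arr, add2 = plus_iso, add0 = zero_iso,
     mul2 = times_iso, mul0 = unit_iso\<rparr>"

lemma val_functor_simps [simp]:
  "fobj val_functor = val" "farr val_functor = val_arr" "add2 val_functor = plus_iso"
  "add0 val_functor = zero_iso" "mul2 val_functor = times_iso" "mul0 val_functor = unit_iso"
  by (simp_all add: val_functor_def)

lemma val_functor_functor: "cat_functor transported B val_functor"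
proof
  show "farr val_functor (\<iota>\<^bsub>transported\<^esub> a) = \<iota> (fobj val_functor a)" for a
    by (simp add: transported_def val_arr_def)
  show "farr val_functor (g \<cdot>\<^bsub>transported\<^esub> f) = farr val_functor g \<cdot> farr val_functor f" for f g
    by (simp add: transported_def val_arr_def)
qed (simp_all add: val_arr_hom)

lemma val_functor_strong: "strong_braided_bimonoidal_functor transported B val_functor"
proof -
  interpret P: tight_braided_bimonoidal_category transported by (rule transported_bimonoidal)
  interpret cat_functor transported B val_functor by (rule val_functor_functor)
  show ?thesis
    apply unfold_locales
    apply (simp_all only: transported_simps val_functor_simps)
    subgoal by (simp add: add.hom_arr)
    subgoal for f a a' g b b' using rep_square[OF rep_add_arr[OF rep_arr[of f a a'] rep_arr[of g b b']]]
      by (simp add: plus_pres_def hom_ends)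
    subgoal by (simp add: add.hom_arr)
    subgoal for a b c using rep_square[OF rep_add_assoc[OF pres_val[of a] pres_val[of b] pres_val[of c]]]
      by (simp add: plus_pres_def)
    subgoal for a using rep_square[OF rep_add_lunit[OF pres_val[of a]]] by (simp add: plus_pres_def)
    subgoal for a using rep_square[OF rep_add_runit[OF pres_val[of a]]] by (simp add: plus_pres_def)
    subgoal for a b using rep_square[OF rep_add_braid[OF pres_val[of a] pres_val[of b]]]
      by (simp add: plus_pres_def)
    subgoal by (simp add: add.hom_arr)
    subgoal for f a a' g b b' using rep_square[OF rep_mul_arr[OF rep_arr[of f a a'] rep_arr[of g b b']]]
      by (simp add: times_pres_def hom_ends)
    subgoal by (simp add: add.hom_arr)
    subgoal for a b c using rep_square[OF rep_mul_assoc[OF pres_val[of a] pres_val[of b] pres_val[of c]]]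
      by (simp add: times_pres_def)
    subgoal for a using rep_square[OF rep_mul_lunit[OF pres_val[of a]]] by (simp add: times_pres_def)
    subgoal for a using rep_square[OF rep_mul_runit[OF pres_val[of a]]] by (simp add: times_pres_def)
    subgoal for a b using rep_square[OF rep_mul_braid[OF pres_val[of a] pres_val[of b]]]
      by (simp add: times_pres_def)
    subgoal for a using rep_square[OF rep_lnull[OF pres_val[of a]]] by (simp add: times_pres_def)
    subgoal for a b c using rep_square[OF rep_ldist[OF pres_val[of a] pres_val[of b] pres_val[of c]]]
      by (simp add: plus_pres_def times_pres_def)
    subgoal by simp
    subgoal by simp
    subgoal by simp
    subgoal by simp
    done
qed

text \<open>Used for the first triangle identity, whose sides go between two different presentations of the
  same name.\<close>

lemma rep_unit:
  assumes "pres S X u"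
  shows "rep S X u S (val S) (\<iota> (val S)) (\<iota>\<^bsub>transported\<^esub> S) u"
proof -
  note u = pres_arr[OF assms]
  have "\<iota> (val S) \<cdot> u \<cdot> inv_arr B u = \<iota> (val S)"
    using u(1,5,6) by simp
  then have "lift S u S (\<iota> (val S)) u = \<iota>\<^bsub>transported\<^esub> S"
    by (simp add: lift_def transported_def)
  then show ?thesis
    using rep_lift[OF assms pres_val[OF u(1)], of u] u by (simp add: add.hom_arr)
qed

text \<open>This turns strictness of a structure arrow of \<open>transported\<close> into an equation between presentations.\<close>

lemma rep_identity:
  assumes "rep S X u T Y v x y" "S = T" "v \<cdot> y = u"
  shows "is_identity transported x"
proof -
  have u: "u \<in> Arr B" "Cod B u = val S" "is_iso B u" "S \<in> K"
    and y: "v \<in> Arr B" "y \<in> Arr B" "Dom B v = Cod B y" "Dom B y = Dom B u"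
    and x: "x = (S, v \<cdot> y \<cdot> inv_arr B u, S)"
    using assms(1,2) by (auto simp: rep_def lift_def pres_def add.hom_arr)
  have "v \<cdot> y \<cdot> inv_arr B u = (v \<cdot> y) \<cdot> inv_arr B u"
    by (rule add.comp_assoc_arr[symmetric]) (use u y in simp_all)
  also have "\<dots> = \<iota> (val S)"
    unfolding assms(3) using u by simp
  finally show ?thesis
    using x u(4) by (auto simp: is_identity_def transported_def)
qed

end

section \<open>The inverse equivalence\<close>

text \<open>Since \<open>val\<close> is fully faithful by construction, a choice of a name for each object, up to isomorphism,
  makes it an equivalence.\<close>

locale essentially_surjective_realization =
  realization B K val plus_ob zero_ob times_ob unit_ob plus_iso zero_iso times_iso unit_iso
  for B :: "('o, 'm, 'z) braided_bimon_scheme" (structure) and K :: "'k set" and val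
    and plus_ob zero_ob times_ob unit_ob plus_iso zero_iso times_iso unit_iso +
  fixes sec :: "'o \<Rightarrow> 'k" and sec_iso :: "'o \<Rightarrow> 'm"
  assumes sec_obj [simp]: "a \<in> Obj B \<Longrightarrow> sec a \<in> K"
    and sec_iso: "a \<in> Obj B \<Longrightarrow> sec_iso a \<in> iso_hom B a (val (sec a))"
begin

lemma pres_sec: "a \<in> Obj B \<Longrightarrow> pres (sec a) a (sec_iso a)"
  using sec_iso[of a] by (simp add: pres_def add.iso_hom_arr)

definition sec_arr :: "'m \<Rightarrow> 'k \<times> 'm \<times> 'k" where
  "sec_arr f = lift (sec (Dom B f)) (sec_iso (Dom B f)) (sec (Cod B f)) (sec_iso (Cod B f)) f"

definition sec_functor :: "('o, 'm, 'k, 'k \<times> 'm \<times> 'k) bimon_funct" where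
  "sec_functor = \<lparr>fobj = sec, farr = sec_arr,
     add2 = (\<lambda>a b. lift (plus_ob (sec a) (sec b)) (plus_pres (sec a) (sec_iso a) (sec b) (sec_iso b))
        (sec (a \<oplus> b)) (sec_iso (a \<oplus> b)) (\<iota> (a \<oplus> b))),
     add0 = lift zero_ob zero_iso (sec \<zero>) (sec_iso \<zero>) (\<iota> \<zero>),
     mul2 = (\<lambda>a b. lift (times_ob (sec a) (sec b)) (times_pres (sec a) (sec_iso a) (sec b) (sec_iso b))
        (sec (a \<otimes> b)) (sec_iso (a \<otimes> b)) (\<iota> (a \<otimes> b))),
     mul0 = lift unit_ob unit_iso (sec \<one>) (sec_iso \<one>) (\<iota> \<one>)\<rparr>"

lemma sec_functor_simps [simp]: "fobj sec_functor = sec" "farr sec_functor = sec_arr"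
  by (simp_all add: sec_functor_def)

lemma rep_sec_arr:
  assumes "f \<in> hom B a b"
  shows "rep (sec a) a (sec_iso a) (sec b) b (sec_iso b) (sec_arr f) f"
  unfolding sec_arr_def using assms add.dom_obj[of f] add.cod_obj[of f]
  by (auto simp: add.hom_arr intro!: rep_lift pres_sec)

text \<open>With respect to the presentations of \<open>sec a\<close> by \<open>a\<close>, the coherence arrows of \<open>sec_functor\<close> are
  represented by identities, and \<open>sec_arr f\<close> is represented by \<open>f\<close>. The axioms of a strong functor
  thereby become trivial.\<close>

lemma rep_add2:
  "\<lbrakk>a \<in> Obj B; b \<in> Obj B\<rbrakk> \<Longrightarrow>
    rep (plus_ob (sec a) (sec b)) (a \<oplus> b) (plus_pres (sec a) (sec_iso a) (sec b) (sec_iso b))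
      (sec (a \<oplus> b)) (a \<oplus> b) (sec_iso (a \<oplus> b)) (add2 sec_functor a b) (\<iota> (a \<oplus> b))"
  by (simp add: sec_functor_def) (intro rep_lift pres_sec pres_plus, simp_all add: add.hom_arr)

lemma rep_add0: "rep zero_ob \<zero> zero_iso (sec \<zero>) \<zero> (sec_iso \<zero>) (add0 sec_functor) (\<iota> \<zero>)"
  by (simp add: sec_functor_def) (intro rep_lift pres_sec pres_zero, simp_all add: add.hom_arr)

lemma rep_mul2:
  "\<lbrakk>a \<in> Obj B; b \<in> Obj B\<rbrakk> \<Longrightarrow>
    rep (times_ob (sec a) (sec b)) (a \<otimes> b) (times_pres (sec a) (sec_iso a) (sec b) (sec_iso b))
      (sec (a \<otimes> b)) (a \<otimes> b) (sec_iso (a \<otimes> b)) (mul2 sec_functor a b) (\<iota> (a \<otimes> b))"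
  by (simp add: sec_functor_def) (intro rep_lift pres_sec pres_times, simp_all add: add.hom_arr)

lemma rep_mul0: "rep unit_ob \<one> unit_iso (sec \<one>) \<one> (sec_iso \<one>) (mul0 sec_functor) (\<iota> \<one>)"
  by (simp add: sec_functor_def) (intro rep_lift pres_sec pres_unit, simp_all add: add.hom_arr)

lemmas sec_rules = rep_structure rep_add2 rep_add0 rep_mul2 rep_mul0 rep_sec_arr pres_sec
  add.tensor_obj mul.tensor_obj add.unit_obj mul.unit_obj

lemma sec_functor_functor: "cat_functor B transported sec_functor"
  apply unfold_locales
  apply (simp_all only: transported_simps sec_functor_simps)
  subgoal by simp
  subgoal by (rule rep_hom, (rule sec_rules | assumption)+)
  subgoal by (rule rep_eqI, (rule sec_rules add.id_hom | assumption)+, simp)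
  subgoal by (rule rep_eqI, (rule sec_rules add.comp_hom | assumption)+, simp)
  done

lemma sec_functor_strong: "strong_braided_bimonoidal_functor B transported sec_functor"
proof -
  interpret P: tight_braided_bimonoidal_category transported by (rule transported_bimonoidal)
  interpret cat_functor B transported sec_functor by (rule sec_functor_functor)
  show ?thesis
    apply unfold_locales
    apply (simp_all only: transported_simps sec_functor_simps)
    subgoal by (rule rep_hom, (rule sec_rules | assumption)+)
    subgoal by (rule rep_eqI, (rule sec_rules add.tensor_hom | assumption | erule add.hom_obj)+, auto simp: add.hom_arr)
    subgoal by (rule rep_hom, (rule sec_rules | assumption)+)
    subgoal by (rule rep_eqI, (rule sec_rules add.iso_homD[OF add.assoc_iso] | assumption)+, simp)
    subgoal by (rule rep_eqI, (rule sec_rules add.iso_homD[OF add.lunit_iso] | assumption)+, simp)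
    subgoal by (rule rep_eqI, (rule sec_rules add.iso_homD[OF add.runit_iso] | assumption)+, simp)
    subgoal by (rule rep_eqI, (rule sec_rules add.iso_homD[OF add.braid_iso] | assumption)+, simp)
    subgoal by (rule rep_hom, (rule sec_rules | assumption)+)
    subgoal by (rule rep_eqI, (rule sec_rules mul.tensor_hom | assumption | erule add.hom_obj)+, auto simp: add.hom_arr)
    subgoal by (rule rep_hom, (rule sec_rules | assumption)+)
    subgoal by (rule rep_eqI, (rule sec_rules add.iso_homD[OF mul.assoc_iso] | assumption)+, simp)
    subgoal by (rule rep_eqI, (rule sec_rules add.iso_homD[OF mul.lunit_iso] | assumption)+, simp)
    subgoal by (rule rep_eqI, (rule sec_rules add.iso_homD[OF mul.runit_iso] | assumption)+, simp)
    subgoal by (rule rep_eqI, (rule sec_rules add.iso_homD[OF mul.braid_iso] | assumption)+, simp)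
    subgoal by (rule rep_eqI, (rule sec_rules add.iso_homD[OF lnull_iso] | assumption)+, simp)
    subgoal by (rule rep_eqI, (rule sec_rules add.mono_homD[OF ldist_mono] | assumption)+, simp)
    subgoal by (rule rep_is_iso, (rule sec_rules | assumption)+, simp)
    subgoal by (rule rep_is_iso, (rule sec_rules | assumption)+, simp)
    subgoal by (rule rep_is_iso, (rule sec_rules | assumption)+, simp)
    subgoal by (rule rep_is_iso, (rule sec_rules | assumption)+, simp)
    done
qed

definition counit :: "'k \<Rightarrow> 'k \<times> 'm \<times> 'k" where
  "counit S = lift (sec (val S)) (sec_iso (val S)) S (\<iota> (val S)) (\<iota> (val S))"

lemma rep_counit:
  "S \<in> K \<Longrightarrow> rep (sec (val S)) (val S) (sec_iso (val S)) S (val S) (\<iota> (val S)) (counit S) (\<iota> (val S))"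
  unfolding counit_def by (intro rep_lift pres_sec pres_val) (simp_all add: add.hom_arr)

lemma transported_equivalence: "adjoint_equivalence B transported sec_functor val_functor sec_iso counit"
proof -
  have F: "cat_functor B transported sec_functor" and G: "cat_functor transported B val_functor"
    by (rule sec_functor_functor val_functor_functor)+
  interpret F: cat_functor B transported sec_functor by (rule F)
  interpret G: cat_functor transported B val_functor by (rule G)
  interpret GF: cat_functor B B "comp_funct val_functor sec_functor" by (rule comp_cat_functor[OF F G])
  interpret FG: cat_functor transported transported "comp_funct sec_functor val_functor"
    by (rule comp_cat_functor[OF G F])
  interpret I: cat_functor B B id_funct by (rule id_cat_functor) (rule add.category_axioms)
  interpret J: cat_functor transported transported id_funct by (rule id_cat_functor) (rule trans.category_axioms)
  show ?thesis
  proof (unfold_locales, simp_all only: transported_simps sec_functor_simps val_functor_simps id_funct_def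
        comp_funct_def funct.simps)
    show "sec_iso a \<in> iso_hom B a (val (sec a))" if "a \<in> Obj B" for a
      by (rule sec_iso[OF that])
    show "sec_iso b \<cdot> f = val_arr (sec_arr f) \<cdot> sec_iso a" if "f \<in> hom B a b" for f a b
      by (rule rep_square[OF rep_sec_arr[OF that], symmetric])
    show "counit S \<in> iso_hom transported (sec (val S)) S" if "S \<in> K" for S
      by (rule rep_iso_hom[OF rep_counit[OF that]]) (simp add: that)
    show "counit T \<cdot>\<^bsub>transported\<^esub> sec_arr (val_arr x) = x \<cdot>\<^bsub>transported\<^esub> counit S"
      if "x \<in> hom transported S T" for x S T
      by (rule rep_eqI[OF rep_comp[OF rep_counit rep_sec_arr] rep_comp[OF rep_arr rep_counit]])
        (use that hom_ends[OF that] in \<open>simp_all add: val_arr_hom\<close>)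
    show "val_arr (counit S) \<cdot> sec_iso (val S) = \<iota> (val S)" if "S \<in> K" for S
      using rep_square[OF rep_counit[OF that]] that by simp
    show "counit (sec a) \<cdot>\<^bsub>transported\<^esub> sec_arr (sec_iso a) = \<iota>\<^bsub>transported\<^esub> (sec a)" if a: "a \<in> Obj B" for a
    proof -
      have "sec_iso a \<in> hom B a (val (sec a))"
        using sec_iso[OF a] by (simp add: iso_hom_def)
      then have r: "rep (sec a) a (sec_iso a) (sec a) (val (sec a)) (\<iota> (val (sec a)))
          (counit (sec a) \<cdot>\<^bsub>transported\<^esub> sec_arr (sec_iso a)) (\<iota> (val (sec a)) \<cdot> sec_iso a)"
        by (intro rep_comp[OF rep_counit rep_sec_arr] sec_obj a)
      show ?thesis
        by (rule rep_eqI[OF r rep_unit[OF pres_sec[OF a]]])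
          (use sec_iso[OF a] in \<open>simp add: add.iso_hom_arr\<close>)
    qed
  qed
qed

end

section \<open>Strictness\<close>

text \<open>Operations on names that satisfy the laws strictly, and coherence of the isomorphisms with those
  structure arrows of \<open>B\<close> that are to become identities.\<close>

locale strict_realization = realization +
  assumes plus_ob_assoc: "\<lbrakk>S \<in> K; T \<in> K; U \<in> K\<rbrakk> \<Longrightarrow> plus_ob (plus_ob S T) U = plus_ob S (plus_ob T U)"
    and plus_ob_zero: "S \<in> K \<Longrightarrow> plus_ob zero_ob S = S" "S \<in> K \<Longrightarrow> plus_ob S zero_ob = S"
    and times_ob_assoc: "\<lbrakk>S \<in> K; T \<in> K; U \<in> K\<rbrakk> \<Longrightarrow> times_ob (times_ob S T) U = times_ob S (times_ob T U)"
    and times_ob_unit: "S \<in> K \<Longrightarrow> times_ob unit_ob S = S" "S \<in> K \<Longrightarrow> times_ob S unit_ob = S"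
    and times_ob_zero: "S \<in> K \<Longrightarrow> times_ob zero_ob S = zero_ob" "S \<in> K \<Longrightarrow> times_ob S zero_ob = zero_ob"
    and times_ob_plus: "\<lbrakk>S \<in> K; T \<in> K; U \<in> K\<rbrakk> \<Longrightarrow> times_ob S (plus_ob T U) = plus_ob (times_ob S T) (times_ob S U)"
    and plus_iso_assoc: "\<lbrakk>S \<in> K; T \<in> K; U \<in> K\<rbrakk> \<Longrightarrow>
      plus_iso (plus_ob S T) U \<cdot> (plus_iso S T \<boxplus> \<iota> (val U))
        = plus_iso S (plus_ob T U) \<cdot> (\<iota> (val S) \<boxplus> plus_iso T U) \<cdot> \<alpha>\<^sup>\<oplus> (val S) (val T) (val U)"
    and plus_iso_lunit: "S \<in> K \<Longrightarrow> plus_iso zero_ob S \<cdot> (zero_iso \<boxplus> \<iota> (val S)) = \<lambda>\<^sup>\<oplus> (val S)"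
    and plus_iso_runit: "S \<in> K \<Longrightarrow> plus_iso S zero_ob \<cdot> (\<iota> (val S) \<boxplus> zero_iso) = \<rho>\<^sup>\<oplus> (val S)"
    and times_iso_assoc: "\<lbrakk>S \<in> K; T \<in> K; U \<in> K\<rbrakk> \<Longrightarrow>
      times_iso (times_ob S T) U \<cdot> (times_iso S T \<boxtimes> \<iota> (val U))
        = times_iso S (times_ob T U) \<cdot> (\<iota> (val S) \<boxtimes> times_iso T U) \<cdot> \<alpha>\<^sup>\<otimes> (val S) (val T) (val U)"
    and times_iso_lunit: "S \<in> K \<Longrightarrow> times_iso unit_ob S \<cdot> (unit_iso \<boxtimes> \<iota> (val S)) = \<lambda>\<^sup>\<otimes> (val S)"
    and times_iso_runit: "S \<in> K \<Longrightarrow> times_iso S unit_ob \<cdot> (\<iota> (val S) \<boxtimes> unit_iso) = \<rho>\<^sup>\<otimes> (val S)"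
    and times_iso_lnull: "S \<in> K \<Longrightarrow> times_iso zero_ob S \<cdot> (zero_iso \<boxtimes> \<iota> (val S)) = zero_iso \<cdot> \<lambda>\<^sup>\<bullet> (val S)"
    and times_iso_rnull: "S \<in> K \<Longrightarrow> times_iso S zero_ob \<cdot> (\<iota> (val S) \<boxtimes> zero_iso) = zero_iso \<cdot> \<rho>\<^sup>\<bullet> (val S)"
    and times_iso_ldist: "\<lbrakk>S \<in> K; T \<in> K; U \<in> K\<rbrakk> \<Longrightarrow>
      times_iso S (plus_ob T U) \<cdot> (\<iota> (val S) \<boxtimes> plus_iso T U)
        = plus_iso (times_ob S T) (times_ob S U) \<cdot> (times_iso S T \<boxplus> times_iso S U) \<cdot> \<delta>\<^sup>l (val S) (val T) (val U)"
begin

text \<open>For all but the braidings with zero this is \<open>rep_identity\<close>. Those are determined by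
  \<open>lnull_mul_braid\<close> and \<open>rnull_mul_braid\<close> once the null isomorphisms are identities.\<close>

lemma transported_left_permbraided: "left_permbraided_category transported"
proof -
  interpret P: tight_braided_bimonoidal_category transported by (rule transported_bimonoidal)
  have lnull: "is_identity transported (\<lambda>\<^sup>\<bullet>\<^bsub>transported\<^esub> a)" if "a \<in> K" for a
    by (rule rep_identity[OF rep_lnull[OF pres_val]])
      (use that in \<open>simp_all add: plus_pres_def times_pres_def times_ob_zero times_iso_lnull\<close>)
  have rnull: "is_identity transported (\<rho>\<^sup>\<bullet>\<^bsub>transported\<^esub> a)" if "a \<in> K" for a
    by (rule rep_identity[OF rep_rnull[OF pres_val]])
      (use that in \<open>simp_all add: plus_pres_def times_pres_def times_ob_zero times_iso_rnull\<close>)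
  have unit_of_null: "\<lambda>\<^sup>\<bullet>\<^bsub>transported\<^esub> a = \<iota>\<^bsub>transported\<^esub> zero_ob" "\<rho>\<^sup>\<bullet>\<^bsub>transported\<^esub> a = \<iota>\<^bsub>transported\<^esub> zero_ob" if "a \<in> K" for a
    using trans.identity_eq[OF lnull[OF that]] trans.identity_eq[OF rnull[OF that]] that
    by simp_all
  have z: "is_identity transported (\<iota>\<^bsub>transported\<^esub> zero_ob)"
    by (auto simp: is_identity_def)
  show ?thesis
  proof (unfold_locales, simp_all only: transported_simps)
    show "is_identity transported (\<zeta>\<^sup>\<otimes>\<^bsub>transported\<^esub> a zero_ob)" if "a \<in> K" for a
      using P.lnull_mul_braid[of a] that z by (simp add: unit_of_null times_ob_zero)
    show "is_identity transported (\<zeta>\<^sup>\<otimes>\<^bsub>transported\<^esub> zero_ob a)" if "a \<in> K" for a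
      using P.rnull_mul_braid[of a] that z by (simp add: unit_of_null times_ob_zero)
    show "is_identity transported (\<alpha>\<^sup>\<oplus>\<^bsub>transported\<^esub> a b c)" if "a \<in> K" "b \<in> K" "c \<in> K" for a b c
      by (rule rep_identity[OF rep_add_assoc[OF pres_val pres_val pres_val]])
        (use that in \<open>simp_all add: plus_pres_def plus_ob_assoc plus_iso_assoc[unfolded plus_ob_assoc]\<close>)
    show "is_identity transported (\<lambda>\<^sup>\<oplus>\<^bsub>transported\<^esub> a)" if "a \<in> K" for a
      by (rule rep_identity[OF rep_add_lunit[OF pres_val]])
        (use that in \<open>simp_all add: plus_pres_def plus_ob_zero plus_iso_lunit\<close>)
    show "is_identity transported (\<rho>\<^sup>\<oplus>\<^bsub>transported\<^esub> a)" if "a \<in> K" for a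
      by (rule rep_identity[OF rep_add_runit[OF pres_val]])
        (use that in \<open>simp_all add: plus_pres_def plus_ob_zero plus_iso_runit\<close>)
    show "is_identity transported (\<alpha>\<^sup>\<otimes>\<^bsub>transported\<^esub> a b c)" if "a \<in> K" "b \<in> K" "c \<in> K" for a b c
      by (rule rep_identity[OF rep_mul_assoc[OF pres_val pres_val pres_val]])
        (use that in \<open>simp_all add: times_pres_def times_ob_assoc times_iso_assoc\<close>)
    show "is_identity transported (\<lambda>\<^sup>\<otimes>\<^bsub>transported\<^esub> a)" if "a \<in> K" for a
      by (rule rep_identity[OF rep_mul_lunit[OF pres_val]])
        (use that in \<open>simp_all add: times_pres_def times_ob_unit times_iso_lunit\<close>)
    show "is_identity transported (\<rho>\<^sup>\<otimes>\<^bsub>transported\<^esub> a)" if "a \<in> K" for a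
      by (rule rep_identity[OF rep_mul_runit[OF pres_val]])
        (use that in \<open>simp_all add: times_pres_def times_ob_unit times_iso_runit\<close>)
    show "is_identity transported (\<delta>\<^sup>l\<^bsub>transported\<^esub> a b c)" if "a \<in> K" "b \<in> K" "c \<in> K" for a b c
      by (rule rep_identity[OF rep_ldist[OF pres_val pres_val pres_val]])
        (use that in \<open>simp_all add: plus_pres_def times_pres_def times_ob_plus times_iso_ldist\<close>)
  qed (rule lnull rnull; assumption)+
qed

end

section \<open>Strictification by polynomials\<close>

context tight_braided_bimonoidal_category
begin

lemma list_realization:
  "strict_realization B polys sums (@) [] prods [[]] append_iso (\<iota> \<zero>) prods_iso (inv_arr B (\<rho>\<^sup>\<oplus> \<one>))"
  by unfold_locales (simp_all add: add.iso_hom_arr append_iso_assoc append_iso_nil prods_iso_nil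
    prods_iso_one_left prods_iso_one_right prods_iso_append prods_iso_assoc
    del: prods_iso.simps(2))

lemma list_section:
  "essentially_surjective_realization B polys sums (@) [] prods [[]] append_iso (\<iota> \<zero>) prods_iso
    (inv_arr B (\<rho>\<^sup>\<oplus> \<one>)) (\<lambda>a. [[a]]) (\<lambda>a. inv_arr B (\<rho>\<^sup>\<otimes> a \<cdot> \<rho>\<^sup>\<oplus> (a \<otimes> \<one>)))"
proof -
  interpret strict_realization B polys sums "(@)" "[]" prods "[[]]" append_iso "\<iota> \<zero>" prods_iso
    "inv_arr B (\<rho>\<^sup>\<oplus> \<one>)" by (rule list_realization)
  show ?thesis by unfold_locales (simp_all add: add.iso_hom_arr)
qed

end

theorem mainTheorem11:
  fixes C :: "('o, 'm) braided_bimon"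
  assumes "tight_braided_bimonoidal_category C"
  shows "\<exists>(A :: ('o list list, 'o list list \<times> 'm \<times> 'o list list) braided_bimon)
      (F :: ('o, 'm, 'o list list, 'o list list \<times> 'm \<times> 'o list list) bimon_funct)
      (G :: ('o list list, 'o list list \<times> 'm \<times> 'o list list, 'o, 'm) bimon_funct) \<eta> \<epsilon>.
    left_permbraided_category A \<and>
    strong_braided_bimonoidal_functor C A F \<and>
    strong_braided_bimonoidal_functor A C G \<and>
    adjoint_equivalence C A F G \<eta> \<epsilon>"
proof -
  interpret tight_braided_bimonoidal_category C by (rule assms)
  interpret S: strict_realization C polys sums "(@)" "[]" prods "[[]]" append_iso
    "\<iota>\<^bsub>C\<^esub> \<zero>\<^bsub>C\<^esub>" prods_iso "inv_arr C (\<rho>\<^sup>\<oplus>\<^bsub>C\<^esub> \<one>\<^bsub>C\<^esub>)"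
    by (rule list_realization)
  interpret E: essentially_surjective_realization C polys sums "(@)" "[]" prods "[[]]" append_iso
    "\<iota>\<^bsub>C\<^esub> \<zero>\<^bsub>C\<^esub>" prods_iso "inv_arr C (\<rho>\<^sup>\<oplus>\<^bsub>C\<^esub> \<one>\<^bsub>C\<^esub>)"
    "\<lambda>a. [[a]]" "\<lambda>a. inv_arr C (\<rho>\<^sup>\<otimes>\<^bsub>C\<^esub> a \<cdot>\<^bsub>C\<^esub> \<rho>\<^sup>\<oplus>\<^bsub>C\<^esub> (a \<otimes>\<^bsub>C\<^esub> \<one>\<^bsub>C\<^esub>))"
    by (rule list_section)
  show ?thesis
    using S.transported_left_permbraided E.sec_functor_strong S.val_functor_strong
      E.transported_equivalence by blast
qed

end
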